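(* Let $\mathcal A$ be a $\mathbb Q$-Karoubian additive category, in which $2$ is inverted, with a tensor product satisfying the usual associativity, commutativity and unit constraints, and let $F:\mathrm{Fin}^{\mathrm{opp}}\to\mathcal A$ be a functor with a natural transformation $N(S,T):F(S)\otimes F(T)\to F(S\amalg T)$ satisfying the axioms (1)–(4) listed in the context. Write $F(n)=F([n])$ and let $F(n)F(\widetilde{w_n})$ denote the image of $F(\widetilde{w_n}):F(n)\to F(n)$. Let $$\mathcal P_F=\bigoplus_{n=1}^{\infty}F(n)F(\widetilde{w_n}),\qquad \mathcal P_F^M=\bigoplus_{n=1}^{M}F(n)F(\widetilde{w_n})\quad(M\ge 1).$$ Then $\mathcal P_F$ and $\mathcal P_F^M$, with differential induced by the maps $F(f_n):F(n)\to F(n+1)$ and bracket induced by the maps $$[\,,]_{p,q}=N([p],[q])-(-1)^{pq}\,N([q],[p])\circ c_{p,q}:F(p)\otimes F(q)\to F(p+q)$$ (with $c_{p,q}:F(p)\otimes F(q)\to F(q)\otimes F(p)$ the commutativity constraint; in $\mathcal P_F^M$ the bracket is $0$ when $p+q>M$ and the differential is $0$ on the summand $n=M$), are differential graded Lie algebras in $\mathcal A$. In particular these differentials and brackets restrict to the images $F(n)F(\widetilde{w_n})$.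
   Context: $\mathrm{Fin}$ is the category of finite sets and all maps; $[n]=\{1,\dots,n\}$. $\mathcal D$ is the category with the same objects as $\mathrm{Fin}$ and $\mathrm{Hom}_{\mathcal D}(X,Y)=\mathbb Z[\mathrm{Hom}_{\mathrm{Fin}}(X,Y)]$ (free abelian group, bilinear composition). A functor $F:\mathrm{Fin}^{\mathrm{opp}}\to\mathcal A$ to an additive category extends uniquely to an additive functor on $\mathcal D^{\mathrm{opp}}$, again called $F$. The tensor product $\otimes$ on $\mathcal A$ is additive in each variable, with unit $1_{\mathcal A}$. The disjoint union $[p]\amalg[q]$ is identified with $[p+q]$ by placing $[p]$ first. "$2$ is inverted" means that multiplication by $2$ is invertible on the Hom groups of $\mathcal A$. $\mathbb Q$-Karoubian: for any $f:M\to M$ in $\mathcal A$ such that $f\circ f=n\cdot f$ for some integer $n$, the image of $f$ is an object of $\mathcal A$. Axioms on $(F,N)$: (1) $F(\emptyset)=1_{\mathcal A}$. (2) $N(\emptyset,S):F(\emptyset)\otimes F(S)\to F(S)$ and $N(S,\emptyset):F(S)\otimes F(\emptyset)\to F(S)$ are the canonical unit identifications. (3) (commutativity) If $\sigma:T\amalg S\to S\amalg T$ is the switch map, then $F(\sigma)\circ N(S,T)=N(T,S)\circ c$, where $c:F(S)\otimes F(T)\to F(T)\otimes F(S)$ is the commutativity constraint. (4) (associativity) $N(R\amalg S,T)\circ(N(R,S)\otimes 1)=N(R,S\amalg T)\circ(1\otimes N(S,T))$ modulo the associativity constraint. $N$ is natural in both variables. No isomorphism or quasi-isomorphism assumption is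 made on $N$. The maps $f_n$: for $1\le i\le n$ let $\delta_i:[n+1]\to[n]$ be $\delta_i(j)=j$ if $j\le i$ and $\delta_i(j)=j-1$ if $j>i$; $f_n=\sum_{i=1}^n(-1)^{i-1}\delta_i\in\mathrm{Hom}_{\mathcal D}([n+1],[n])$. The elements $\widetilde{w_n}$: $\Sigma_n$ acts on the right on words $(x_1,\dots,x_n)$ by place permutation, $\sigma$ moving the entry in position $i$ to position $\sigma(i)$; correspondingly, in $\mathbb Z[\Sigma_n]$ the product $\sigma\tau$ means "first $\sigma$, then $\tau$". With $c_i=(1\,2\,\cdots\,i)$, put $w_1=1$ and $w_n=(1+c_2)(1-c_3)\cdots(1+(-1)^nc_n)\in\mathbb Z[\Sigma_n]$. $\widetilde{w_n}\in\mathrm{Hom}_{\mathcal D}([n],[n])$ is the unique element such that for every finite set $S$ the precomposition map $\mathrm{Hom}_{\mathcal D}(\widetilde{w_n},S)$ on $\mathrm{Hom}_{\mathcal D}([n],S)=\mathbb Z[S]^{\otimes n}$ is the right action of $w_n$ (explicitly, if $w_n=\sum a_\sigma\sigma$ then $\widetilde{w_n}=\sum a_\sigma\sigma^{-1}$). One has $\widetilde{w_n}^2=n\widetilde{w_n}$. A differential graded Lie algebra in $\mathcal A$ here is a sequence of objects $P(n)$, $n\ge 1$ (the direct sum is understood as this graded object), with morphisms $d:P(n)\to P(n+1)$, $d^2=0$, and $[\,,]:P(p)\otimes P(q)\to P(p+q)$ satisfying graded antisymmetry $[x,y]=-(-1)^{pq}[y,x]$, the graded Jacobi identity $[x,[y,z]]=[[x,y],z]+(-1)^{pq}[y,[x,z]]$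 and the Leibniz rule $d[x,y]=[dx,y]+(-1)^p[x,dy]$ for $x,y$ of degrees $p,q$ (expressed as identities of morphisms using the constraints of $\mathcal A$). *)

theory Defs
  imports "HOL-Algebra.Free_Abelian_Groups" "HOL-Library.Nat_Bijection"
    "HOL-Combinatorics.Permutations"
begin

section \<open>Additive tensor categories\<close>

record ('o, 'm) category_data =
  Obj :: "'o set"
  Arr :: "'m set"
  Src :: "'m \<Rightarrow> 'o"
  Tgt :: "'m \<Rightarrow> 'o"
  Idt :: "'o \<Rightarrow> 'm"
  Cmp :: "'m \<Rightarrow> 'm \<Rightarrow> 'm"  (infixl "\<cdot>\<index>" 70)

definition Hom :: "('o, 'm, 'z) category_data_scheme \<Rightarrow> 'o \<Rightarrow> 'o \<Rightarrow> 'm set" where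
  "Hom A X Y = {f \<in> Arr A. Src A f = X \<and> Tgt A f = Y}"

locale small_category =
  fixes A :: "('o, 'm, 'z) category_data_scheme" (structure)
  assumes src_obj: "f \<in> Arr A \<Longrightarrow> Src A f \<in> Obj A"
    and tgt_obj: "f \<in> Arr A \<Longrightarrow> Tgt A f \<in> Obj A"
    and id_hom: "X \<in> Obj A \<Longrightarrow> Idt A X \<in> Hom A X X"
    and comp_hom: "\<lbrakk>f \<in> Hom A X Y; g \<in> Hom A Y Z\<rbrakk> \<Longrightarrow> g \<cdot> f \<in> Hom A X Z"
    and id_right: "f \<in> Hom A X Y \<Longrightarrow> f \<cdot> Idt A X = f"
    and id_left: "f \<in> Hom A X Y \<Longrightarrow> Idt A Y \<cdot> f = f"
    and comp_assoc:
      "\<lbrakk>f \<in> Hom A W X; g \<in> Hom A X Y; h \<in> Hom A Y Z\<rbrakk> \<Longrightarrow> h \<cdot> (g \<cdot> f) = (h \<cdot> g) \<cdot> f"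

definition is_isomorphism :: "('o, 'm, 'z) category_data_scheme \<Rightarrow> 'o \<Rightarrow> 'o \<Rightarrow> 'm \<Rightarrow> bool" where
  "is_isomorphism A X Y f \<longleftrightarrow> f \<in> Hom A X Y \<and>
     (\<exists>g \<in> Hom A Y X. g \<cdot>\<^bsub>A\<^esub> f = Idt A X \<and> f \<cdot>\<^bsub>A\<^esub> g = Idt A Y)"

definition is_mono :: "('o, 'm, 'z) category_data_scheme \<Rightarrow> 'o \<Rightarrow> 'o \<Rightarrow> 'm \<Rightarrow> bool" where
  "is_mono A X Y f \<longleftrightarrow> f \<in> Hom A X Y \<and>
     (\<forall>W. \<forall>g \<in> Hom A W X. \<forall>h \<in> Hom A W X. f \<cdot>\<^bsub>A\<^esub> g = f \<cdot>\<^bsub>A\<^esub> h \<longrightarrow> g = h)"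

definition is_epi :: "('o, 'm, 'z) category_data_scheme \<Rightarrow> 'o \<Rightarrow> 'o \<Rightarrow> 'm \<Rightarrow> bool" where
  "is_epi A X Y f \<longleftrightarrow> f \<in> Hom A X Y \<and>
     (\<forall>W. \<forall>g \<in> Hom A Y W. \<forall>h \<in> Hom A Y W. g \<cdot>\<^bsub>A\<^esub> f = h \<cdot>\<^bsub>A\<^esub> f \<longrightarrow> g = h)"

text \<open>The image of \<open>f : X \<rightarrow> Y\<close> is the least subobject \<open>i : I \<rightarrow> Y\<close> through which \<open>f\<close> factors, the
  factorisation \<open>f = i e\<close> being an epi-mono factorisation. (In a category with equalisers \<open>e\<close> is
  automatically epi; a general additive category need not have equalisers.)\<close>

definition is_image ::
  "('o, 'm, 'z) category_data_scheme \<Rightarrow> 'o \<Rightarrow> 'o \<Rightarrow> 'm \<Rightarrow> 'o \<Rightarrow> 'm \<Rightarrow> bool" where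
  "is_image A X Y f I i \<longleftrightarrow> is_mono A I Y i \<and>
     (\<exists>e. is_epi A X I e \<and> f = i \<cdot>\<^bsub>A\<^esub> e) \<and>
     (\<forall>J j g. is_mono A J Y j \<and> g \<in> Hom A X J \<and> f = j \<cdot>\<^bsub>A\<^esub> g \<longrightarrow>
        (\<exists>u \<in> Hom A I J. i = j \<cdot>\<^bsub>A\<^esub> u))"

record ('o, 'm) additive_data = "('o, 'm) category_data" +
  Add :: "'m \<Rightarrow> 'm \<Rightarrow> 'm"  (infixl "\<boxplus>\<index>" 65)
  Zer :: "'o \<Rightarrow> 'o \<Rightarrow> 'm"

text \<open>The additive group of morphisms, as a multiplicatively written group: \<open>f [^] n\<close> is the
  \<open>n\<close>-fold sum \<open>n f\<close>.\<close>

definition hom_group :: "('o, 'm, 'z) additive_data_scheme \<Rightarrow> 'o \<Rightarrow> 'o \<Rightarrow> 'm monoid" where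
  "hom_group A X Y = \<lparr>carrier = Hom A X Y, monoid.mult = Add A, one = Zer A X Y\<rparr>"

definition scal :: "('o, 'm, 'z) additive_data_scheme \<Rightarrow> int \<Rightarrow> 'm \<Rightarrow> 'm" where
  "scal A n f = f [^]\<^bsub>hom_group A (Src A f) (Tgt A f)\<^esub> n"

definition is_zero_object :: "('o, 'm, 'z) additive_data_scheme \<Rightarrow> 'o \<Rightarrow> bool" where
  "is_zero_object A Z \<longleftrightarrow> Z \<in> Obj A \<and> Idt A Z = Zer A Z Z"

locale additive_category = small_category A
  for A :: "('o, 'm, 'z) additive_data_scheme" (structure) +
  assumes hom_comm_group: "\<lbrakk>X \<in> Obj A; Y \<in> Obj A\<rbrakk> \<Longrightarrow> comm_group (hom_group A X Y)"
    and comp_add_right: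
      "\<lbrakk>f \<in> Hom A X Y; f' \<in> Hom A X Y; g \<in> Hom A Y Z\<rbrakk> \<Longrightarrow> g \<cdot> (f \<boxplus> f') = g \<cdot> f \<boxplus> g \<cdot> f'"
    and comp_add_left:
      "\<lbrakk>f \<in> Hom A X Y; g \<in> Hom A Y Z; g' \<in> Hom A Y Z\<rbrakk> \<Longrightarrow> (g \<boxplus> g') \<cdot> f = g \<cdot> f \<boxplus> g' \<cdot> f"
    and zero_object: "\<exists>Z. is_zero_object A Z"
    and biproduct: "\<lbrakk>X \<in> Obj A; Y \<in> Obj A\<rbrakk> \<Longrightarrow>
      \<exists>B \<in> Obj A. \<exists>i \<in> Hom A X B. \<exists>j \<in> Hom A Y B. \<exists>p \<in> Hom A B X. \<exists>q \<in> Hom A B Y.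
        p \<cdot> i = Idt A X \<and> q \<cdot> j = Idt A Y \<and> q \<cdot> i = Zer A X Y \<and> p \<cdot> j = Zer A Y X \<and>
        i \<cdot> p \<boxplus> j \<cdot> q = Idt A B"

record ('o, 'm) tensor_data = "('o, 'm) additive_data" +
  TenO :: "'o \<Rightarrow> 'o \<Rightarrow> 'o"  (infixr "\<odot>\<index>" 72)
  TenM :: "'m \<Rightarrow> 'm \<Rightarrow> 'm"  (infixr "\<otimes>\<^sub>m\<index>" 72)
  UnitO :: "'o"
  Asso :: "'o \<Rightarrow> 'o \<Rightarrow> 'o \<Rightarrow> 'm"
  LUnit :: "'o \<Rightarrow> 'm"
  RUnit :: "'o \<Rightarrow> 'm"
  Comm :: "'o \<Rightarrow> 'o \<Rightarrow> 'm"

locale additive_tensor_category = additive_category A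
  for A :: "('o, 'm, 'z) tensor_data_scheme" (structure) +
  assumes unit_obj: "UnitO A \<in> Obj A"
    and ten_obj: "\<lbrakk>X \<in> Obj A; Y \<in> Obj A\<rbrakk> \<Longrightarrow> X \<odot> Y \<in> Obj A"
    and ten_hom: "\<lbrakk>f \<in> Hom A X X'; g \<in> Hom A Y Y'\<rbrakk> \<Longrightarrow> f \<otimes>\<^sub>m g \<in> Hom A (X \<odot> Y) (X' \<odot> Y')"
    and ten_id: "\<lbrakk>X \<in> Obj A; Y \<in> Obj A\<rbrakk> \<Longrightarrow> Idt A X \<otimes>\<^sub>m Idt A Y = Idt A (X \<odot> Y)"
    and ten_comp:
      "\<lbrakk>f \<in> Hom A X X'; f' \<in> Hom A X' X''; g \<in> Hom A Y Y'; g' \<in> Hom A Y' Y''\<rbrakk> \<Longrightarrow>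
         (f' \<cdot> f) \<otimes>\<^sub>m (g' \<cdot> g) = (f' \<otimes>\<^sub>m g') \<cdot> (f \<otimes>\<^sub>m g)"
    and ten_add_left:
      "\<lbrakk>f \<in> Hom A X X'; f' \<in> Hom A X X'; g \<in> Hom A Y Y'\<rbrakk> \<Longrightarrow>
         (f \<boxplus> f') \<otimes>\<^sub>m g = (f \<otimes>\<^sub>m g) \<boxplus> (f' \<otimes>\<^sub>m g)"
    and ten_add_right:
      "\<lbrakk>f \<in> Hom A X X'; g \<in> Hom A Y Y'; g' \<in> Hom A Y Y'\<rbrakk> \<Longrightarrow>
         f \<otimes>\<^sub>m (g \<boxplus> g') = (f \<otimes>\<^sub>m g) \<boxplus> (f \<otimes>\<^sub>m g')"
    and assoc_iso: "\<lbrakk>X \<in> Obj A; Y \<in> Obj A; Z \<in> Obj A\<rbrakk> \<Longrightarrow>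
      is_isomorphism A ((X \<odot> Y) \<odot> Z) (X \<odot> (Y \<odot> Z)) (Asso A X Y Z)"
    and lunit_iso: "X \<in> Obj A \<Longrightarrow> is_isomorphism A (UnitO A \<odot> X) X (LUnit A X)"
    and runit_iso: "X \<in> Obj A \<Longrightarrow> is_isomorphism A (X \<odot> UnitO A) X (RUnit A X)"
    and comm_hom: "\<lbrakk>X \<in> Obj A; Y \<in> Obj A\<rbrakk> \<Longrightarrow> Comm A X Y \<in> Hom A (X \<odot> Y) (Y \<odot> X)"
    and assoc_nat:
      "\<lbrakk>f \<in> Hom A X X'; g \<in> Hom A Y Y'; h \<in> Hom A Z Z'\<rbrakk> \<Longrightarrow>
         Asso A X' Y' Z' \<cdot> ((f \<otimes>\<^sub>m g) \<otimes>\<^sub>m h) = (f \<otimes>\<^sub>m (g \<otimes>\<^sub>m h)) \<cdot> Asso A X Y Z"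
    and lunit_nat:
      "f \<in> Hom A X Y \<Longrightarrow> LUnit A Y \<cdot> (Idt A (UnitO A) \<otimes>\<^sub>m f) = f \<cdot> LUnit A X"
    and runit_nat:
      "f \<in> Hom A X Y \<Longrightarrow> RUnit A Y \<cdot> (f \<otimes>\<^sub>m Idt A (UnitO A)) = f \<cdot> RUnit A X"
    and comm_nat:
      "\<lbrakk>f \<in> Hom A X X'; g \<in> Hom A Y Y'\<rbrakk> \<Longrightarrow> Comm A X' Y' \<cdot> (f \<otimes>\<^sub>m g) = (g \<otimes>\<^sub>m f) \<cdot> Comm A X Y"
    and pentagon: "\<lbrakk>W \<in> Obj A; X \<in> Obj A; Y \<in> Obj A; Z \<in> Obj A\<rbrakk> \<Longrightarrow>
      Asso A W X (Y \<odot> Z) \<cdot> Asso A (W \<odot> X) Y Z =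
      (Idt A W \<otimes>\<^sub>m Asso A X Y Z) \<cdot> Asso A W (X \<odot> Y) Z \<cdot> (Asso A W X Y \<otimes>\<^sub>m Idt A Z)"
    and triangle: "\<lbrakk>X \<in> Obj A; Y \<in> Obj A\<rbrakk> \<Longrightarrow>
      (Idt A X \<otimes>\<^sub>m LUnit A Y) \<cdot> Asso A X (UnitO A) Y = RUnit A X \<otimes>\<^sub>m Idt A Y"
    and hexagon: "\<lbrakk>X \<in> Obj A; Y \<in> Obj A; Z \<in> Obj A\<rbrakk> \<Longrightarrow>
      Asso A Y Z X \<cdot> Comm A X (Y \<odot> Z) \<cdot> Asso A X Y Z =
      (Idt A Y \<otimes>\<^sub>m Comm A X Z) \<cdot> Asso A Y X Z \<cdot> (Comm A X Y \<otimes>\<^sub>m Idt A Z)"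
    and symmetry: "\<lbrakk>X \<in> Obj A; Y \<in> Obj A\<rbrakk> \<Longrightarrow> Comm A Y X \<cdot> Comm A X Y = Idt A (X \<odot> Y)"

definition Q_Karoubian :: "('o, 'm, 'z) additive_data_scheme \<Rightarrow> bool" where
  "Q_Karoubian A \<longleftrightarrow> (\<forall>X \<in> Obj A. \<forall>f \<in> Hom A X X.
     (\<exists>n::int. f \<cdot>\<^bsub>A\<^esub> f = scal A n f) \<longrightarrow> (\<exists>I \<in> Obj A. \<exists>i. is_image A X X f I i))"

definition two_inverted :: "('o, 'm, 'z) additive_data_scheme \<Rightarrow> bool" where
  "two_inverted A \<longleftrightarrow> (\<forall>X \<in> Obj A. \<forall>Y \<in> Obj A. bij_betw (scal A 2) (Hom A X Y) (Hom A X Y))"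

section \<open>Finite sets, and functors on them\<close>

text \<open>\<open>Fin\<close> is modelled by the finite subsets of \<^typ>\<open>nat\<close>, with \<^term>\<open>X \<rightarrow>\<^sub>E Y\<close> as the set of maps from
  \<open>X\<close> to \<open>Y\<close>. The disjoint union is transported along the bijection
  \<^term>\<open>sum_encode :: nat + nat \<Rightarrow> nat\<close>.\<close>

definition inl :: "nat \<Rightarrow> nat" where "inl x = sum_encode (Inl x)"
definition inr :: "nat \<Rightarrow> nat" where "inr x = sum_encode (Inr x)"

definition djunion :: "nat set \<Rightarrow> nat set \<Rightarrow> nat set"  (infixr "\<amalg>" 65) where
  "S \<amalg> T = sum_encode ` (S <+> T)"

definition copair ::
  "nat set \<Rightarrow> nat set \<Rightarrow> (nat \<Rightarrow> nat) \<Rightarrow> (nat \<Rightarrow> nat) \<Rightarrow> nat \<Rightarrow> nat" where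
  "copair S T f g = (\<lambda>z \<in> S \<amalg> T. case sum_decode z of Inl x \<Rightarrow> f x | Inr y \<Rightarrow> g y)"

definition djunion_map ::
  "nat set \<Rightarrow> nat set \<Rightarrow> (nat \<Rightarrow> nat) \<Rightarrow> (nat \<Rightarrow> nat) \<Rightarrow> nat \<Rightarrow> nat" where
  "djunion_map S T \<phi> \<psi> = copair S T (inl \<circ> \<phi>) (inr \<circ> \<psi>)"

definition switch_map :: "nat set \<Rightarrow> nat set \<Rightarrow> nat \<Rightarrow> nat" where
  "switch_map T S = copair T S inr inl"

definition assoc_map :: "nat set \<Rightarrow> nat set \<Rightarrow> nat set \<Rightarrow> nat \<Rightarrow> nat" where
  "assoc_map R S T = copair (R \<amalg> S) T (copair R S inl (inr \<circ> inl)) (inr \<circ> inr)"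

abbreviation ordinal :: "nat \<Rightarrow> nat set"  ("\<lbrakk>_\<rbrakk>\<^sub>n") where
  "\<lbrakk>n\<rbrakk>\<^sub>n \<equiv> {1..n}"

text \<open>The identification of \<open>[p + q]\<close> with \<open>[p] \<amalg> [q]\<close>.\<close>

definition split_map :: "nat \<Rightarrow> nat \<Rightarrow> nat \<Rightarrow> nat" where
  "split_map p q = (\<lambda>k \<in> \<lbrakk>p + q\<rbrakk>\<^sub>n. if k \<le> p then inl k else inr (k - p))"

text \<open>A contravariant functor is given by \<open>Fo\<close> on objects and by \<open>Fm X Y \<phi> : Fo Y \<rightarrow> Fo X\<close> on maps
  \<open>\<phi> : X \<rightarrow> Y\<close>.\<close>

locale Fin_opp_functor = small_category A
  for A :: "('o, 'm, 'z) category_data_scheme" (structure)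
    and Fo :: "nat set \<Rightarrow> 'o"
    and Fm :: "nat set \<Rightarrow> nat set \<Rightarrow> (nat \<Rightarrow> nat) \<Rightarrow> 'm" +
  assumes F_obj: "finite X \<Longrightarrow> Fo X \<in> Obj A"
    and F_hom: "\<lbrakk>finite X; finite Y; \<phi> \<in> X \<rightarrow>\<^sub>E Y\<rbrakk> \<Longrightarrow> Fm X Y \<phi> \<in> Hom A (Fo Y) (Fo X)"
    and F_id: "finite X \<Longrightarrow> Fm X X (\<lambda>x \<in> X. x) = Idt A (Fo X)"
    and F_comp: "\<lbrakk>finite X; finite Y; finite Z; \<phi> \<in> X \<rightarrow>\<^sub>E Y; \<psi> \<in> Y \<rightarrow>\<^sub>E Z\<rbrakk> \<Longrightarrow>
      Fm X Z (compose X \<psi> \<phi>) = Fm X Y \<phi> \<cdot> Fm Y Z \<psi>"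

locale multiplicative_Fin_opp_functor =
  additive_tensor_category A + Fin_opp_functor A Fo Fm
  for A :: "('o, 'm, 'z) tensor_data_scheme" (structure)
    and Fo :: "nat set \<Rightarrow> 'o"
    and Fm :: "nat set \<Rightarrow> nat set \<Rightarrow> (nat \<Rightarrow> nat) \<Rightarrow> 'm"
    and N :: "nat set \<Rightarrow> nat set \<Rightarrow> 'm" +
  assumes N_hom: "\<lbrakk>finite S; finite T\<rbrakk> \<Longrightarrow> N S T \<in> Hom A (Fo S \<odot> Fo T) (Fo (S \<amalg> T))"
    and N_nat:
      "\<lbrakk>finite S; finite S'; finite T; finite T'; \<phi> \<in> S \<rightarrow>\<^sub>E S'; \<psi> \<in> T \<rightarrow>\<^sub>E T'\<rbrakk> \<Longrightarrow>
         Fm (S \<amalg> T) (S' \<amalg> T') (djunion_map S T \<phi> \<psi>) \<cdot> N S' T' =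
         N S T \<cdot> (Fm S S' \<phi> \<otimes>\<^sub>m Fm T T' \<psi>)"
    and F_empty: "Fo {} = UnitO A"
    and N_unit_left:
      "finite S \<Longrightarrow> Fm S ({} \<amalg> S) (\<lambda>x \<in> S. inr x) \<cdot> N {} S = LUnit A (Fo S)"
    and N_unit_right:
      "finite S \<Longrightarrow> Fm S (S \<amalg> {}) (\<lambda>x \<in> S. inl x) \<cdot> N S {} = RUnit A (Fo S)"
    and N_commutative: "\<lbrakk>finite S; finite T\<rbrakk> \<Longrightarrow>
      Fm (T \<amalg> S) (S \<amalg> T) (switch_map T S) \<cdot> N S T = N T S \<cdot> Comm A (Fo S) (Fo T)"
    and N_associative: "\<lbrakk>finite R; finite S; finite T\<rbrakk> \<Longrightarrow>
      N (R \<amalg> S) T \<cdot> (N R S \<otimes>\<^sub>m Idt A (Fo T)) =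
      Fm ((R \<amalg> S) \<amalg> T) (R \<amalg> (S \<amalg> T)) (assoc_map R S T) \<cdot>
        N R (S \<amalg> T) \<cdot> (Idt A (Fo R) \<otimes>\<^sub>m N S T) \<cdot> Asso A (Fo R) (Fo S) (Fo T)"

text \<open>The additive extension of \<open>F\<close> to formal integral combinations of maps
  \<open>X \<rightarrow> Y\<close>, that is to \<^term>\<open>carrier (free_Abelian_group (X \<rightarrow>\<^sub>E Y))\<close>.\<close>

definition F_ext ::
  "('o, 'm, 'z) additive_data_scheme \<Rightarrow> (nat set \<Rightarrow> 'o) \<Rightarrow>
   (nat set \<Rightarrow> nat set \<Rightarrow> (nat \<Rightarrow> nat) \<Rightarrow> 'm) \<Rightarrow> nat set \<Rightarrow> nat set \<Rightarrow> ((nat \<Rightarrow> nat) \<Rightarrow>\<^sub>0 int) \<Rightarrow> 'm"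
  where
  "F_ext A Fo Fm X Y u = finprod (hom_group A (Fo Y) (Fo X))
     (\<lambda>\<phi>. scal A (Poly_Mapping.lookup u \<phi>) (Fm X Y \<phi>)) (Poly_Mapping.keys u)"

section \<open>The morphisms $f_n$ and $\widetilde{w_n}$\<close>

definition delta :: "nat \<Rightarrow> nat \<Rightarrow> nat \<Rightarrow> nat" where
  "delta n i = (\<lambda>j \<in> \<lbrakk>n + 1\<rbrakk>\<^sub>n. if j \<le> i then j else j - 1)"

definition f_elem :: "nat \<Rightarrow> ((nat \<Rightarrow> nat) \<Rightarrow>\<^sub>0 int)" where
  "f_elem n = (\<Sum>i = 1..n. frag_cmul ((-1) ^ (i - 1)) (frag_of (delta n i)))"

text \<open>Integral group rings of permutation groups; \<open>\<sigma> \<tau>\<close> means first \<open>\<sigma>\<close>, then \<open>\<tau>\<close>.\<close>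

definition gr_mult ::
  "((nat \<Rightarrow> nat) \<Rightarrow>\<^sub>0 int) \<Rightarrow> ((nat \<Rightarrow> nat) \<Rightarrow>\<^sub>0 int) \<Rightarrow> ((nat \<Rightarrow> nat) \<Rightarrow>\<^sub>0 int)"  (infixl "\<star>" 70)
  where
  "a \<star> b = frag_extend (\<lambda>\<sigma>. frag_extend (\<lambda>\<tau>. frag_of (\<tau> \<circ> \<sigma>)) b) a"

definition cyc :: "nat \<Rightarrow> nat \<Rightarrow> nat" where
  "cyc i = (\<lambda>k. if 1 \<le> k \<and> k < i then k + 1 else if k = i \<and> 1 \<le> i then 1 else k)"

definition w_elem :: "nat \<Rightarrow> ((nat \<Rightarrow> nat) \<Rightarrow>\<^sub>0 int)" where
  "w_elem n =
     foldl (\<lambda>u i. u \<star> (frag_of id + frag_cmul ((-1) ^ i) (frag_of (cyc i)))) (frag_of id) [2..<n + 1]"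

text \<open>A permutation \<open>\<sigma>\<close> acts on words \<open>x : [n] \<rightarrow> S\<close> from the right by \<open>x \<mapsto> x \<circ> \<sigma>\<^sup>-\<^sup>1\<close>, the precomposition
  with \<open>\<sigma>\<^sup>-\<^sup>1\<close>.\<close>

definition w_tilde :: "nat \<Rightarrow> ((nat \<Rightarrow> nat) \<Rightarrow>\<^sub>0 int)" where
  "w_tilde n = frag_extend (\<lambda>\<sigma>. frag_of (restrict (inv_into UNIV \<sigma>) \<lbrakk>n\<rbrakk>\<^sub>n)) (w_elem n)"

section \<open>Differential graded Lie algebras\<close>

text \<open>Only the components in degrees \<open>\<ge> 1\<close> of the families \<open>P\<close>, \<open>d\<close>, \<open>b\<close> are significant.\<close>

definition is_dg_Lie_algebra ::
  "('o, 'm, 'z) tensor_data_scheme \<Rightarrow> (nat \<Rightarrow> 'o) \<Rightarrow> (nat \<Rightarrow> 'm) \<Rightarrow> (nat \<Rightarrow> nat \<Rightarrow> 'm) \<Rightarrow> bool"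
  where
  "is_dg_Lie_algebra A P d b \<longleftrightarrow>
    (\<forall>n\<ge>1. P n \<in> Obj A) \<and>
    (\<forall>n\<ge>1. d n \<in> Hom A (P n) (P (n + 1))) \<and>
    (\<forall>p\<ge>1. \<forall>q\<ge>1. b p q \<in> Hom A (P p \<odot>\<^bsub>A\<^esub> P q) (P (p + q))) \<and>
    (\<forall>n\<ge>1. d (n + 1) \<cdot>\<^bsub>A\<^esub> d n = Zer A (P n) (P (n + 2))) \<and>
    (\<forall>p\<ge>1. \<forall>q\<ge>1. b p q = scal A (- ((-1) ^ (p * q))) (b q p \<cdot>\<^bsub>A\<^esub> Comm A (P p) (P q))) \<and>
    (\<forall>p\<ge>1. \<forall>q\<ge>1. \<forall>r\<ge>1.
       b p (q + r) \<cdot>\<^bsub>A\<^esub> (Idt A (P p) \<otimes>\<^sub>m\<^bsub>A\<^esub> b q r) \<cdot>\<^bsub>A\<^esub> Asso A (P p) (P q) (P r) =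
       b (p + q) r \<cdot>\<^bsub>A\<^esub> (b p q \<otimes>\<^sub>m\<^bsub>A\<^esub> Idt A (P r)) \<boxplus>\<^bsub>A\<^esub>
       scal A ((-1) ^ (p * q))
         (b q (p + r) \<cdot>\<^bsub>A\<^esub> (Idt A (P q) \<otimes>\<^sub>m\<^bsub>A\<^esub> b p r) \<cdot>\<^bsub>A\<^esub> Asso A (P q) (P p) (P r) \<cdot>\<^bsub>A\<^esub>
           (Comm A (P p) (P q) \<otimes>\<^sub>m\<^bsub>A\<^esub> Idt A (P r)))) \<and>
    (\<forall>p\<ge>1. \<forall>q\<ge>1.
       d (p + q) \<cdot>\<^bsub>A\<^esub> b p q =
       b (p + 1) q \<cdot>\<^bsub>A\<^esub> (d p \<otimes>\<^sub>m\<^bsub>A\<^esub> Idt A (P q)) \<boxplus>\<^bsub>A\<^esub>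
       scal A ((-1) ^ p) (b p (q + 1) \<cdot>\<^bsub>A\<^esub> (Idt A (P p) \<otimes>\<^sub>m\<^bsub>A\<^esub> d q)))"

text \<open>Truncation in degrees \<open>\<le> M\<close>, with a zero object \<open>Z\<close> in all degrees above \<open>M\<close>.\<close>

definition trunc_obj :: "'o \<Rightarrow> nat \<Rightarrow> (nat \<Rightarrow> 'o) \<Rightarrow> nat \<Rightarrow> 'o" where
  "trunc_obj Z M P n = (if n \<le> M then P n else Z)"

definition trunc_diff ::
  "('o, 'm, 'z) additive_data_scheme \<Rightarrow> 'o \<Rightarrow> nat \<Rightarrow> (nat \<Rightarrow> 'o) \<Rightarrow> (nat \<Rightarrow> 'm) \<Rightarrow> nat \<Rightarrow> 'm" where
  "trunc_diff A Z M P d n =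
     (if n < M then d n else Zer A (trunc_obj Z M P n) (trunc_obj Z M P (n + 1)))"

definition trunc_bracket ::
  "('o, 'm, 'z) tensor_data_scheme \<Rightarrow> 'o \<Rightarrow> nat \<Rightarrow> (nat \<Rightarrow> 'o) \<Rightarrow> (nat \<Rightarrow> nat \<Rightarrow> 'm) \<Rightarrow> nat \<Rightarrow> nat \<Rightarrow> 'm"
  where
  "trunc_bracket A Z M P b p q =
     (if p + q \<le> M then b p q
      else Zer A (trunc_obj Z M P p \<odot>\<^bsub>A\<^esub> trunc_obj Z M P q) (trunc_obj Z M P (p + q)))"

section \<open>The graded object $\mathcal P_F$\<close>

text \<open>\<open>N([p],[q])\<close> with values in \<open>F(p + q)\<close>.\<close>

definition N_ord ::
  "('o, 'm, 'z) tensor_data_scheme \<Rightarrow> (nat set \<Rightarrow> nat set \<Rightarrow> (nat \<Rightarrow> nat) \<Rightarrow> 'm) \<Rightarrow>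
   (nat set \<Rightarrow> nat set \<Rightarrow> 'm) \<Rightarrow> nat \<Rightarrow> nat \<Rightarrow> 'm" where
  "N_ord A Fm N p q = Fm \<lbrakk>p + q\<rbrakk>\<^sub>n (\<lbrakk>p\<rbrakk>\<^sub>n \<amalg> \<lbrakk>q\<rbrakk>\<^sub>n) (split_map p q) \<cdot>\<^bsub>A\<^esub> N \<lbrakk>p\<rbrakk>\<^sub>n \<lbrakk>q\<rbrakk>\<^sub>n"

definition F_bracket ::
  "('o, 'm, 'z) tensor_data_scheme \<Rightarrow> (nat set \<Rightarrow> 'o) \<Rightarrow>
   (nat set \<Rightarrow> nat set \<Rightarrow> (nat \<Rightarrow> nat) \<Rightarrow> 'm) \<Rightarrow> (nat set \<Rightarrow> nat set \<Rightarrow> 'm) \<Rightarrow> nat \<Rightarrow> nat \<Rightarrow> 'm" where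
  "F_bracket A Fo Fm N p q =
     N_ord A Fm N p q \<boxplus>\<^bsub>A\<^esub>
     scal A (- ((-1) ^ (p * q))) (N_ord A Fm N q p \<cdot>\<^bsub>A\<^esub> Comm A (Fo \<lbrakk>p\<rbrakk>\<^sub>n) (Fo \<lbrakk>q\<rbrakk>\<^sub>n))"

text \<open>\<open>P n\<close>, with inclusion \<open>\<iota> n : P n \<rightarrow> F(n)\<close>, is a choice of the image of $F(\widetilde{w_n})$ for all
  \<open>n \<ge> 1\<close>.\<close>

definition image_family ::
  "('o, 'm, 'z) additive_data_scheme \<Rightarrow> (nat set \<Rightarrow> 'o) \<Rightarrow>
   (nat set \<Rightarrow> nat set \<Rightarrow> (nat \<Rightarrow> nat) \<Rightarrow> 'm) \<Rightarrow> (nat \<Rightarrow> 'o) \<Rightarrow> (nat \<Rightarrow> 'm) \<Rightarrow> bool" where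
  "image_family A Fo Fm P \<iota> \<longleftrightarrow>
     (\<forall>n\<ge>1. is_image A (Fo \<lbrakk>n\<rbrakk>\<^sub>n) (Fo \<lbrakk>n\<rbrakk>\<^sub>n) (F_ext A Fo Fm \<lbrakk>n\<rbrakk>\<^sub>n \<lbrakk>n\<rbrakk>\<^sub>n (w_tilde n)) (P n) (\<iota> n))"

text \<open>\<open>d\<close> and \<open>b\<close> are the restrictions to the images of the maps \<open>F(f\<^sub>n)\<close> and \<open>[,]\<^sub>p\<^sub>,\<^sub>q\<close>; they are unique,
  the \<open>\<iota> n\<close> being monomorphisms.\<close>

definition induced_structure ::
  "('o, 'm, 'z) tensor_data_scheme \<Rightarrow> (nat set \<Rightarrow> 'o) \<Rightarrow>
   (nat set \<Rightarrow> nat set \<Rightarrow> (nat \<Rightarrow> nat) \<Rightarrow> 'm) \<Rightarrow> (nat set \<Rightarrow> nat set \<Rightarrow> 'm) \<Rightarrow>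
   (nat \<Rightarrow> 'o) \<Rightarrow> (nat \<Rightarrow> 'm) \<Rightarrow> (nat \<Rightarrow> 'm) \<Rightarrow> (nat \<Rightarrow> nat \<Rightarrow> 'm) \<Rightarrow> bool" where
  "induced_structure A Fo Fm N P \<iota> d b \<longleftrightarrow>
     (\<forall>n\<ge>1. d n \<in> Hom A (P n) (P (n + 1)) \<and>
        \<iota> (n + 1) \<cdot>\<^bsub>A\<^esub> d n = F_ext A Fo Fm \<lbrakk>n + 1\<rbrakk>\<^sub>n \<lbrakk>n\<rbrakk>\<^sub>n (f_elem n) \<cdot>\<^bsub>A\<^esub> \<iota> n) \<and>
     (\<forall>p\<ge>1. \<forall>q\<ge>1. b p q \<in> Hom A (P p \<odot>\<^bsub>A\<^esub> P q) (P (p + q)) \<and>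
        \<iota> (p + q) \<cdot>\<^bsub>A\<^esub> b p q = F_bracket A Fo Fm N p q \<cdot>\<^bsub>A\<^esub> (\<iota> p \<otimes>\<^sub>m\<^bsub>A\<^esub> \<iota> q))"

end

theory Submission
  imports Defs
begin

text \<open>
  Let \<open>T\<close> be the free associative ring on letters, all of them odd, and write
  \<open>\<lambda>(x\<^sub>1 \<dots> x\<^sub>n) = [\<dots>[[x\<^sub>1, x\<^sub>2], x\<^sub>3] \<dots>, x\<^sub>n]\<close> for the left-normed superbracket of a word, extended
  linearly. A formal combination of maps \<open>[m] \<rightarrow> [n]\<close> is the same thing as an element of \<open>T\<close> that is
  homogeneous of degree \<open>m\<close> in the letters \<open>1, \<dots>, n\<close>. Under this dictionary $\widetilde{w_n}$ is
  \<open>\<lambda>(1 2 \<dots> n)\<close>, composition with it applies \<open>\<lambda>\<close> to words, and \<open>f\<^sub>n\<close> is \<open>d(1 2 \<dots> n)\<close> for the odd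
  derivation \<open>d\<close> with \<open>d a = a a\<close>.

  Naturality, commutativity and associativity of \<open>N\<close> turn every composite of brackets and
  differentials on the objects \<open>F(n)\<close> into \<open>F\<close> of one element of \<open>T\<close> applied to an iterated \<open>N\<close>
  (\<open>FB_natural\<close>, \<open>FB_nested_right\<close>, \<open>FB_nested_left\<close>, \<open>N3_Comm\<close>). So the Jacobi identity, the Leibniz
  rule and \<open>d\<^sup>2 = 0\<close> hold on the \<open>F(n)\<close> because they hold in \<open>T\<close> (\<open>sbr_jacobi\<close>, \<open>dbl_sbr\<close>, \<open>dbl_dbl\<close>),
  antisymmetry holds by construction, and all of them pass to the images because the inclusions
  \<open>\<iota>\<close> are monomorphisms.

  The substance is that bracket and differential restrict to the images. Let \<open>F(w\<^sub>n) = \<iota> \<epsilon>\<close> be the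
  epi-mono factorisation. It is not enough to know the bracket on \<open>\<iota> \<epsilon> \<otimes> \<iota> \<epsilon>\<close>: a tensor product of
  epimorphisms need not be epi, and the factors \<open>p\<close> and \<open>q\<close> in \<open>\<epsilon> \<iota> = p\<close>, \<open>\<epsilon> \<iota> = q\<close> need not be
  invertible. Therefore the bracket of the inclusions themselves is written as \<open>\<lambda>\<close> of something. For
  Lie elements \<open>V\<close> of degree \<open>p\<close> and \<open>Y = y\<^sub>1 \<dots> y\<^sub>q\<close> of degree \<open>q\<close> (sums of words are understood),
  \<open>[V, Y] = [\<dots>[V, y\<^sub>1], \<dots>, y\<^sub>q]\<close> because \<open>Y\<close> is Lie, \<open>[V, y\<^sub>1] = (-1)\<^bsup>p+1\<^esup>[y\<^sub>1, V]\<close>, and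
  \<open>[y\<^sub>1, V] = [\<dots>[y\<^sub>1, v\<^sub>1], \<dots>, v\<^sub>p]\<close> because \<open>V\<close> is Lie; so
  \<open>[V, Y] = (-1)\<^bsup>p+1\<^esup> \<lambda>(y\<^sub>1 V y\<^sub>2 \<dots> y\<^sub>q)\<close> (\<open>sbr_eq_lie_defects\<close>). What being Lie means for the abstract
  \<open>\<iota>\<close> is that \<open>F(u) \<iota> = 0\<close> whenever the composite of $\widetilde{w_n}$ with \<open>u\<close> is zero
  (\<open>FT_\<iota>_zero\<close>), and \<open>\<epsilon>\<close> is cancelled before tensoring. To use this in one tensor factor only, the two
  error terms of the displayed formula are split according to the positions of the letters that
  belong to that factor (\<open>block_decomposition\<close>).

  For the differential, \<open>d Y = [\<dots>[y\<^sub>1 y\<^sub>1, y\<^sub>2] \<dots>, y\<^sub>n]\<close> for a Lie element \<open>Y\<close> (\<open>dbl_lie\<close>), and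
  \<open>2 y\<^sub>1 y\<^sub>1 = [y\<^sub>1, y\<^sub>1]\<close>, so \<open>2 d Y = \<lambda>(y\<^sub>1 y\<^sub>1 y\<^sub>2 \<dots> y\<^sub>n)\<close>. This is where \<open>2\<close> has to be inverted.
  The images exist since \<open>\<lambda>\<close> is multiplication by \<open>n\<close> on Lie elements of degree \<open>n\<close> (\<open>lie_lie\<close>).
\<close>

section \<open>The tensor ring on words\<close>

text \<open>With concatenation as monoid operation, integral combinations of words form a ring, the
  tensor ring.\<close>

instantiation list :: (type) monoid_add
begin
definition plus_list_def [simp]: "(u :: 'a list) + v = u @ v"
definition zero_list_def [simp]: "(0 :: 'a list) = []"
instance by standard simp_all
end

type_synonym tensor = "nat list \<Rightarrow>\<^sub>0 int"

definition words :: "nat set \<Rightarrow> nat \<Rightarrow> nat list set" where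
  "words S m = {w. set w \<subseteq> S \<and> length w = m}"

abbreviation tensors :: "nat set \<Rightarrow> nat \<Rightarrow> tensor set" where
  "tensors S m \<equiv> carrier (free_Abelian_group (words S m))"

lemma wordsI: "set w \<subseteq> S \<Longrightarrow> length w = m \<Longrightarrow> w \<in> words S m"
  by (simp add: words_def)

lemma words_nth: "w \<in> words S m \<Longrightarrow> 1 \<le> j \<Longrightarrow> j \<le> m \<Longrightarrow> w ! (j - 1) \<in> S"
  using nth_mem[of "j - 1" w] by (auto simp: words_def)

lemma words_append: "u \<in> words S m \<Longrightarrow> v \<in> words S n \<Longrightarrow> u @ v \<in> words S (m + n)"
  by (auto simp: words_def)

lemma tensors_mult:
  assumes "x \<in> tensors S m" "y \<in> tensors S n"
  shows "x * y \<in> tensors S (m + n)"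
proof -
  have "Poly_Mapping.keys (x * y) \<subseteq> {u + v |u v. u \<in> Poly_Mapping.keys x \<and> v \<in> Poly_Mapping.keys y}"
    by (rule keys_mult)
  also have "\<dots> \<subseteq> words S (m + n)"
    using assms by (auto intro!: words_append)
  finally show ?thesis by simp
qed

lemma tensors_diff: "x \<in> tensors S m \<Longrightarrow> y \<in> tensors S m \<Longrightarrow> x - y \<in> tensors S m"
  using keys_diff[of x y] by auto

lemma tensors_add: "x \<in> tensors S m \<Longrightarrow> y \<in> tensors S m \<Longrightarrow> x + y \<in> tensors S m"
  using keys_add[of x y] by auto

lemma tensors_cmul: "x \<in> tensors S m \<Longrightarrow> frag_cmul c x \<in> tensors S m"
  using keys_cmul[of c x] by auto

lemma tensors_sign: "x \<in> tensors S m \<Longrightarrow> (- 1) ^ k * x \<in> tensors S m"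
  by (cases "even k") auto

lemma tensors_mono: "u \<in> tensors S m \<Longrightarrow> S \<subseteq> S' \<Longrightarrow> u \<in> tensors S' m"
  by (fastforce simp: words_def)

lemma tensors_frag_of: "w \<in> words S m \<Longrightarrow> frag_of w \<in> tensors S m"
  by simp

lemma tensors_frag_extend:
  assumes "x \<in> tensors S m" "\<And>w. w \<in> words S m \<Longrightarrow> f w \<in> tensors S' m'"
  shows "frag_extend f x \<in> tensors S' m'"
  using assms keys_frag_extend[of f x] by fastforce

lemma frag_of_append: "frag_of (u @ v :: 'a list) = frag_of u * frag_of v"
  by (simp add: mult_single)

lemma frag_of_Cons: "frag_of (a # v) = frag_of [a] * frag_of v"
  using frag_of_append[of "[a]" v] by simp

lemma frag_of_Nil: "frag_of ([] :: 'a list) = 1"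
  using single_one[where 'a="'a list" and 'b=int] by simp

lemma frag_induct [consumes 1, case_names zero diff of]:
  assumes "x \<in> carrier (free_Abelian_group S)" "P 0"
    and "\<And>x y. P x \<Longrightarrow> P y \<Longrightarrow> P (x - y)" "\<And>w. w \<in> S \<Longrightarrow> P (frag_of w)"
  shows "P x"
  by (rule free_Abelian_group_induct[of x S P]) (use assms in auto)

text \<open>Linear extensions are moved past additive maps by this rule throughout.\<close>

lemma additive_frag_extend:
  assumes "\<And>a b. L (a - b) = L a - L b"
  shows "L (frag_extend f x) = frag_extend (\<lambda>w. L (f w)) x"
proof -
  have [simp]: "L 0 = 0" using assms[of 0 0] by simp
  have "x \<in> carrier (free_Abelian_group UNIV)" by simp
  then show ?thesis
    by (induction x rule: frag_induct) (simp_all add: frag_extend_diff assms)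
qed

lemma frag_extend_cong:
  assumes "x \<in> carrier (free_Abelian_group S)" "\<And>w. w \<in> S \<Longrightarrow> f w = g w"
  shows "frag_extend f x = frag_extend g x"
  using assms by (intro frag_extend_eq) auto

section \<open>Superbrackets and Lie words\<close>

text \<open>The superbracket of elements of degrees \<open>p\<close> and \<open>q\<close>. As the degrees are parameters, the identities
  below hold for arbitrary ring elements, homogeneous or not.\<close>

definition sbr :: "nat \<Rightarrow> nat \<Rightarrow> 'a \<Rightarrow> 'a \<Rightarrow> 'a::ring_1" where
  "sbr p q x y = x * y - (- 1) ^ (p * q) * (y * x)"

lemma sbr_diff_left: "sbr p q (x - x') y = sbr p q x y - sbr p q x' y"
  by (simp add: sbr_def algebra_simps)

lemma sbr_diff_right: "sbr p q x (y - y') = sbr p q x y - sbr p q x y'"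
  by (simp add: sbr_def algebra_simps)

lemma sbr_zero: "sbr p q 0 y = 0"
  by (simp add: sbr_def)

lemma tensors_sbr:
  assumes "x \<in> tensors S m" "y \<in> tensors S n"
  shows "sbr p q x y \<in> tensors S (m + n)"
  unfolding sbr_def using tensors_mult[OF assms] tensors_mult[OF assms(2,1)]
  by (intro tensors_diff tensors_sign) (simp_all add: add.commute)

lemma sbr_antisym: "sbr p q x y = - ((- 1) ^ (p * q) * sbr q p y x)"
  by (cases "even (p * q)") (simp_all add: sbr_def algebra_simps)

lemma sbr_jacobi:
  "sbr p (q + r) x (sbr q r y z) =
     sbr (p + q) r (sbr p q x y) z + (- 1) ^ (p * q) * sbr q (p + r) y (sbr p r x z)"
  by (cases "even p"; cases "even q"; cases "even r") (simp_all add: sbr_def algebra_simps)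

text \<open>\<open>nest k t (a\<^sub>1 \<dots> a\<^sub>m) = [\<dots>[t, a\<^sub>1], \<dots>, a\<^sub>m]\<close>, for \<open>t\<close> of degree \<open>k\<close>.\<close>

fun nest :: "nat \<Rightarrow> tensor \<Rightarrow> nat list \<Rightarrow> tensor" where
  "nest k t [] = t"
| "nest k t (a # w) = nest (Suc k) (sbr k 1 t (frag_of [a])) w"

fun lie :: "nat list \<Rightarrow> tensor" where
  "lie [] = 1"
| "lie (a # w) = nest 1 (frag_of [a]) w"

lemma nest_append: "nest k t (u @ v) = nest (k + length u) (nest k t u) v"
  by (induction u arbitrary: k t) simp_all

lemma lie_append: "u \<noteq> [] \<Longrightarrow> lie (u @ v) = nest (length u) (lie u) v"
  by (cases u) (simp_all add: nest_append)

lemma lie_snoc: "w \<noteq> [] \<Longrightarrow> lie (w @ [a]) = sbr (length w) 1 (lie w) (frag_of [a])"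
  by (simp add: lie_append)

lemma nest_diff: "nest k (s - t) w = nest k s w - nest k t w"
  by (induction w arbitrary: k s t) (simp_all add: sbr_diff_left)

lemma nest_zero: "nest k 0 w = 0"
  using nest_diff[of k 0 0 w] by simp

lemma nest_minus: "nest k (- t) w = - nest k t w"
  using nest_diff[of k 0 t w] by (simp add: nest_zero)

lemma nest_add: "nest k (s + t) w = nest k s w + nest k t w"
  using nest_diff[of k s "- t" w] by (simp add: nest_minus)

lemma nest_sign: "nest k ((- 1) ^ i * t) w = (- 1) ^ i * nest k t w"
  by (cases "even i") (simp_all add: nest_minus)

lemma nest_tensors: "t \<in> tensors S k \<Longrightarrow> set w \<subseteq> S \<Longrightarrow> nest k t w \<in> tensors S (k + length w)"
proof (induction w arbitrary: k t)
  case (Cons a w)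
  have a: "frag_of [a] \<in> tensors S 1" using Cons.prems by (intro tensors_frag_of wordsI) auto
  have "sbr k 1 t (frag_of [a]) \<in> tensors S (k + 1)"
    unfolding sbr_def
    using tensors_mult[OF Cons.prems(1) a] tensors_mult[OF a Cons.prems(1)]
    by (intro tensors_diff tensors_sign) (simp_all add: add.commute)
  with Cons.IH[of _ "Suc k"] Cons.prems show ?case by simp
qed simp

lemma lie_tensors:
  assumes "w \<in> words S m" shows "lie w \<in> tensors S m"
proof (cases w)
  case Nil
  then show ?thesis using assms by (simp add: words_def)
next
  case (Cons a v)
  have "nest 1 (frag_of [a]) v \<in> tensors S (1 + length v)"
    using assms Cons by (intro nest_tensors tensors_frag_of wordsI) (auto simp: words_def)
  then show ?thesis using assms Cons by (simp add: words_def)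
qed

lemma sbr_frag_extend_right:
  "frag_extend (\<lambda>w. sbr p q y (f w)) x = sbr p q y (frag_extend f x)"
  by (rule additive_frag_extend[of "\<lambda>t. sbr p q y t", symmetric]) (rule sbr_diff_right)

lemma frag_extend_nest_snoc:
  assumes "x \<in> tensors S m"
  shows "frag_extend (nest k t) (x * frag_of [a]) =
    sbr (k + m) 1 (frag_extend (nest k t) x) (frag_of [a])"
  using assms
  by (induction x rule: frag_induct)
     (simp_all add: frag_extend_diff left_diff_distrib sbr_diff_left nest_append words_def sbr_zero
        flip: frag_of_append)

lemma frag_extend_nest_Cons:
  "frag_extend (nest k t) (frag_of [a] * x) =
    frag_extend (nest (Suc k) (sbr k 1 t (frag_of [a]))) x"
proof -
  have "x \<in> carrier (free_Abelian_group UNIV)" by simp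
  then show ?thesis
    by (induction x rule: frag_induct)
       (simp_all add: frag_extend_diff right_diff_distrib flip: frag_of_append)
qed

text \<open>A Lie element acts by the adjoint action in the same way as the word tensor that it is: bracketing
  with the letters of \<open>\<lambda>(w)\<close> one after the other is bracketing with \<open>\<lambda>(w)\<close>. By the Jacobi identity, the
  property passes from \<open>\<lambda>(w)\<close> to \<open>\<lambda>(w a) = [\<lambda>(w), a]\<close>.\<close>

lemma nest_lie:
  "w \<noteq> [] \<Longrightarrow> frag_extend (nest k t) (lie w) = sbr k (length w) t (lie w)"
proof (induction w arbitrary: k t rule: rev_nonempty_induct)
  case (single a)
  then show ?case by simp
next
  case (snoc a w)
  let ?n = "length w" and ?a = "frag_of [a]"
  have lw: "lie w \<in> tensors UNIV ?n" by (intro lie_tensors wordsI) auto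
  have "frag_extend (nest k t) (lie (w @ [a]))
      = frag_extend (nest k t) (lie w * ?a) - (- 1) ^ ?n * frag_extend (nest k t) (?a * lie w)"
    using snoc.hyps by (cases "even ?n")
      (simp_all add: lie_snoc sbr_def frag_extend_diff frag_extend_add)
  also have "\<dots> = sbr (k + ?n) 1 (sbr k ?n t (lie w)) ?a
      - (- 1) ^ ?n * sbr (Suc k) ?n (sbr k 1 t ?a) (lie w)"
    using snoc.IH frag_extend_nest_snoc[OF lw] frag_extend_nest_Cons by simp
  also have "\<dots> = sbr k (?n + 1) t (sbr ?n 1 (lie w) ?a)"
    by (cases "even k"; cases "even ?n") (simp_all add: sbr_def algebra_simps)
  finally show ?case using snoc.hyps by (simp add: lie_snoc)
qed

lemma frag_extend_lie_snoc:
  assumes "x \<in> tensors S m" "m \<noteq> 0"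
  shows "frag_extend lie (x * frag_of [a]) = sbr m 1 (frag_extend lie x) (frag_of [a])"
  using assms(1)
proof (induction x rule: frag_induct)
  case (of w)
  then show ?case using assms(2) by (auto simp: lie_snoc words_def simp flip: frag_of_append)
qed (simp_all add: frag_extend_diff left_diff_distrib sbr_diff_left sbr_zero)

lemma frag_extend_lie_Cons:
  "frag_extend lie (frag_of [a] * x) = frag_extend (nest 1 (frag_of [a])) x"
proof -
  have "x \<in> carrier (free_Abelian_group UNIV)" by simp
  then show ?thesis
    by (induction x rule: frag_induct)
       (simp_all add: frag_extend_diff right_diff_distrib flip: frag_of_append)
qed

text \<open>The Dynkin-Specht-Wever identity. In \<open>\<lambda>(\<lambda>(w a)) = \<lambda>(\<lambda>(w) a) \<mp> \<lambda>(a \<lambda>(w))\<close> the first term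
  contributes \<open>n [\<lambda>(w), a]\<close> by induction and the second one \<open>[\<lambda>(w), a]\<close> by \<open>nest_lie\<close>.\<close>

lemma lie_lie: "w \<noteq> [] \<Longrightarrow> frag_extend lie (lie w) = of_nat (length w) * lie w"
proof (induction w rule: rev_nonempty_induct)
  case (snoc a w)
  let ?n = "length w" and ?a = "frag_of [a]"
  have lw: "lie w \<in> tensors UNIV ?n" by (intro lie_tensors wordsI) auto
  have "frag_extend lie (lie (w @ [a]))
      = frag_extend lie (lie w * ?a) - (- 1) ^ ?n * frag_extend lie (?a * lie w)"
    using snoc.hyps by (cases "even ?n")
      (simp_all add: lie_snoc sbr_def frag_extend_diff frag_extend_add)
  also have "\<dots> = sbr ?n 1 (of_nat ?n * lie w) ?a - (- 1) ^ ?n * sbr 1 ?n ?a (lie w)"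
    using snoc frag_extend_lie_snoc[OF lw] frag_extend_lie_Cons by (simp add: nest_lie)
  also have "\<dots> = of_nat (?n + 1) * sbr ?n 1 (lie w) ?a"
    by (cases "even ?n")
       (simp_all add: sbr_def algebra_simps mult_of_nat_commute)
  finally show ?case using snoc.hyps by (simp add: lie_snoc)
qed simp

section \<open>The derivation doubling a letter\<close>

text \<open>The odd derivation with \<open>d a = a a\<close> on letters, evaluated on words.\<close>

fun dbl :: "nat list \<Rightarrow> tensor" where
  "dbl [] = 0"
| "dbl (a # w) = frag_of (a # a # w) - frag_of [a] * dbl w"

lemma dbl_append:
  "dbl (u @ v) = dbl u * frag_of v + (- 1) ^ length u * (frag_of u * dbl v)"
proof (induction u)
  case Nil
  show ?case by (simp add: frag_of_Nil)
next
  case (Cons a u)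
  have 1: "frag_of (a # u) = frag_of [a] * frag_of u"
    "frag_of (a # a # u) = frag_of [a] * (frag_of [a] * frag_of u)"
    "frag_of (a # a # u @ v) = frag_of [a] * (frag_of [a] * (frag_of u * frag_of v))"
    by (simp_all add: mult_single)
  show ?case
    by (cases "even (length u)") (simp_all add: 1 Cons algebra_simps)
qed

lemma frag_extend_dbl_mult:
  assumes "x \<in> tensors S m" "y \<in> tensors S' n"
  shows "frag_extend dbl (x * y) = frag_extend dbl x * y + (- 1) ^ m * (x * frag_extend dbl y)"
proof -
  have *: "frag_extend dbl (x * frag_of v) = frag_extend dbl x * frag_of v
      + (- 1) ^ m * (x * frag_extend dbl (frag_of v))" for v
    using assms(1)
    by (induction x rule: frag_induct)
       (simp_all add: frag_extend_diff algebra_simps dbl_append words_def flip: frag_of_append)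
  show ?thesis
    using assms(2)
    by (induction y rule: frag_induct) (simp_all only: *, simp_all add: frag_extend_diff algebra_simps)
qed

lemma dbl_sbr:
  assumes "x \<in> tensors S p" "y \<in> tensors S q"
  shows "frag_extend dbl (sbr p q x y) =
    sbr (p + 1) q (frag_extend dbl x) y + (- 1) ^ p * sbr p (q + 1) x (frag_extend dbl y)"
proof -
  have "frag_extend dbl (sbr p q x y)
      = frag_extend dbl (x * y) - (- 1) ^ (p * q) * frag_extend dbl (y * x)"
    by (cases "even (p * q)") (simp_all add: sbr_def frag_extend_diff frag_extend_add)
  then show ?thesis
    unfolding frag_extend_dbl_mult[OF assms] frag_extend_dbl_mult[OF assms(2,1)]
    by (cases "even p"; cases "even q") (simp_all add: sbr_def algebra_simps)
qed

lemma dbl_tensors: "w \<in> words S m \<Longrightarrow> dbl w \<in> tensors S (Suc m)"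
proof (induction w arbitrary: m)
  case (Cons a w)
  then obtain k where k: "m = Suc k" "w \<in> words S k" "a \<in> S" by (auto simp: words_def)
  have "frag_of [a] * dbl w \<in> tensors S (1 + Suc k)"
    using k by (intro tensors_mult Cons.IH tensors_frag_of) (auto simp: words_def)
  moreover have "frag_of (a # a # w) \<in> tensors S (Suc m)"
    using Cons.prems by (intro tensors_frag_of) (auto simp: words_def)
  ultimately show ?case unfolding dbl.simps using k by (intro tensors_diff) auto
qed simp

text \<open>Since \<open>d\<^sup>2\<close> is again a derivation, it suffices that \<open>d (a a) = a a a - a a a = 0\<close>.\<close>

lemma dbl_dbl: "frag_extend dbl (dbl w) = 0"
proof (induction w)
  case (Cons a w)
  have d: "dbl w \<in> tensors UNIV (Suc (length w))"
    by (intro dbl_tensors wordsI) auto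
  have "frag_extend dbl (frag_of [a] * dbl w) = frag_of [a, a] * dbl w"
    by (subst frag_extend_dbl_mult[OF tensors_frag_of[of "[a]" UNIV 1] d])
       (simp_all add: Cons words_def frag_of_Nil)
  moreover have "dbl (a # a # w) = frag_of [a, a] * dbl w"
    by (simp add: right_diff_distrib mult_single flip: mult.assoc)
  ultimately show ?case by (simp add: frag_extend_diff)
qed simp


text \<open>\<open>[\<dots>[a a, a\<^sub>2], \<dots>, a\<^sub>m]\<close> for a word \<open>a a\<^sub>2 \<dots> a\<^sub>m\<close>.\<close>

definition double_first :: "nat list \<Rightarrow> tensor" where
  "double_first w = nest 2 (frag_of [hd w, hd w]) (tl w)"

lemma frag_extend_double_first_snoc:
  assumes "x \<in> tensors S m" "m \<noteq> 0"
  shows "frag_extend double_first (x * frag_of [b]) =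
    sbr (m + 1) 1 (frag_extend double_first x) (frag_of [b])"
  using assms(1)
proof (induction x rule: frag_induct)
  case (of w)
  then have "w \<noteq> []" "length w = m" using assms(2) by (auto simp: words_def)
  then show ?case
    by (cases w) (simp_all add: double_first_def nest_append flip: frag_of_append)
qed (simp_all add: frag_extend_diff left_diff_distrib sbr_diff_left sbr_zero)

lemma frag_extend_double_first_Cons:
  "frag_extend double_first (frag_of [b] * x) = frag_extend (nest 2 (frag_of [b, b])) x"
proof -
  have "x \<in> carrier (free_Abelian_group UNIV)" by simp
  then show ?thesis
    by (induction x rule: frag_induct)
       (simp_all add: frag_extend_diff right_diff_distrib double_first_def flip: frag_of_append)
qed

text \<open>A Lie element that is linear in a letter \<open>a\<close> is \<open>[\<dots>[a, v\<^sub>1], \<dots>, v\<^sub>k]\<close>, where \<open>a v\<^sub>1 \<dots> v\<^sub>k\<close> runs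
  through its words that begin with \<open>a\<close>. Replacing \<open>a\<close> by \<open>d a = a a\<close>, and summing over the letters,
  expresses \<open>d\<close> by the first letters of the words alone. The formal proof is an induction that compares
  both sides on \<open>\<lambda>(w) b\<close> and \<open>b \<lambda>(w)\<close>.\<close>

lemma dbl_lie: "w \<noteq> [] \<Longrightarrow> frag_extend dbl (lie w) = frag_extend double_first (lie w)"
proof (induction w rule: rev_nonempty_induct)
  case (single a)
  then show ?case by (simp add: double_first_def)
next
  case (snoc b w)
  let ?n = "length w" and ?b = "frag_of [b]" and ?D = "frag_extend dbl (lie w)"
  have lw: "lie w \<in> tensors UNIV ?n" by (intro lie_tensors wordsI) auto
  have b: "?b \<in> tensors UNIV 1" by (intro tensors_frag_of wordsI) auto
  have "frag_extend double_first (lie (w @ [b]))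
      = frag_extend double_first (lie w * ?b) - (- 1) ^ ?n * frag_extend double_first (?b * lie w)"
    using snoc.hyps by (cases "even ?n")
      (simp_all add: lie_snoc sbr_def frag_extend_diff frag_extend_add)
  also have "\<dots> = sbr (?n + 1) 1 ?D ?b - (- 1) ^ ?n * sbr 2 ?n (frag_of [b, b]) (lie w)"
    using snoc frag_extend_double_first_snoc[OF lw]
    by (simp add: frag_extend_double_first_Cons nest_lie)
  also have "\<dots> = (?D * ?b + (- 1) ^ ?n * (lie w * frag_of [b, b]))
      - (- 1) ^ ?n * (frag_of [b, b] * lie w + (- 1) ^ 1 * (?b * ?D))"
    by (cases "even ?n") (simp_all add: sbr_def algebra_simps)
  also have "\<dots> = frag_extend dbl (lie w * ?b) - (- 1) ^ ?n * frag_extend dbl (?b * lie w)"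
    unfolding frag_extend_dbl_mult[OF lw b] frag_extend_dbl_mult[OF b lw] by simp
  also have "\<dots> = frag_extend dbl (lie (w @ [b]))"
    using snoc.hyps by (cases "even ?n")
      (simp_all add: lie_snoc sbr_def frag_extend_diff frag_extend_add)
  finally show ?case by simp
qed

lemma lie_double_first: "w \<noteq> [] \<Longrightarrow> lie (hd w # w) = 2 * double_first w"
proof (cases w)
  case (Cons a v)
  have "sbr 1 1 (frag_of [a]) (frag_of [a]) = frag_of [a, a] + frag_of [a, a]"
    by (simp add: sbr_def mult_single)
  then show ?thesis
    using Cons by (simp add: double_first_def nest_add mult_2 numeral_2_eq_2)
qed simp

lemma dbl_lie_twice:
  assumes "w \<noteq> []"
  shows "frag_extend (\<lambda>v. lie (hd v # v)) (lie w) = 2 * frag_extend dbl (lie w)"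
proof -
  have lw: "lie w \<in> tensors UNIV (length w)" by (intro lie_tensors wordsI) auto
  have "frag_extend (\<lambda>v. lie (hd v # v)) (lie w) = frag_extend (\<lambda>v. 2 * double_first v) (lie w)"
  proof (rule frag_extend_cong[OF lw])
    fix v :: "nat list" assume "v \<in> words UNIV (length w)"
    then have "v \<noteq> []" using assms by (auto simp: words_def)
    then show "lie (hd v # v) = 2 * double_first v" by (rule lie_double_first)
  qed
  also have "\<dots> = 2 * frag_extend double_first (lie w)"
    by (rule additive_frag_extend[of "\<lambda>t. 2 * t", symmetric]) (rule right_diff_distrib)
  finally show ?thesis using dbl_lie[OF assms] by simp
qed

section \<open>Substitution of letters and composition\<close>

text \<open>The ring endomorphism induced by a map of letters.\<close>

definition relabel :: "(nat \<Rightarrow> nat) \<Rightarrow> tensor \<Rightarrow> tensor" where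
  "relabel f = frag_extend (\<lambda>w. frag_of (map f w))"

lemma relabel_frag_of [simp]: "relabel f (frag_of w) = frag_of (map f w)"
  by (simp add: relabel_def)

lemma relabel_diff: "relabel f (x - y) = relabel f x - relabel f y"
  by (simp add: relabel_def frag_extend_diff)

lemma relabel_add: "relabel f (x + y) = relabel f x + relabel f y"
  by (simp add: relabel_def frag_extend_add)

lemma relabel_minus: "relabel f (- x) = - relabel f x"
  by (simp add: relabel_def frag_extend_minus)

lemma relabel_zero [simp]: "relabel f 0 = 0"
  by (simp add: relabel_def)

lemma relabel_mult: "relabel f (x * y) = relabel f x * relabel f y"
proof -
  have "x \<in> carrier (free_Abelian_group UNIV)" "y \<in> carrier (free_Abelian_group UNIV)" by simp_all
  then show ?thesis
  proof (induction x rule: frag_induct)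
    case (of u)
    from of(2) show ?case
      by (induction y rule: frag_induct)
         (simp_all add: relabel_diff right_diff_distrib flip: frag_of_append)
  qed (simp_all add: relabel_diff left_diff_distrib)
qed

lemma relabel_sign: "relabel f ((- 1) ^ k * x) = (- 1) ^ k * relabel f x"
  by (cases "even k") (simp_all add: relabel_minus)

lemma relabel_sbr: "relabel f (sbr p q x y) = sbr p q (relabel f x) (relabel f y)"
  by (simp add: sbr_def relabel_diff relabel_sign relabel_mult[of f x y] relabel_mult[of f y x])

lemma relabel_nest: "relabel f (nest k t w) = nest k (relabel f t) (map f w)"
  by (induction w arbitrary: k t) (simp_all add: relabel_sbr)

lemma relabel_lie: "relabel f (lie w) = lie (map f w)"
proof (cases w)
  case Nil
  then show ?thesis using relabel_frag_of[of f "[]"] by (simp add: frag_of_Nil del: relabel_frag_of)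
qed (simp add: relabel_nest)

lemma relabel_tensors:
  assumes "x \<in> tensors S m" "f ` S \<subseteq> S'"
  shows "relabel f x \<in> tensors S' m"
  unfolding relabel_def
  by (rule tensors_frag_extend[OF assms(1)]) (use assms(2) in \<open>auto simp: words_def\<close>)

lemma shift_tensors: "v \<in> tensors {1..q} m \<Longrightarrow> relabel ((+) p) v \<in> tensors {1..p + q} m"
  by (rule relabel_tensors) auto

text \<open>If words are read as maps, \<open>u : [n] \<rightarrow> S\<close> and \<open>v : [m] \<rightarrow> [n]\<close>, then \<open>plug u v\<close> is the composite
  \<open>u \<circ> v : [m] \<rightarrow> S\<close>.\<close>

definition plug :: "nat list \<Rightarrow> nat list \<Rightarrow> nat list" where
  "plug u v = map (\<lambda>j. u ! (j - 1)) v"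

text \<open>Composition of formal combinations of maps. As an operation on \<open>y\<close> it substitutes letters
  (\<open>tcomp_conv_relabel\<close>); as an operation on \<open>x\<close> it permutes, repeats or drops places.\<close>

definition tcomp :: "tensor \<Rightarrow> tensor \<Rightarrow> tensor" where
  "tcomp x y = frag_extend (\<lambda>v. frag_extend (\<lambda>u. frag_of (plug u v)) x) y"

lemma plug_words: "u \<in> words S n \<Longrightarrow> v \<in> words {1..n} m \<Longrightarrow> plug u v \<in> words S m"
  by (force simp: plug_def words_def)

lemma tcomp_diff_right: "tcomp x (y - y') = tcomp x y - tcomp x y'"
  by (simp add: tcomp_def frag_extend_diff)

lemma frag_extend_fun_diff:
  "frag_extend (\<lambda>w. f w - g w) x = frag_extend f x - frag_extend g x"
proof -
  have "x \<in> carrier (free_Abelian_group UNIV)" by simp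
  then show ?thesis by (induction x rule: frag_induct) (simp_all add: frag_extend_diff)
qed

lemma frag_extend_fun_cmul:
  fixes f :: "'a \<Rightarrow> 'b \<Rightarrow>\<^sub>0 int"
  shows "frag_extend (\<lambda>w. frag_cmul c (f w)) x = frag_cmul c (frag_extend f x)"
proof (rule additive_frag_extend[symmetric])
  show "frag_cmul c (a - b) = frag_cmul c a - frag_cmul c b" for a b :: "'b \<Rightarrow>\<^sub>0 int"
    by (rule poly_mapping_eqI) (simp add: lookup_minus algebra_simps)
qed

lemma tcomp_zero_right [simp]: "tcomp x 0 = 0"
  by (simp add: tcomp_def)

lemma tcomp_conv_relabel: "tcomp x y = frag_extend (\<lambda>u. relabel (\<lambda>j. u ! (j - 1)) y) x"
proof -
  have "y \<in> carrier (free_Abelian_group UNIV)" by simp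
  then show ?thesis
  proof (induction y rule: frag_induct)
    case zero
    show ?case by (simp add: frag_extend_eq_0)
  next
    case (diff y y')
    then show ?case by (simp add: tcomp_diff_right relabel_diff frag_extend_fun_diff)
  qed (simp add: tcomp_def plug_def)
qed

lemma tcomp_diff_left: "tcomp (x - x') y = tcomp x y - tcomp x' y"
  by (simp add: tcomp_conv_relabel frag_extend_diff)

lemma tcomp_zero_left: "tcomp 0 y = 0"
  by (simp add: tcomp_conv_relabel)

lemma tcomp_tensors:
  assumes "x \<in> tensors S n" "y \<in> tensors {1..n} m"
  shows "tcomp x y \<in> tensors S m"
  unfolding tcomp_def
  by (intro tensors_frag_extend[OF assms(2)] tensors_frag_extend[OF assms(1)] tensors_frag_of plug_words)

text \<open>The word of the \<open>k\<close> letters that follow \<open>a\<close>; \<open>ival 0 n\<close> is the identity of \<open>[n]\<close>.\<close>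

definition ival :: "nat \<Rightarrow> nat \<Rightarrow> nat list" where
  "ival a k = [Suc a..<Suc (a + k)]"

lemma length_ival [simp]: "length (ival a k) = k"
  by (simp add: ival_def del: upt_Suc)

lemma nth_ival [simp]: "i < k \<Longrightarrow> ival a k ! i = Suc (a + i)"
  by (simp add: ival_def del: upt_Suc)

lemma set_ival [simp]: "set (ival a k) = {a<..a + k}"
  by (auto simp: ival_def)

lemma ival_0 [simp]: "ival a 0 = []"
  by (simp add: ival_def)

lemma ival_Suc: "ival a (Suc k) = ival a k @ [Suc (a + k)]"
  by (simp add: ival_def)

lemma ival_Cons: "k \<noteq> 0 \<Longrightarrow> ival a k = Suc a # ival (Suc a) (k - 1)"
  by (cases k) (simp_all add: ival_def upt_conv_Cons del: upt_Suc)

lemma ival_eq_Nil [simp]: "ival a k = [] \<longleftrightarrow> k = 0"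
  by (metis length_ival length_0_conv)

lemma map_add_ival: "map ((+) p) (ival a k) = ival (p + a) k"
  by (rule nth_equalityI) simp_all

lemma ival_append: "ival a j @ ival (a + j) k = ival a (j + k)"
  by (rule nth_equalityI) (simp_all add: nth_append)

lemma ival_words: "a + k \<le> n \<Longrightarrow> ival a k \<in> words {1..n} k"
  by (auto simp: words_def)

lemma ival_tensors: "a + k \<le> n \<Longrightarrow> frag_of (ival a k) \<in> tensors {1..n} k"
  by (intro tensors_frag_of ival_words)

lemma dbl_ival_tensors: "a + k \<le> n \<Longrightarrow> dbl (ival a k) \<in> tensors {1..n} (k + 1)"
  using dbl_tensors[OF ival_words, of a k n] by (simp only: Suc_eq_plus1)

lemma lie_ival_tensors: "lie (ival 0 n) \<in> tensors {1..n} n"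
  by (intro lie_tensors ival_words) simp

lemma plug_ival: "length u = n \<Longrightarrow> plug u (ival 0 n) = u"
  by (rule nth_equalityI) (simp_all add: plug_def)

text \<open>Composition with $\widetilde{w_m}$ applies \<open>\<lambda>\<close> to each word.\<close>

lemma tcomp_lie:
  assumes "x \<in> tensors S m"
  shows "tcomp x (lie (ival 0 m)) = frag_extend lie x"
  unfolding tcomp_conv_relabel relabel_lie plug_def[symmetric]
  by (rule frag_extend_cong[OF assms]) (simp add: words_def plug_ival)

lemma relabel_dbl: "relabel f (dbl w) = dbl (map f w)"
  by (induction w) (simp_all add: relabel_diff relabel_mult)

lemma tcomp_dbl:
  assumes "x \<in> tensors S m"
  shows "tcomp x (dbl (ival 0 m)) = frag_extend dbl x"
  unfolding tcomp_conv_relabel relabel_dbl plug_def[symmetric]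
  by (rule frag_extend_cong[OF assms]) (simp add: words_def plug_ival)

section \<open>Words with a block of consecutive letters\<close>

definition in_block :: "nat \<Rightarrow> nat \<Rightarrow> nat \<Rightarrow> bool" where
  "in_block a r c \<longleftrightarrow> a < c \<and> c \<le> a + r"

text \<open>The map of \<open>[a + r + b]\<close> to itself which is \<open>x\<close> on the block \<open>a + 1, \<dots>, a + r\<close> and the identity outside.\<close>

definition embed :: "nat \<Rightarrow> nat \<Rightarrow> nat \<Rightarrow> nat list \<Rightarrow> nat list" where
  "embed a r b x = ival 0 a @ map ((+) a) x @ ival (a + r) b"

abbreviation embed_tensor :: "nat \<Rightarrow> nat \<Rightarrow> nat \<Rightarrow> tensor \<Rightarrow> tensor" where
  "embed_tensor a r b \<equiv> frag_extend (\<lambda>x. frag_of (embed a r b x))"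

lemma embed_words: "x \<in> words {1..r} r \<Longrightarrow> embed a r b x \<in> words {1..a + r + b} (a + r + b)"
  by (fastforce simp: embed_def words_def)

lemma embed_nth:
  assumes "length x = r" "c \<in> {1..a + r + b}"
  shows "embed a r b x ! (c - 1) = (if in_block a r c then a + x ! (c - a - 1) else c)"
proof -
  have "c - Suc (a + r) < b" if "a + r < c" using that assms by auto
  then show ?thesis
    using assms by (auto simp: embed_def nth_append in_block_def)
qed

lemma embed_tensor_right: "embed_tensor p q 0 u = frag_of (ival 0 p) * relabel ((+) p) u"
  unfolding relabel_def
  by (subst additive_frag_extend[of "\<lambda>t. frag_of (ival 0 p) * t"])
     (simp_all add: right_diff_distrib embed_def mult_single)

lemma embed_tensor_left: "embed_tensor 0 p q u = u * frag_of (ival p q)"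
proof -
  have "u * frag_of (ival p q) = frag_extend frag_of u * frag_of (ival p q)"
    by (simp flip: frag_expansion)
  also have "\<dots> = frag_extend (\<lambda>x. frag_of x * frag_of (ival p q)) u"
    by (rule additive_frag_extend[of "\<lambda>t. t * frag_of (ival p q)"]) (rule left_diff_distrib)
  finally show ?thesis by (simp add: embed_def mult_single map_idI)
qed

lemma embed_tensor_tensors:
  assumes "u \<in> tensors {1..r} r"
  shows "embed_tensor a r b u \<in> tensors {1..a + r + b} (a + r + b)"
  by (rule tensors_frag_extend[OF assms tensors_frag_of[OF embed_words]])

text \<open>A word with exactly \<open>r\<close> letters in the block is determined by its pattern, in which the letters of
  the block are replaced by \<open>0\<close>, and by the word of its letters in the block. The word \<open>restore (a + 1) \<kappa>\<close>
  fills the places of the pattern \<open>\<kappa>\<close> with the block in increasing order.\<close>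

fun restore :: "nat \<Rightarrow> nat list \<Rightarrow> nat list" where
  "restore k [] = []"
| "restore k (c # w) = (if c = 0 then k # restore (Suc k) w else c # restore k w)"

definition pattern :: "nat \<Rightarrow> nat \<Rightarrow> nat list \<Rightarrow> nat list" where
  "pattern a r w = map (\<lambda>c. if in_block a r c then 0 else c) w"

definition block_part :: "nat \<Rightarrow> nat \<Rightarrow> nat list \<Rightarrow> nat list" where
  "block_part a r w = map (\<lambda>c. c - a) (filter (in_block a r) w)"

lemma block_part_words:
  "length (filter (in_block a r) w) = k \<Longrightarrow> block_part a r w \<in> words {1..r} k"
  by (auto simp: block_part_def words_def in_block_def)

lemma pattern_plug_embed:
  assumes "x \<in> words {1..r} r" "w \<in> words {1..a + r + b} m"
  shows "pattern a r (plug (embed a r b x) w) = pattern a r w"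
proof -
  have "in_block a r (embed a r b x ! (c - 1)) = in_block a r c"
    "\<not> in_block a r c \<Longrightarrow> embed a r b x ! (c - 1) = c" if "c \<in> set w" for c
  proof -
    have c: "c \<in> {1..a + r + b}" using assms that by (auto simp: words_def)
    have "x ! (c - a - 1) \<in> {1..r}" if "in_block a r c"
      using that assms(1) nth_mem[of "c - a - 1" x] by (fastforce simp: in_block_def words_def)
    then show "in_block a r (embed a r b x ! (c - 1)) = in_block a r c"
      "\<not> in_block a r c \<Longrightarrow> embed a r b x ! (c - 1) = c"
      using embed_nth[OF _ c, of x] assms(1) by (auto simp: words_def in_block_def)
  qed
  then show ?thesis by (auto simp: pattern_def plug_def)
qed

lemma block_part_plug_embed:
  assumes "x \<in> words {1..r} r" "w \<in> words {1..a + r + b} m"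
  shows "block_part a r (plug (embed a r b x) w) = plug x (block_part a r w)"
  using assms(2)
proof (induction w arbitrary: m)
  case (Cons c w)
  have c: "c \<in> {1..a + r + b}" and w: "w \<in> words {1..a + r + b} (length w)"
    using Cons.prems by (auto simp: words_def)
  have e: "embed a r b x ! (c - 1) = (if in_block a r c then a + x ! (c - a - 1) else c)"
    using embed_nth[OF _ c] assms(1) by (auto simp: words_def)
  have "x ! (c - a - 1) \<in> {1..r}" if "in_block a r c"
    using that assms(1) nth_mem[of "c - a - 1" x] by (fastforce simp: in_block_def words_def)
  then have "in_block a r (embed a r b x ! (c - 1)) = in_block a r c"
    unfolding e by (auto simp: in_block_def)
  with Cons.IH[OF w] e show ?case
    by (simp add: plug_def block_part_def)
qed (simp add: plug_def block_part_def)

lemma plug_embed_restore: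
  assumes "length x = r" "w \<in> words {1..a + r + b} m"
    and "drop j x = block_part a r w" "j + length (filter (in_block a r) w) = r"
  shows "plug (embed a r b x) (restore (Suc (a + j)) (pattern a r w)) = w \<and>
    restore (Suc (a + j)) (pattern a r w) \<in> words {1..a + r + b} m"
  using assms(2-)
proof (induction w arbitrary: j m)
  case (Cons c w)
  then obtain m' where m: "m = Suc m'" "w \<in> words {1..a + r + b} m'"
    and c: "c \<in> {1..a + r + b}" by (auto simp: words_def)
  show ?case
  proof (cases "in_block a r c")
    case True
    with Cons.prems have j: "j < r" by simp
    have x: "x ! j = c - a" "drop (Suc j) x = block_part a r w"
      using Cons.prems(2) True j assms(1) Cons_nth_drop_Suc[of j x]
      by (auto simp: block_part_def)
    have "embed a r b x ! (a + j) = c"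
      using embed_nth[OF assms(1), of "Suc (a + j)" a b] j x True by (auto simp: in_block_def)
    moreover have "plug (embed a r b x) (restore (Suc (a + Suc j)) (pattern a r w)) = w \<and>
      restore (Suc (a + Suc j)) (pattern a r w) \<in> words {1..a + r + b} m'"
      using Cons.prems True x m by (intro Cons.IH) auto
    ultimately show ?thesis using True m j by (simp add: plug_def pattern_def words_def)
  next
    case False
    have "embed a r b x ! (c - 1) = c"
      using embed_nth[OF assms(1) c] False by simp
    moreover have "plug (embed a r b x) (restore (Suc (a + j)) (pattern a r w)) = w \<and>
      restore (Suc (a + j)) (pattern a r w) \<in> words {1..a + r + b} m'"
      using Cons.prems False m by (intro Cons.IH) (auto simp: block_part_def)
    ultimately show ?thesis using False m c by (simp add: plug_def pattern_def words_def)
  qed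
qed (simp add: plug_def pattern_def words_def)

text \<open>Words with \<open>r\<close> letters in the block are the composites \<open>embed x \<circ> t\<close>, with \<open>t\<close> depending only on the
  pattern; so \<open>\<Omega>\<close> is a sum over patterns of terms \<open>embed(u) \<circ> t\<close>. Composition with \<open>embed(L)\<close> on the left
  does not change patterns, hence it annihilates \<open>\<Omega>\<close> only if \<open>L\<close> annihilates each \<open>u\<close>.\<close>

lemma block_decomposition:
  fixes a r b m :: nat and L \<Omega> :: tensor
  defines "B \<equiv> {w \<in> words {1..a + r + b} m. length (filter (in_block a r) w) = r}"
  assumes \<Omega>: "\<Omega> \<in> carrier (free_Abelian_group B)"
    and L: "L \<in> tensors {1..r} r"
    and ann: "tcomp (embed_tensor a r b L) \<Omega> = 0"
  shows "\<exists>(K :: nat list set) u t. finite K \<and> \<Omega> = (\<Sum>\<kappa>\<in>K. tcomp (embed_tensor a r b (u \<kappa>)) (frag_of (t \<kappa>))) \<and>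
    (\<forall>\<kappa>\<in>K. u \<kappa> \<in> tensors {1..r} r \<and> tcomp L (u \<kappa>) = 0 \<and> t \<kappa> \<in> words {1..a + r + b} m)"
proof -
  define part :: "nat list \<Rightarrow> tensor \<Rightarrow> tensor" where
    "part \<kappa> = frag_extend (\<lambda>w. if pattern a r w = \<kappa> then frag_of (block_part a r w) else 0)" for \<kappa>
  define t where "t = restore (Suc a)"
  define K where "K = pattern a r ` Poly_Mapping.keys \<Omega>"
  have wB: "w \<in> words {1..a + r + b} m" "block_part a r w \<in> words {1..r} r" if "w \<in> B" for w
    using that block_part_words[of a r w r] by (auto simp: B_def)
  have fill: "plug (embed a r b (block_part a r w)) (t (pattern a r w)) = w"
    "t (pattern a r w) \<in> words {1..a + r + b} m" if "w \<in> B" for w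
    using that plug_embed_restore[of "block_part a r w" r w a b m 0] wB[OF that]
    by (auto simp: B_def t_def words_def)
  have part_diff: "part \<kappa> (x - y) = part \<kappa> x - part \<kappa> y" for \<kappa> x y
    by (simp add: part_def frag_extend_diff)
  have part_tensors: "part \<kappa> \<Omega> \<in> tensors {1..r} r" for \<kappa>
  proof -
    have "part \<kappa> \<Omega> \<in> carrier (free_Abelian_group (words {1..r} r))"
      using \<Omega> unfolding part_def
    proof (induction \<Omega> rule: frag_induct)
      case (diff x y)
      then show ?case by (simp only: frag_extend_diff tensors_diff)
    qed (use wB(2) in auto)
    then show ?thesis .
  qed
  have part_comp: "tcomp L (part \<kappa> \<Omega>) = part \<kappa> (tcomp (embed_tensor a r b L) \<Omega>)" for \<kappa>
    using \<Omega>
  proof (induction \<Omega> rule: frag_induct)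
    case (of w)
    note w = wB[OF of]
    have "part \<kappa> (tcomp (embed_tensor a r b L) (frag_of w))
        = frag_extend (\<lambda>x. part \<kappa> (frag_of (plug (embed a r b x) w))) L"
      using additive_frag_extend[of "\<lambda>y. part \<kappa> (frag_extend (\<lambda>u. frag_of (plug u w)) y)"
            "\<lambda>x. frag_of (embed a r b x)" L]
      by (simp add: tcomp_def part_diff frag_extend_diff)
    also have "\<dots> = frag_extend (\<lambda>x. if pattern a r w = \<kappa> then frag_of (plug x (block_part a r w)) else 0) L"
      by (rule frag_extend_cong[OF L])
         (simp add: part_def pattern_plug_embed[OF _ w(1)] block_part_plug_embed[OF _ w(1)])
    also have "\<dots> = tcomp L (part \<kappa> (frag_of w))"
      by (simp add: part_def tcomp_def frag_extend_eq_0)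
    finally show ?case by simp
  qed (simp_all add: part_def tcomp_diff_right frag_extend_diff)
  have "x = (\<Sum>\<kappa>\<in>K. tcomp (embed_tensor a r b (part \<kappa> x)) (frag_of (t \<kappa>)))"
    if "x \<in> carrier (free_Abelian_group (Poly_Mapping.keys \<Omega>))" for x
    using that
  proof (induction x rule: frag_induct)
    case (of w)
    then have w: "w \<in> B" using \<Omega> by auto
    have "(\<Sum>\<kappa>\<in>K. tcomp (embed_tensor a r b (part \<kappa> (frag_of w))) (frag_of (t \<kappa>)))
        = (\<Sum>\<kappa>\<in>K. if \<kappa> = pattern a r w then frag_of w else 0)"
      by (rule sum.cong) (auto simp: part_def tcomp_def fill[OF w])
    also have "\<dots> = frag_of w"
      using of by (simp add: K_def)
    finally show ?case ..
  next
    case (diff x y)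
    then show ?case
      by (simp add: part_diff frag_extend_diff tcomp_def sum_subtractf)
  qed (simp add: part_def tcomp_def)
  then have dec: "\<Omega> = (\<Sum>\<kappa>\<in>K. tcomp (embed_tensor a r b (part \<kappa> \<Omega>)) (frag_of (t \<kappa>)))"
    by simp
  have fin: "finite K" by (simp add: K_def)
  have t_words: "t \<kappa> \<in> words {1..a + r + b} m" if "\<kappa> \<in> K" for \<kappa>
    using that fill(2) \<Omega> by (auto simp: K_def)
  have ann_part: "tcomp L (part \<kappa> \<Omega>) = 0" for \<kappa>
    unfolding part_comp ann by (simp add: part_def)
  show ?thesis
    by (rule exI[of _ K], rule exI[of _ "\<lambda>\<kappa>. part \<kappa> \<Omega>"], rule exI[of _ t])
       (intro conjI ballI fin dec part_tensors ann_part t_words)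
qed

section \<open>The bracket of two Lie elements as a left-normed bracket\<close>

text \<open>Multilinear tensors, in which every letter of a given word occurs as often as in the word, are
  closed under the operations in use, and their words have the right number of letters in every block.\<close>

definition rearrangements :: "nat list \<Rightarrow> nat list set" where
  "rearrangements w = {v. mset v = mset w}"

abbreviation multilinear :: "nat list \<Rightarrow> tensor set" where
  "multilinear w \<equiv> carrier (free_Abelian_group (rearrangements w))"

lemma multilinear_mult:
  assumes "x \<in> multilinear u" "y \<in> multilinear v"
  shows "x * y \<in> multilinear (u @ v)"
proof -
  have "Poly_Mapping.keys (x * y) \<subseteq> {u + v |u v. u \<in> Poly_Mapping.keys x \<and> v \<in> Poly_Mapping.keys y}"
    by (rule keys_mult)
  also have "\<dots> \<subseteq> rearrangements (u @ v)"
    using assms by (fastforce simp: rearrangements_def)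
  finally show ?thesis by simp
qed

lemma multilinear_sbr:
  assumes "x \<in> multilinear u" "y \<in> multilinear v"
  shows "sbr p q x y \<in> multilinear (u @ v)"
proof -
  have 1: "x * y \<in> multilinear (u @ v)" "y * x \<in> multilinear (u @ v)"
    using multilinear_mult[OF assms] multilinear_mult[OF assms(2,1)]
    by (simp_all add: rearrangements_def add.commute)
  then have "(- 1) ^ (p * q) * (y * x) \<in> multilinear (u @ v)"
    by (cases "even (p * q)") simp_all
  with 1 show ?thesis
    unfolding sbr_def using keys_diff[of "x * y" "(- 1) ^ (p * q) * (y * x)"] by auto
qed

lemma multilinear_nest: "t \<in> multilinear u \<Longrightarrow> nest k t w \<in> multilinear (u @ w)"
proof (induction w arbitrary: k t u)
  case (Cons a w)
  have "sbr k 1 t (frag_of [a]) \<in> multilinear (u @ [a])"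
    by (rule multilinear_sbr[OF Cons.prems]) (simp add: rearrangements_def)
  from Cons.IH[OF this] show ?case by simp
qed simp

lemma multilinear_block:
  assumes "x \<in> multilinear (ival 0 (a + r + b))"
  shows "x \<in> carrier (free_Abelian_group
    {w \<in> words {1..a + r + b} (a + r + b). length (filter (in_block a r) w) = r})"
proof -
  have "w \<in> words {1..a + r + b} (a + r + b) \<and> length (filter (in_block a r) w) = r"
    if "mset w = mset (ival 0 (a + r + b))" for w
  proof -
    have "filter (in_block a r) (ival 0 (a + r + b)) = ival a r"
    proof -
      have "ival 0 (a + r + b) = ival 0 a @ ival a r @ ival (a + r) b"
        using ival_append[of a r b] ival_append[of 0 a "r + b"] by (simp add: add.assoc)
      moreover have "filter (in_block a r) (ival 0 a) = []" "filter (in_block a r) (ival a r) = ival a r"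
        "filter (in_block a r) (ival (a + r) b) = []"
        unfolding filter_empty_conv filter_id_conv by (auto simp: in_block_def)
      ultimately show ?thesis by (simp)
    qed
    then have "length (filter (in_block a r) w) = r"
      using that by (metis length_ival mset_filter size_mset)
    moreover have "set w = {1..a + r + b}"
      using that by (auto dest: mset_eq_setD)
    moreover have "length w = a + r + b"
      using that by (metis size_mset length_ival)
    ultimately show ?thesis by (auto simp: words_def)
  qed
  then show ?thesis using assms unfolding carrier_free_Abelian_group_iff rearrangements_def by blast
qed

lemma embed_ival:
  assumes "x \<in> words {1..r} r"
  shows "map (\<lambda>j. embed a r b x ! (j - 1)) (ival 0 a) = ival 0 a"
    and "map (\<lambda>j. embed a r b x ! (j - 1)) (ival a r) = map ((+) a) x"
    and "map (\<lambda>j. embed a r b x ! (j - 1)) (ival (a + r) b) = ival (a + r) b"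
proof -
  have n: "embed a r b x ! (c - 1) = (if in_block a r c then a + x ! (c - a - 1) else c)"
    if "c \<in> {1..a + r + b}" for c
    using assms by (intro embed_nth that) (simp add: words_def)
  show "map (\<lambda>j. embed a r b x ! (j - 1)) (ival 0 a) = ival 0 a"
    "map (\<lambda>j. embed a r b x ! (j - 1)) (ival (a + r) b) = ival (a + r) b"
  proof (rule_tac [!] map_idI)
    show "embed a r b x ! (c - 1) = c" if "c \<in> set (ival 0 a)" for c
      using n[of c] that by (auto simp: in_block_def)
    show "embed a r b x ! (c - 1) = c" if "c \<in> set (ival (a + r) b)" for c
      using n[of c] that by (auto simp: in_block_def)
  qed
  show "map (\<lambda>j. embed a r b x ! (j - 1)) (ival a r) = map ((+) a) x"
  proof (rule nth_equalityI)
    fix i assume "i < length (map (\<lambda>j. embed a r b x ! (j - 1)) (ival a r))"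
    then have i: "i < r" by simp
    then show "map (\<lambda>j. embed a r b x ! (j - 1)) (ival a r) ! i = map ((+) a) x ! i"
      using n[of "Suc (a + i)"] assms by (simp add: in_block_def words_def)
  qed (use assms in \<open>simp add: words_def\<close>)
qed

lemma tcomp_embed_tensor:
  "tcomp (embed_tensor a r b L) x = frag_extend (\<lambda>u. relabel (\<lambda>j. embed a r b u ! (j - 1)) x) L"
  unfolding tcomp_conv_relabel
  by (subst additive_frag_extend) (simp_all add: frag_extend_diff)

lemma relabel_add_lie: "relabel ((+) a) (lie (ival 0 r)) = lie (ival a r)"
  unfolding relabel_lie map_add_ival by simp

text \<open>The identities \<open>[\<dots>[V, y\<^sub>1], \<dots>, y\<^sub>q] = [V, Y]\<close> and \<open>[y\<^sub>1, V] = [\<dots>[y\<^sub>1, v\<^sub>1], \<dots>, v\<^sub>p]\<close>, the latter bracketed with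
  \<open>y\<^sub>2, \<dots>, y\<^sub>q\<close>, hold for Lie elements. The defects are the differences of their two sides for the words
  \<open>V = 1 \<dots> p\<close> and \<open>Y = p+1 \<dots> p+q\<close>.\<close>

definition right_defect :: "nat \<Rightarrow> nat \<Rightarrow> tensor" where
  "right_defect p q = nest p (frag_of (ival 0 p)) (ival p q)
     - sbr p q (frag_of (ival 0 p)) (frag_of (ival p q))"

definition left_defect :: "nat \<Rightarrow> nat \<Rightarrow> tensor" where
  "left_defect p q = nest (Suc p) (sbr 1 p (frag_of [Suc p]) (frag_of (ival 0 p))
     - nest 1 (frag_of [Suc p]) (ival 0 p)) (ival (Suc p) (q - 1))"

text \<open>Modulo the defects, \<open>[V, Y]\<close> is the left-normed bracket of a single word.\<close>

lemma sbr_eq_lie_defects: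
  assumes "q \<noteq> 0"
  shows "sbr p q (frag_of (ival 0 p)) (frag_of (ival p q)) =
    (- 1) ^ Suc p * lie (Suc p # ival 0 p @ ival (Suc p) (q - 1))
    - right_defect p q - (- 1) ^ p * left_defect p q"
proof -
  have "nest p (frag_of (ival 0 p)) (ival p q) =
     nest (Suc p) (sbr p 1 (frag_of (ival 0 p)) (frag_of [Suc p])) (ival (Suc p) (q - 1))"
    by (simp add: ival_Cons[OF assms])
  also have "sbr p 1 (frag_of (ival 0 p)) (frag_of [Suc p]) =
      - ((- 1) ^ p * sbr 1 p (frag_of [Suc p]) (frag_of (ival 0 p)))"
    using sbr_antisym[of p 1] by simp
  finally have "nest p (frag_of (ival 0 p)) (ival p q) = - ((- 1) ^ p * (left_defect p q
     + nest (Suc p) (nest 1 (frag_of [Suc p]) (ival 0 p)) (ival (Suc p) (q - 1))))"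
    by (simp add: left_defect_def nest_minus nest_sign nest_diff)
  moreover have "lie (Suc p # ival 0 p @ ival (Suc p) (q - 1)) =
     nest (Suc p) (nest 1 (frag_of [Suc p]) (ival 0 p)) (ival (Suc p) (q - 1))"
    by (simp add: nest_append)
  ultimately show ?thesis
    by (simp add: right_defect_def algebra_simps)
qed

lemma right_defect_multilinear: "right_defect p q \<in> multilinear (ival 0 (p + q))"
proof -
  have V: "frag_of (ival 0 p) \<in> multilinear (ival 0 p)" "frag_of (ival p q) \<in> multilinear (ival p q)"
    by (simp_all add: rearrangements_def)
  have "ival 0 (p + q) = ival 0 p @ ival p q" using ival_append[of 0 p q] by simp
  then show ?thesis
    unfolding right_defect_def
    using multilinear_nest[OF V(1), of p "ival p q"] multilinear_sbr[OF V, of p q]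
      keys_diff[of "nest p (frag_of (ival 0 p)) (ival p q)"
        "sbr p q (frag_of (ival 0 p)) (frag_of (ival p q))"]
    by auto
qed

lemma left_defect_multilinear:
  assumes "q \<noteq> 0"
  shows "left_defect p q \<in> multilinear (ival 0 (p + q))"
proof -
  have V: "frag_of [Suc p] \<in> multilinear [Suc p]" "frag_of (ival 0 p) \<in> multilinear (ival 0 p)"
    by (simp_all add: rearrangements_def)
  have "sbr 1 p (frag_of [Suc p]) (frag_of (ival 0 p)) - nest 1 (frag_of [Suc p]) (ival 0 p)
      \<in> multilinear ([Suc p] @ ival 0 p)"
    using multilinear_nest[OF V(1), of 1 "ival 0 p"] multilinear_sbr[OF V, of 1 p]
      keys_diff[of "sbr 1 p (frag_of [Suc p]) (frag_of (ival 0 p))" "nest 1 (frag_of [Suc p]) (ival 0 p)"]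
    by auto
  then have "left_defect p q \<in> multilinear (([Suc p] @ ival 0 p) @ ival (Suc p) (q - 1))"
    unfolding left_defect_def by (rule multilinear_nest)
  moreover have "ival 0 (p + q) = ival 0 p @ Suc p # ival (Suc p) (q - 1)"
    using ival_append[of 0 p q] ival_Cons[OF assms, of p] by simp
  ultimately show ?thesis by (simp add: rearrangements_def)
qed

text \<open>Replacing the word \<open>Y\<close> by the Lie element \<open>\<lambda>(Y)\<close> makes the defect vanish, by \<open>nest_lie\<close>.\<close>

lemma right_defect_annihilated:
  assumes "q \<noteq> 0"
  shows "tcomp (embed_tensor p q 0 (lie (ival 0 q))) (right_defect p q) = 0"
proof -
  let ?V = "frag_of (ival 0 p)" and ?L = "lie (ival 0 q)"
  have L: "?L \<in> tensors {1..q} q" by (intro lie_tensors ival_words) simp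
  have "tcomp (embed_tensor p q 0 ?L) (right_defect p q)
     = frag_extend (\<lambda>x. nest p ?V (map ((+) p) x) - sbr p q ?V (frag_of (map ((+) p) x))) ?L"
    unfolding tcomp_embed_tensor
    by (rule frag_extend_cong[OF L])
       (simp only: right_defect_def relabel_diff relabel_nest relabel_sbr relabel_frag_of embed_ival)
  also have "\<dots> = frag_extend (nest p ?V) (relabel ((+) p) ?L) - sbr p q ?V (relabel ((+) p) ?L)"
    unfolding frag_extend_fun_diff relabel_def sbr_frag_extend_right
    by (subst (2) additive_frag_extend) (simp_all add: frag_extend_diff)
  also have "\<dots> = 0"
    unfolding relabel_add_lie using nest_lie[of "ival p q" p ?V] assms by simp
  finally show ?thesis .
qed

text \<open>Replacing the word \<open>V\<close> by the Lie element \<open>\<lambda>(V)\<close> makes the defect vanish, by \<open>nest_lie\<close>.\<close>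

lemma left_defect_annihilated:
  assumes "p \<noteq> 0" "q \<noteq> 0"
  shows "tcomp (embed_tensor 0 p q (lie (ival 0 p))) (left_defect p q) = 0"
proof -
  let ?a = "frag_of [Suc p]" and ?L = "lie (ival 0 p)" and ?Y = "ival (Suc p) (q - 1)"
  have L: "?L \<in> tensors {1..p} p" by (intro lie_tensors ival_words) simp
  have Y: "map (\<lambda>j. embed 0 p q x ! (j - 1)) [Suc p] = [Suc p]"
     "map (\<lambda>j. embed 0 p q x ! (j - 1)) ?Y = ?Y" if "x \<in> words {1..p} p" for x
    using embed_ival(3)[OF that, of 0 q] ival_Cons[OF assms(2), of p] by simp_all
  have "tcomp (embed_tensor 0 p q ?L) (left_defect p q)
     = frag_extend (\<lambda>x. nest (Suc p) (sbr 1 p ?a (frag_of x) - nest 1 ?a x) ?Y) ?L"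
    unfolding tcomp_embed_tensor
  proof (rule frag_extend_cong[OF L])
    fix x assume x: "x \<in> words {1..p} p"
    have "map (\<lambda>j. embed 0 p q x ! (j - 1)) (ival 0 p) = x"
      using embed_ival(2)[OF x, of 0 q] by (simp add: map_idI)
    then show "relabel (\<lambda>j. embed 0 p q x ! (j - 1)) (left_defect p q)
      = nest (Suc p) (sbr 1 p ?a (frag_of x) - nest 1 ?a x) ?Y"
      by (simp only: left_defect_def relabel_diff relabel_nest relabel_sbr relabel_frag_of Y[OF x])
  qed
  also have "\<dots> = nest (Suc p) (frag_extend (\<lambda>x. sbr 1 p ?a (frag_of x) - nest 1 ?a x) ?L) ?Y"
    by (rule additive_frag_extend[symmetric]) (rule nest_diff)
  also have "frag_extend (\<lambda>x. sbr 1 p ?a (frag_of x) - nest 1 ?a x) ?L = 0"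
    unfolding frag_extend_fun_diff sbr_frag_extend_right frag_expansion[symmetric]
    using nest_lie[of "ival 0 p" 1 ?a] assms by simp
  finally show ?thesis by (simp add: nest_zero)
qed


section \<open>Maps between the standard finite sets as words\<close>

definition word_map :: "nat list \<Rightarrow> nat \<Rightarrow> nat" where
  "word_map w = (\<lambda>j \<in> {1..length w}. w ! (j - 1))"

abbreviation map_tensor :: "tensor \<Rightarrow> ((nat \<Rightarrow> nat) \<Rightarrow>\<^sub>0 int)" where
  "map_tensor \<equiv> frag_extend (\<lambda>w. frag_of (word_map w))"

lemma word_map_PiE: "w \<in> words S m \<Longrightarrow> word_map w \<in> {1..m} \<rightarrow>\<^sub>E S"
  by (force simp: word_map_def words_def)

lemma word_map_plug:
  assumes "u \<in> words S n" "v \<in> words {1..n} m"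
  shows "compose {1..m} (word_map u) (word_map v) = word_map (plug u v)"
proof
  fix j
  show "compose {1..m} (word_map u) (word_map v) j = word_map (plug u v) j"
  proof (cases "j \<in> {1..m}")
    case True
    then have "v ! (j - 1) \<in> {1..n}"
      using assms(2) nth_mem[of "j - 1" v] by (fastforce simp: words_def)
    then show ?thesis using True assms
      by (auto simp: compose_def word_map_def plug_def words_def)
  qed (use assms in \<open>auto simp: compose_def word_map_def plug_def words_def\<close>)
qed

lemma word_map_map_ival: "word_map (map f (ival 0 n)) = restrict f {1..n}"
  by (auto simp: word_map_def restrict_def fun_eq_iff)

lemma word_map_ival: "word_map (ival 0 n) = (\<lambda>x \<in> {1..n}. x)"
  using word_map_map_ival[of "\<lambda>x. x" n] by simp

lemma minus_one_power_cases: "(- 1) ^ k = (1::int) \<or> (- 1) ^ k = (- 1 :: int)"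
  by (cases "even k") simp_all

lemma dbl_conv_sum: "dbl w = (\<Sum>i<length w. frag_cmul ((- 1) ^ i) (frag_of (take (Suc i) w @ drop i w)))"
proof (induction w)
  case (Cons a w)
  have cm: "frag_of [a] * frag_cmul c x = frag_cmul c (frag_of [a] * x)" if "c = 1 \<or> c = - 1"
    for c :: int and x :: tensor
    using that by auto
  have "frag_of [a] * dbl w
      = (\<Sum>i<length w. frag_cmul ((- 1) ^ i) (frag_of (a # take (Suc i) w @ drop i w)))"
    unfolding Cons sum_distrib_left
    by (rule sum.cong) (auto simp: cm minus_one_power_cases mult_single)
  then show ?case
    by (simp add: sum.lessThan_Suc_shift sum_negf[symmetric] del: sum.lessThan_Suc)
qed simp

text \<open>The map \<open>\<delta>\<^sub>i\<close> is the word \<open>1 \<dots> i i \<dots> n\<close>.\<close>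

lemma f_elem_eq_dbl: "f_elem n = map_tensor (dbl (ival 0 n))"
proof -
  have d: "delta n (Suc i) = word_map (take (Suc i) (ival 0 n) @ drop i (ival 0 n))" if "i < n" for i
    using that by (auto simp: delta_def word_map_def fun_eq_iff nth_append min_def)
  have "f_elem n = (\<Sum>i<n. frag_cmul ((- 1) ^ i) (frag_of (delta n (Suc i))))"
    unfolding f_elem_def by (rule sum.reindex_bij_witness[of _ Suc "\<lambda>i. i - 1"]) auto
  also have "\<dots> = map_tensor (dbl (ival 0 n))"
    unfolding dbl_conv_sum
    by (subst frag_extend_sum) (auto simp: frag_extend_cmul d intro!: sum.cong)
  finally show ?thesis .
qed

definition cyc_inv :: "nat \<Rightarrow> nat \<Rightarrow> nat" where
  "cyc_inv i j = (if j = 1 \<and> 1 \<le> i then i else if 1 < j \<and> j \<le> i then j - 1 else j)"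

lemma inv_cyc: "inv_into UNIV (cyc i) = cyc_inv i"
  by (rule inv_equality) (auto simp: cyc_def cyc_inv_def)

lemma bij_cyc: "bij (cyc i)"
  by (rule o_bij[of "cyc_inv i"]) (auto simp: cyc_def cyc_inv_def fun_eq_iff)

text \<open>In $\widetilde{w_n}$ a permutation acts by precomposition with its inverse, so it is read as the word of
  the inverse.\<close>

definition inv_word :: "nat \<Rightarrow> (nat \<Rightarrow> nat) \<Rightarrow> nat list" where
  "inv_word n \<sigma> = map (inv_into UNIV \<sigma>) (ival 0 n)"

text \<open>The place permutation by \<open>c\<^sub>k\<^sub>+\<^sub>1\<close>: the entry at the place \<open>k + 1\<close> moves to the front.\<close>

definition rotate_prefix :: "nat \<Rightarrow> nat list \<Rightarrow> nat list" where
  "rotate_prefix k w = w ! k # take k w @ drop (Suc k) w"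

lemma inv_word_cyc:
  assumes "bij \<sigma>" "k < n"
  shows "inv_word n (cyc (Suc k) \<circ> \<sigma>) = rotate_prefix k (inv_word n \<sigma>)"
proof (rule nth_equalityI)
  show "length (inv_word n (cyc (Suc k) \<circ> \<sigma>)) = length (rotate_prefix k (inv_word n \<sigma>))"
    using assms by (simp add: inv_word_def rotate_prefix_def)
next
  fix i assume "i < length (inv_word n (cyc (Suc k) \<circ> \<sigma>))"
  then have i: "i < n" by (simp add: inv_word_def)
  have "inv_into UNIV (cyc (Suc k) \<circ> \<sigma>) = inv_into UNIV \<sigma> \<circ> cyc_inv (Suc k)"
    using o_inv_distrib[OF bij_cyc assms(1)] by (simp add: inv_cyc)
  then show "inv_word n (cyc (Suc k) \<circ> \<sigma>) ! i = rotate_prefix k (inv_word n \<sigma>) ! i"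
    using i assms(2) by (cases i) (auto simp: inv_word_def rotate_prefix_def cyc_inv_def nth_append)
qed

lemma rotate_prefix_tensor:
  assumes "x \<in> tensors S k"
  shows "frag_extend (\<lambda>w. frag_of (rotate_prefix k w)) (x * frag_of (c # v)) = frag_of [c] * x * frag_of v"
  using assms
proof (induction x rule: frag_induct)
  case (of w)
  then show ?case
    by (simp add: words_def rotate_prefix_def mult_single nth_append)
qed (simp_all add: frag_extend_diff algebra_simps)

text \<open>Right multiplication by \<open>1 + (-1)\<^bsup>k+1\<^esup> c\<^sub>k\<^sub>+\<^sub>1\<close> maps a word \<open>u a v\<close>, \<open>u\<close> of length \<open>k\<close>, to
  \<open>(u a - (-1)\<^sup>k a u) v = [u, a] v\<close>. Thus the first factors of \<open>w\<^sub>n\<close> bracket the first letters.\<close>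

lemma w_elem_eq_lie:
  assumes "1 \<le> k" "k \<le> n"
  shows "Poly_Mapping.keys (w_elem k) \<subseteq> {\<sigma>. bij \<sigma>} \<and>
    frag_extend (\<lambda>\<sigma>. frag_of (inv_word n \<sigma>)) (w_elem k) = lie (ival 0 k) * frag_of (ival k (n - k))"
  using assms
proof (induction k rule: dec_induct)
  case base
  have "ival 0 n = 1 # ival 1 (n - 1)"
    using ival_Cons[of n 0] base by simp
  moreover have "ival 0 1 = [1]" by (simp add: ival_Cons)
  ultimately show ?case
    by (simp add: w_elem_def inv_word_def mult_single)
next
  case (step k)
  let ?s = "(- 1 :: int) ^ Suc k" and ?W = "\<lambda>\<sigma>. frag_of (inv_word n \<sigma>)"
  have IH: "Poly_Mapping.keys (w_elem k) \<subseteq> {\<sigma>. bij \<sigma>}"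
    "frag_extend ?W (w_elem k) = lie (ival 0 k) * frag_of (ival k (n - k))"
    using step by simp_all
  have kn: "k < n" and l: "lie (ival 0 k) \<in> tensors UNIV k"
    using step by (simp, intro lie_tensors wordsI) simp_all
  have "w_elem (Suc k) = w_elem k \<star> (frag_of id + frag_cmul ?s (frag_of (cyc (Suc k))))"
    using step by (simp add: w_elem_def)
  then have w: "w_elem (Suc k) =
      frag_extend (\<lambda>\<sigma>. frag_of \<sigma> + frag_cmul ?s (frag_of (cyc (Suc k) \<circ> \<sigma>))) (w_elem k)"
    by (simp add: gr_mult_def frag_extend_add frag_extend_cmul)
  have "Poly_Mapping.keys (w_elem (Suc k)) \<subseteq> {\<sigma>. bij \<sigma>}"
  proof -
    have "Poly_Mapping.keys (frag_of \<sigma> + frag_cmul ?s (frag_of (cyc (Suc k) \<circ> \<sigma>))) \<subseteq> {\<sigma>. bij \<sigma>}"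
      if "bij \<sigma>" for \<sigma>
      using that bij_cyc[of "Suc k"] keys_add[of "frag_of \<sigma>" "frag_cmul ?s (frag_of (cyc (Suc k) \<circ> \<sigma>))"]
      by (auto simp: bij_comp)
    then show ?thesis
      unfolding w
      by (intro order_trans[OF keys_frag_extend] UN_least) (use IH(1) in blast)
  qed
  moreover
  have "frag_extend ?W (w_elem (Suc k)) = lie (ival 0 (Suc k)) * frag_of (ival (Suc k) (n - Suc k))"
  proof -
    have iv: "ival k (n - k) = Suc k # ival (Suc k) (n - Suc k)"
      using ival_Cons[of "n - k" k] kn by simp
    have "frag_extend ?W (w_elem (Suc k))
        = frag_extend (\<lambda>\<sigma>. ?W \<sigma> + frag_cmul ?s (?W (cyc (Suc k) \<circ> \<sigma>))) (w_elem k)"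
      unfolding w by (subst additive_frag_extend)
        (simp_all add: frag_extend_diff frag_extend_add frag_extend_cmul)
    also have "\<dots> = frag_extend (\<lambda>\<sigma>. ?W \<sigma> + frag_cmul ?s (frag_of (rotate_prefix k (inv_word n \<sigma>)))) (w_elem k)"
      by (rule frag_extend_cong[of _ "{\<sigma>. bij \<sigma>}"]) (use IH(1) kn in \<open>simp_all add: inv_word_cyc\<close>)
    also have "\<dots> = frag_extend (\<lambda>w. frag_of w + frag_cmul ?s (frag_of (rotate_prefix k w)))
        (frag_extend ?W (w_elem k))"
      by (subst additive_frag_extend) (simp_all add: frag_extend_diff)
    also have "\<dots> = frag_extend (\<lambda>w. frag_of w - frag_cmul (- ?s) (frag_of (rotate_prefix k w)))
        (frag_extend ?W (w_elem k))"
      by (simp flip: minus_frag_cmul)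
    also have "\<dots> = frag_extend ?W (w_elem k)
        - frag_cmul (- ?s) (frag_extend (\<lambda>w. frag_of (rotate_prefix k w)) (frag_extend ?W (w_elem k)))"
      unfolding frag_extend_fun_diff frag_extend_fun_cmul frag_expansion[symmetric] ..
    also have "\<dots> = lie (ival 0 k) * frag_of (ival k (n - k))
        - frag_cmul (- ?s) (frag_of [Suc k] * lie (ival 0 k) * frag_of (ival (Suc k) (n - Suc k)))"
      unfolding IH(2) unfolding iv rotate_prefix_tensor[OF l] ..
    also have "\<dots> = sbr k 1 (lie (ival 0 k)) (frag_of [Suc k]) * frag_of (ival (Suc k) (n - Suc k))"
      unfolding iv frag_of_Cons[of "Suc k" "ival (Suc k) (n - Suc k)"] sbr_def
      by (cases "even k") (simp_all add: algebra_simps)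
    also have "sbr k 1 (lie (ival 0 k)) (frag_of [Suc k]) = lie (ival 0 (Suc k))"
      using lie_snoc[of "ival 0 k" "Suc k"] step by (simp add: ival_Suc)
    finally show ?thesis .
  qed
  ultimately show ?case by simp
qed

lemma w_tilde_eq_lie:
  assumes "1 \<le> n"
  shows "w_tilde n = map_tensor (lie (ival 0 n))"
proof -
  have "map_tensor (lie (ival 0 n)) = map_tensor (frag_extend (\<lambda>\<sigma>. frag_of (inv_word n \<sigma>)) (w_elem n))"
    using w_elem_eq_lie[OF assms order_refl] by (simp add: frag_of_Nil)
  also have "\<dots> = frag_extend (\<lambda>\<sigma>. frag_of (restrict (inv_into UNIV \<sigma>) {1..n})) (w_elem n)"
    by (subst additive_frag_extend[of map_tensor])
       (simp_all add: frag_extend_diff inv_word_def word_map_map_ival)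
  finally show ?thesis by (simp add: w_tilde_def)
qed

text \<open>This keeps \<open>{1..n}\<close> in the form in which the definitions mention it.\<close>

declare One_nat_def [simp del]

section \<open>Calculation in an additive tensor category\<close>

text \<open>Additive maps out of combinations of words are compared on words.\<close>

lemma free_hom_eqI:
  assumes "group G" "L \<in> hom (free_Abelian_group S) G" "L' \<in> hom (free_Abelian_group S) G"
    and "\<And>w. w \<in> S \<Longrightarrow> L (frag_of w) = L' (frag_of w)" "x \<in> carrier (free_Abelian_group S)"
  shows "L x = L' x"
proof -
  interpret L: group_hom "free_Abelian_group S" G L
    using assms by (simp add: group_hom_def group_hom_axioms_def)
  interpret L': group_hom "free_Abelian_group S" G L'
    using assms by (simp add: group_hom_def group_hom_axioms_def)
  have x: "Poly_Mapping.keys x \<subseteq> S" using assms(5) by simp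
  show ?thesis
  proof (rule free_Abelian_group_induct[OF x])
    fix x y
    assume xy: "Poly_Mapping.keys x \<subseteq> S" "Poly_Mapping.keys y \<subseteq> S" "L x = L' x" "L y = L' y"
    have m: "(x - y) \<otimes>\<^bsub>free_Abelian_group S\<^esub> y = x" by simp
    have c: "x - y \<in> carrier (free_Abelian_group S)" "y \<in> carrier (free_Abelian_group S)"
      using xy keys_diff[of x y] by auto
    have "L (x - y) \<otimes>\<^bsub>G\<^esub> L y = L' (x - y) \<otimes>\<^bsub>G\<^esub> L y"
      using L.hom_mult[OF c] L'.hom_mult[OF c] xy unfolding m by simp
    then show "L (x - y) = L' (x - y)"
      using c by (simp del: carrier_free_Abelian_group_iff)
  qed (use assms L.hom_one L'.hom_one in simp_all)
qed

lemma (in comm_group) lincomb_hom: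
  fixes f :: "'c \<Rightarrow> 'a"
  assumes "f ` S \<subseteq> carrier G"
  shows "(\<lambda>u. finprod G (\<lambda>x. f x [^] (Poly_Mapping.lookup u x)) (Poly_Mapping.keys u))
    \<in> hom (free_Abelian_group S) G"
proof (rule homI)
  let ?L = "\<lambda>u :: 'c \<Rightarrow>\<^sub>0 int. finprod G (\<lambda>x. f x [^] (Poly_Mapping.lookup u x)) (Poly_Mapping.keys u)"
  have f: "f x \<in> carrier G" if "x \<in> S" for x using that assms by auto
  show "?L u \<in> carrier G" if "u \<in> carrier (free_Abelian_group S)" for u
    using that f by (intro finprod_closed) auto
  fix u v assume u: "u \<in> carrier (free_Abelian_group S)" and v: "v \<in> carrier (free_Abelian_group S)"
  let ?K = "Poly_Mapping.keys u \<union> Poly_Mapping.keys v"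
  have ext: "?L t = finprod G (\<lambda>x. f x [^] (Poly_Mapping.lookup t x)) ?K"
    if "Poly_Mapping.keys t \<subseteq> ?K" for t
  proof (rule finprod_mono_neutral_cong_left)
    show "f x [^] Poly_Mapping.lookup t x = \<one>" if "x \<in> ?K - Poly_Mapping.keys t" for x
      using that by (simp add: in_keys_iff)
  qed (use that u v f in auto)
  have "?L (u + v) = finprod G (\<lambda>x. f x [^] (Poly_Mapping.lookup (u + v) x)) ?K"
    by (rule ext[OF keys_add])
  also have "\<dots> = finprod G (\<lambda>x. f x [^] (Poly_Mapping.lookup u x) \<otimes> f x [^] (Poly_Mapping.lookup v x)) ?K"
    using u v f by (intro finprod_cong') (auto simp: lookup_add int_pow_mult)
  also have "\<dots> = ?L u \<otimes> ?L v"
    using u v f by (subst finprod_multf) (auto simp: ext)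
  finally show "?L (u \<otimes>\<^bsub>free_Abelian_group S\<^esub> v) = ?L u \<otimes> ?L v" by simp
qed


lemma hom_compose':
  "f \<in> hom G H \<Longrightarrow> g \<in> hom H I \<Longrightarrow> (\<lambda>x. g (f x)) \<in> hom G I"
  using hom_compose[of f G H g I] by (simp add: comp_def)

lemma free_homI:
  assumes "\<And>x. x \<in> carrier (free_Abelian_group S) \<Longrightarrow> M x \<in> carrier (free_Abelian_group S')"
    and "\<And>x y. M (x + y) = M x + M y"
  shows "M \<in> hom (free_Abelian_group S) (free_Abelian_group S')"
  using assms by (intro homI) simp_all

context small_category
begin

lemma Hom_objD: "f \<in> Hom A X Y \<Longrightarrow> X \<in> Obj A" "f \<in> Hom A X Y \<Longrightarrow> Y \<in> Obj A"
  using src_obj tgt_obj by (auto simp: Hom_def)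

lemma HomD: "f \<in> Hom A X Y \<Longrightarrow> f \<in> Arr A" "f \<in> Hom A X Y \<Longrightarrow> Src A f = X"
  "f \<in> Hom A X Y \<Longrightarrow> Tgt A f = Y"
  by (auto simp: Hom_def)

lemma HomI: "f \<in> Arr A \<Longrightarrow> Src A f = X \<Longrightarrow> Tgt A f = Y \<Longrightarrow> f \<in> Hom A X Y"
  by (simp add: Hom_def)

text \<open>Source and target are rewritten here as functions, so that the simplifier can check by itself that
  composites are defined and normalise them; compositions are associated to the right and tensor
  products of maps are composed factorwise.\<close>

lemma arr_comp:
  assumes "f \<in> Arr A" "g \<in> Arr A" "Src A g = Tgt A f"
  shows "g \<cdot> f \<in> Arr A" "Src A (g \<cdot> f) = Src A f" "Tgt A (g \<cdot> f) = Tgt A g"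
  using comp_hom[of f "Src A f" "Tgt A f" g "Tgt A g"] assms by (simp_all add: Hom_def)

lemma arr_assoc:
  assumes "f \<in> Arr A" "g \<in> Arr A" "h \<in> Arr A" "Src A g = Tgt A f" "Src A h = Tgt A g"
  shows "(h \<cdot> g) \<cdot> f = h \<cdot> (g \<cdot> f)"
  using comp_assoc[of f "Src A f" "Tgt A f" g "Tgt A g" h "Tgt A h"] assms by (simp add: Hom_def)

lemma arr_id:
  assumes "X \<in> Obj A"
  shows "Idt A X \<in> Arr A" "Src A (Idt A X) = X" "Tgt A (Idt A X) = X"
  using id_hom[OF assms] by (simp_all add: Hom_def)

lemma arr_id_comp:
  "f \<in> Arr A \<Longrightarrow> Src A f = X \<Longrightarrow> f \<cdot> Idt A X = f" "f \<in> Arr A \<Longrightarrow> Tgt A f = X \<Longrightarrow> Idt A X \<cdot> f = f"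
  using id_left[of f "Src A f" X] id_right[of f X "Tgt A f"] by (auto simp: Hom_def)

lemmas arr_simps = arr_comp arr_assoc arr_id arr_id_comp

end

context additive_category
begin

lemma hom_group_simps [simp]: "carrier (hom_group A X Y) = Hom A X Y"
  "f \<otimes>\<^bsub>hom_group A X Y\<^esub> g = f \<boxplus> g" "\<one>\<^bsub>hom_group A X Y\<^esub> = Zer A X Y"
  by (simp_all add: hom_group_def)

lemma add_hom: "f \<in> Hom A X Y \<Longrightarrow> g \<in> Hom A X Y \<Longrightarrow> f \<boxplus> g \<in> Hom A X Y"
  using monoid.m_closed[OF group.is_monoid[OF comm_group.axioms(2)[OF hom_comm_group]], of X Y f g] Hom_objD[of f X Y]
  by simp

lemma zer_hom: "X \<in> Obj A \<Longrightarrow> Y \<in> Obj A \<Longrightarrow> Zer A X Y \<in> Hom A X Y"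
  using monoid.one_closed[OF group.is_monoid[OF comm_group.axioms(2)[OF hom_comm_group]], of X Y] by simp

lemma hom_group_group: "f \<in> Hom A X Y \<Longrightarrow> group (hom_group A X Y)"
  using comm_group.axioms(2)[OF hom_comm_group] Hom_objD by blast

lemma scal_pow: "f \<in> Hom A X Y \<Longrightarrow> scal A n f = f [^]\<^bsub>hom_group A X Y\<^esub> n"
  by (simp add: scal_def HomD)

lemma scal_hom: "f \<in> Hom A X Y \<Longrightarrow> scal A n f \<in> Hom A X Y"
  using group.int_pow_closed[OF hom_group_group, of f X Y f n] by (simp add: scal_pow)

lemma scal_one: "f \<in> Hom A X Y \<Longrightarrow> scal A 1 f = f"
  using group.int_pow_1[OF hom_group_group, of f X Y f] by (simp add: scal_pow)

lemma scal_scal: "f \<in> Hom A X Y \<Longrightarrow> scal A m (scal A n f) = scal A (m * n) f"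
  using group.int_pow_pow[OF hom_group_group, of f X Y f n m] scal_pow[OF scal_hom, of f X Y m n]
  by (simp add: scal_pow mult.commute)

lemma scal_zer: "X \<in> Obj A \<Longrightarrow> Y \<in> Obj A \<Longrightarrow> scal A n (Zer A X Y) = Zer A X Y"
  using group.int_pow_one[OF hom_group_group[OF zer_hom], of X Y n] scal_pow[OF zer_hom, of X Y n]
  by simp

lemma scal_add: "f \<in> Hom A X Y \<Longrightarrow> g \<in> Hom A X Y \<Longrightarrow> scal A n (f \<boxplus> g) = scal A n f \<boxplus> scal A n g"
  using comm_group.int_pow_distrib[OF hom_comm_group, of X Y f g n] Hom_objD[of f X Y]
  by (simp add: scal_pow[OF add_hom] scal_pow)

lemma add_zer: "f \<in> Hom A X Y \<Longrightarrow> f \<boxplus> Zer A X Y = f" "f \<in> Hom A X Y \<Longrightarrow> Zer A X Y \<boxplus> f = f"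
  using group.is_monoid[OF hom_group_group, of f X Y]
    monoid.r_one[of "hom_group A X Y" f] monoid.l_one[of "hom_group A X Y" f] by simp_all

lemma add_commute: "f \<in> Hom A X Y \<Longrightarrow> g \<in> Hom A X Y \<Longrightarrow> f \<boxplus> g = g \<boxplus> f"
  using comm_monoid.m_comm[OF comm_group.axioms(1)[OF hom_comm_group], of X Y f g]
    Hom_objD[of f X Y] by simp

lemma homI_add:
  assumes "\<And>f. f \<in> Hom A X Y \<Longrightarrow> T f \<in> Hom A X' Y'"
    and "\<And>f g. f \<in> Hom A X Y \<Longrightarrow> g \<in> Hom A X Y \<Longrightarrow> T (f \<boxplus> g) = T f \<boxplus> T g"
  shows "T \<in> hom (hom_group A X Y) (hom_group A X' Y')"
  using assms by (intro homI) auto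

lemma comp_left_hom: "g \<in> Hom A Y Z \<Longrightarrow> (\<lambda>f. g \<cdot> f) \<in> hom (hom_group A X Y) (hom_group A X Z)"
  by (rule homI_add) (auto intro: comp_hom comp_add_right)

lemma comp_right_hom: "f \<in> Hom A X Y \<Longrightarrow> (\<lambda>g. g \<cdot> f) \<in> hom (hom_group A Y Z) (hom_group A X Z)"
  by (rule homI_add) (auto intro: comp_hom comp_add_left)

lemma hom_scal:
  assumes "T \<in> hom (hom_group A X Y) (hom_group A X' Y')" "f \<in> Hom A X Y"
  shows "T (scal A n f) = scal A n (T f)"
proof -
  have Tf: "T f \<in> Hom A X' Y'" using assms by (auto simp: hom_def)
  then show ?thesis
    using hom_int_pow[OF assms(1), of f n] hom_group_group[OF assms(2)] hom_group_group[OF Tf] assms(2)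
    by (simp add: scal_pow)
qed

lemma hom_zer:
  assumes "T \<in> hom (hom_group A X Y) (hom_group A X' Y')" "X \<in> Obj A" "Y \<in> Obj A"
  shows "T (Zer A X Y) = Zer A X' Y'"
proof -
  have "T (Zer A X Y) \<in> Hom A X' Y'" using assms zer_hom[of X Y] by (auto simp: hom_def)
  then show ?thesis
    using hom_one[OF assms(1)] hom_group_group[OF zer_hom[OF assms(2,3)]] hom_group_group by simp
qed

lemma comp_scal: "f \<in> Hom A X Y \<Longrightarrow> g \<in> Hom A Y Z \<Longrightarrow> g \<cdot> scal A n f = scal A n (g \<cdot> f)"
  by (rule hom_scal[OF comp_left_hom])

lemma scal_comp: "f \<in> Hom A X Y \<Longrightarrow> g \<in> Hom A Y Z \<Longrightarrow> scal A n g \<cdot> f = scal A n (g \<cdot> f)"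
  by (rule hom_scal[OF comp_right_hom])

lemma comp_zer: "g \<in> Hom A Y Z \<Longrightarrow> X \<in> Obj A \<Longrightarrow> g \<cdot> Zer A X Y = Zer A X Z"
  by (rule hom_zer[OF comp_left_hom]) (auto dest: Hom_objD)

lemma zer_comp: "f \<in> Hom A X Y \<Longrightarrow> Z \<in> Obj A \<Longrightarrow> Zer A Y Z \<cdot> f = Zer A X Z"
  by (rule hom_zer[OF comp_right_hom]) (auto dest: Hom_objD)

text \<open>The identities of the truncation in degrees above the bound hold for this reason.\<close>

lemma hom_to_zero_object:
  assumes "is_zero_object A Z" "f \<in> Hom A X Z" "g \<in> Hom A X Z"
  shows "f = g"
proof -
  have "h = Zer A X Z" if h: "h \<in> Hom A X Z" for h
    using id_left[OF h] zer_comp[OF h, of Z] assms(1) by (simp add: is_zero_object_def)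
  then show ?thesis using assms by metis
qed

end

context additive_tensor_category
begin

lemma arr_ten:
  assumes "f \<in> Arr A" "g \<in> Arr A"
  shows "f \<otimes>\<^sub>m g \<in> Arr A" "Src A (f \<otimes>\<^sub>m g) = Src A f \<odot> Src A g" "Tgt A (f \<otimes>\<^sub>m g) = Tgt A f \<odot> Tgt A g"
  using ten_hom[of f "Src A f" "Tgt A f" g "Src A g" "Tgt A g"] assms by (simp_all add: Hom_def)

lemma arr_ten_comp:
  assumes "f \<in> Arr A" "g \<in> Arr A" "f' \<in> Arr A" "g' \<in> Arr A" "Src A f' = Tgt A f" "Src A g' = Tgt A g"
  shows "(f' \<otimes>\<^sub>m g') \<cdot> (f \<otimes>\<^sub>m g) = (f' \<cdot> f) \<otimes>\<^sub>m (g' \<cdot> g)"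
  using ten_comp[of f "Src A f" "Tgt A f" f' "Tgt A f'" g "Src A g" "Tgt A g" g' "Tgt A g'"] assms
  by (simp add: Hom_def)

lemma arr_ten_comp':
  assumes "f \<in> Arr A" "g \<in> Arr A" "f' \<in> Arr A" "g' \<in> Arr A" "Src A f' = Tgt A f" "Src A g' = Tgt A g"
    and "h \<in> Arr A" "Tgt A h = Src A f \<odot> Src A g"
  shows "(f' \<otimes>\<^sub>m g') \<cdot> ((f \<otimes>\<^sub>m g) \<cdot> h) = ((f' \<cdot> f) \<otimes>\<^sub>m (g' \<cdot> g)) \<cdot> h"
  using arr_ten_comp[OF assms(1-6)] assms(7,8) arr_assoc[of h "f \<otimes>\<^sub>m g" "f' \<otimes>\<^sub>m g'"] assms(1-6)
  by (simp add: arr_ten)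

lemma ten_left_hom:
  "g \<in> Hom A Y Y' \<Longrightarrow> (\<lambda>f. f \<otimes>\<^sub>m g) \<in> hom (hom_group A X X') (hom_group A (X \<odot> Y) (X' \<odot> Y'))"
  by (rule homI_add) (auto intro: ten_hom ten_add_left)

lemma ten_right_hom:
  "f \<in> Hom A X X' \<Longrightarrow> (\<lambda>g. f \<otimes>\<^sub>m g) \<in> hom (hom_group A Y Y') (hom_group A (X \<odot> Y) (X' \<odot> Y'))"
  by (rule homI_add) (auto intro: ten_hom ten_add_right)

lemma zer_ten:
  "g \<in> Hom A Y Y' \<Longrightarrow> X \<in> Obj A \<Longrightarrow> X' \<in> Obj A \<Longrightarrow> Zer A X X' \<otimes>\<^sub>m g = Zer A (X \<odot> Y) (X' \<odot> Y')"
  by (rule hom_zer[OF ten_left_hom])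

lemma ten_zer:
  "f \<in> Hom A X X' \<Longrightarrow> Y \<in> Obj A \<Longrightarrow> Y' \<in> Obj A \<Longrightarrow> f \<otimes>\<^sub>m Zer A Y Y' = Zer A (X \<odot> Y) (X' \<odot> Y')"
  by (rule hom_zer[OF ten_right_hom])

lemma asso_hom:
  "X \<in> Obj A \<Longrightarrow> Y \<in> Obj A \<Longrightarrow> Z \<in> Obj A \<Longrightarrow> Asso A X Y Z \<in> Hom A ((X \<odot> Y) \<odot> Z) (X \<odot> (Y \<odot> Z))"
  using assoc_iso by (simp add: is_isomorphism_def)

end

section \<open>Splitting a standard finite set into two blocks\<close>

lemma inl_in_djunion [simp]: "inl x \<in> S \<amalg> T \<longleftrightarrow> x \<in> S"
  by (auto simp: djunion_def inl_def sum_encode_eq)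

lemma inr_in_djunion [simp]: "inr x \<in> S \<amalg> T \<longleftrightarrow> x \<in> T"
  by (auto simp: djunion_def inr_def sum_encode_eq)

lemma djunion_cases:
  assumes "z \<in> S \<amalg> T"
  obtains x where "z = inl x" "x \<in> S" | y where "z = inr y" "y \<in> T"
  using assms unfolding djunion_def inl_def inr_def by blast

lemma finite_djunion [simp]: "finite S \<Longrightarrow> finite T \<Longrightarrow> finite (S \<amalg> T)"
  by (simp add: djunion_def)

lemma copair_inl [simp]: "x \<in> S \<Longrightarrow> copair S T f g (inl x) = f x"
  unfolding copair_def using inl_in_djunion[of x S T] by (simp add: inl_def)

lemma copair_inr [simp]: "x \<in> T \<Longrightarrow> copair S T f g (inr x) = g x"
  unfolding copair_def using inr_in_djunion[of x S T] by (simp add: inr_def)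

lemma copair_PiE:
  assumes "\<And>x. x \<in> S \<Longrightarrow> f x \<in> U" "\<And>y. y \<in> T \<Longrightarrow> g y \<in> U"
  shows "copair S T f g \<in> S \<amalg> T \<rightarrow>\<^sub>E U"
proof
  fix z assume "z \<in> S \<amalg> T"
  then show "copair S T f g z \<in> U" by (cases z rule: djunion_cases) (use assms in auto)
next
  fix z assume "z \<notin> S \<amalg> T"
  then show "copair S T f g z = undefined" by (simp add: copair_def)
qed

lemma split_map_PiE: "split_map p q \<in> {1..p + q} \<rightarrow>\<^sub>E {1..p} \<amalg> {1..q}"
  by (auto simp: split_map_def)

lemma split_map_simps:
  "1 \<le> j \<Longrightarrow> j \<le> p \<Longrightarrow> split_map p q j = inl j"
  "1 \<le> i \<Longrightarrow> i \<le> q \<Longrightarrow> split_map p q (p + i) = inr i"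
  by (simp_all add: split_map_def)

lemma nat_interval_cases:
  fixes j :: nat
  assumes "j \<in> {1..p + q}"
  obtains "1 \<le> j" "j \<le> p" | i where "j = p + i" "1 \<le> i" "i \<le> q"
  using assms that(2)[of "j - p"] that(1) by fastforce

lemma djunion_map_PiE:
  "\<phi> \<in> S \<rightarrow>\<^sub>E S' \<Longrightarrow> \<psi> \<in> T \<rightarrow>\<^sub>E T' \<Longrightarrow> djunion_map S T \<phi> \<psi> \<in> S \<amalg> T \<rightarrow>\<^sub>E S' \<amalg> T'"
  unfolding djunion_map_def by (intro copair_PiE) auto

lemma switch_map_PiE: "switch_map T S \<in> T \<amalg> S \<rightarrow>\<^sub>E S \<amalg> T"
  unfolding switch_map_def by (intro copair_PiE) auto

lemma assoc_map_PiE: "assoc_map R S T \<in> (R \<amalg> S) \<amalg> T \<rightarrow>\<^sub>E R \<amalg> (S \<amalg> T)"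
proof -
  have "copair R S inl (inr \<circ> inl) \<in> R \<amalg> S \<rightarrow>\<^sub>E R \<amalg> (S \<amalg> T)"
    by (intro copair_PiE) auto
  then show ?thesis unfolding assoc_map_def by (intro copair_PiE) auto
qed

lemma compose_eqI:
  assumes "\<And>x. x \<in> X \<Longrightarrow> f (g x) = f' (g' x)"
  shows "compose X f g = compose X f' g'"
  using assms by (auto simp: compose_def fun_eq_iff restrict_def)

lemma funcset_compose_PiE:
  "g \<in> X \<rightarrow>\<^sub>E Y \<Longrightarrow> f \<in> Y \<rightarrow>\<^sub>E Z \<Longrightarrow> compose X f g \<in> X \<rightarrow>\<^sub>E Z"
  by (auto simp: compose_def PiE_iff)

lemma split_map_natural:
  assumes "u \<in> words {1..p} p'" "v \<in> words {1..q} q'"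
  shows "compose {1..p' + q'} (djunion_map {1..p'} {1..q'} (word_map u) (word_map v)) (split_map p' q')
    = compose {1..p' + q'} (split_map p q) (word_map (u @ map ((+) p) v))"
proof (rule compose_eqI)
  fix j assume "j \<in> {1..p' + q'}"
  then show "djunion_map {1..p'} {1..q'} (word_map u) (word_map v) (split_map p' q' j)
    = split_map p q (word_map (u @ map ((+) p) v) j)"
  proof (cases j rule: nat_interval_cases)
    case 1
    then have "u ! (j - 1) \<in> {1..p}" using words_nth[OF assms(1)] by simp
    moreover have "j - 1 < p'" using 1 by simp
    ultimately show ?thesis using 1 assms
      by (simp add: split_map_simps djunion_map_def word_map_def words_def nth_append)
  next
    case (2 i)
    then have "v ! (i - 1) \<in> {1..q}" using words_nth[OF assms(2)] by simp
    moreover have "\<not> p' + i - 1 < p'" "p' + i - 1 - p' = i - 1" using 2 by simp_all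
    ultimately show ?thesis using 2 assms
      by (simp add: split_map_simps djunion_map_def word_map_def words_def nth_append)
  qed
qed

lemma split_map_switch:
  "compose {1..q + p} (switch_map {1..q} {1..p}) (split_map q p) =
   compose {1..q + p} (split_map p q) (word_map (ival p q @ ival 0 p))"
proof (rule compose_eqI)
  fix j assume "j \<in> {1..q + p}"
  then show "switch_map {1..q} {1..p} (split_map q p j)
    = split_map p q (word_map (ival p q @ ival 0 p) j)"
    by (cases j rule: nat_interval_cases)
       (auto simp: split_map_simps switch_map_def word_map_def nth_append)
qed

text \<open>Both ways of splitting \<open>[p + q + r]\<close> into three blocks agree.\<close>

lemma split_map_assoc:
  "compose {1..p + q + r} (assoc_map {1..p} {1..q} {1..r})
     (compose {1..p + q + r} (djunion_map {1..p + q} {1..r} (split_map p q) (\<lambda>x \<in> {1..r}. x))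
       (split_map (p + q) r)) =
   compose {1..p + q + r} (djunion_map {1..p} {1..q + r} (\<lambda>x \<in> {1..p}. x) (split_map q r))
     (split_map p (q + r))"
proof (rule compose_eqI)
  fix j assume j: "j \<in> {1..p + q + r}"
  then show "assoc_map {1..p} {1..q} {1..r} (compose {1..p + q + r}
      (djunion_map {1..p + q} {1..r} (split_map p q) (\<lambda>x \<in> {1..r}. x)) (split_map (p + q) r) j) =
    djunion_map {1..p} {1..q + r} (\<lambda>x \<in> {1..p}. x) (split_map q r) (split_map p (q + r) j)"
  proof (cases j rule: nat_interval_cases)
    case 1
    then have "j \<in> {1..p + q}" by simp
    then show ?thesis
    proof (cases j rule: nat_interval_cases)
      case 1
      then show ?thesis using j
        by (simp add: split_map_simps compose_def djunion_map_def assoc_map_def)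
    next
      case (2 i)
      then show ?thesis using j split_map_simps(2)[of i "q + r" p]
        by (simp add: split_map_simps compose_def djunion_map_def assoc_map_def)
    qed
  next
    case (2 i)
    then show ?thesis using j split_map_simps(2)[of "q + i" "q + r" p] split_map_simps(2)[of i r "p + q"]
      by (simp add: split_map_simps compose_def djunion_map_def assoc_map_def add.assoc)
  qed
qed

section \<open>Tensors acting on the functor\<close>

context multiplicative_Fin_opp_functor
begin

abbreviation Fn :: "nat \<Rightarrow> 'o" where "Fn n \<equiv> Fo {1..n}"

text \<open>The action of a tensor, of degree \<open>m\<close> in the letters \<open>1, \<dots>, n\<close>, as a morphism \<open>F(n) \<rightarrow> F(m)\<close>.\<close>

definition FT :: "nat \<Rightarrow> nat \<Rightarrow> tensor \<Rightarrow> 'm" where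
  "FT n m u = F_ext A Fo Fm {1..m} {1..n} (map_tensor u)"

lemma Fn_obj: "Fn n \<in> Obj A"
  by (simp add: F_obj)

lemma F_ext_hom:
  assumes "finite X" "finite Y"
  shows "F_ext A Fo Fm X Y \<in> hom (free_Abelian_group (X \<rightarrow>\<^sub>E Y)) (hom_group A (Fo Y) (Fo X))"
proof -
  let ?G = "hom_group A (Fo Y) (Fo X)"
  interpret G: comm_group ?G
    by (rule hom_comm_group) (simp_all add: F_obj assms)
  have 1: "(\<lambda>u. finprod ?G (\<lambda>\<phi>. Fm X Y \<phi> [^]\<^bsub>?G\<^esub> (Poly_Mapping.lookup u \<phi>)) (Poly_Mapping.keys u))
      \<in> hom (free_Abelian_group (X \<rightarrow>\<^sub>E Y)) ?G"
    using F_hom[OF assms] by (intro G.lincomb_hom) auto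
  have 2: "F_ext A Fo Fm X Y u =
      finprod ?G (\<lambda>\<phi>. Fm X Y \<phi> [^]\<^bsub>?G\<^esub> (Poly_Mapping.lookup u \<phi>)) (Poly_Mapping.keys u)"
    if "u \<in> carrier (free_Abelian_group (X \<rightarrow>\<^sub>E Y))" for u
    unfolding F_ext_def using that F_hom[OF assms]
    by (intro G.finprod_cong') (auto simp: scal_pow intro!: G.int_pow_closed[simplified])
  show ?thesis
    by (rule group.hom_restrict[OF group_free_Abelian_group 1]) (rule 2[symmetric])
qed

lemma FT_hom_group:
  "FT n m \<in> hom (free_Abelian_group (words {1..n} m)) (hom_group A (Fn n) (Fn m))"
proof -
  have "map_tensor \<in> hom (free_Abelian_group (words {1..n} m)) (free_Abelian_group ({1..m} \<rightarrow>\<^sub>E {1..n}))"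
  proof (rule free_homI)
    fix x assume "x \<in> carrier (free_Abelian_group (words {1..n} m))"
    then show "map_tensor x \<in> carrier (free_Abelian_group ({1..m} \<rightarrow>\<^sub>E {1..n}))"
      using keys_frag_extend[of "\<lambda>w. frag_of (word_map w)" x] word_map_PiE by fastforce
  qed (simp add: frag_extend_add)
  from hom_compose'[OF this F_ext_hom] show ?thesis
    by (simp add: FT_def[abs_def])
qed

lemma FT_hom: "u \<in> tensors {1..n} m \<Longrightarrow> FT n m u \<in> Hom A (Fn n) (Fn m)"
  using hom_in_carrier[OF FT_hom_group, of u n m] by simp

lemma FT_group: "group (hom_group A (Fn n) (Fn m))"
  by (rule comm_group.axioms(2)[OF hom_comm_group]) (rule Fn_obj)+

lemma FT_word:
  assumes "w \<in> words {1..n} m"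
  shows "FT n m (frag_of w) = Fm {1..m} {1..n} (word_map w)"
proof -
  interpret G: comm_group "hom_group A (Fn n) (Fn m)"
    by (rule hom_comm_group) (rule Fn_obj)+
  have "Fm {1..m} {1..n} (word_map w) \<in> Hom A (Fn n) (Fn m)"
    using word_map_PiE[OF assms] by (intro F_hom) auto
  then show ?thesis
    using G.finprod_insert[of "{}" "word_map w" "\<lambda>\<phi>. scal A (if \<phi> = word_map w then 1 else 0) (Fm {1..m} {1..n} \<phi>)"]
    by (simp add: FT_def F_ext_def scal_one add_zer)
qed

lemma FT_add:
  "u \<in> tensors {1..n} m \<Longrightarrow> v \<in> tensors {1..n} m \<Longrightarrow> FT n m (u + v) = FT n m u \<boxplus> FT n m v"
  using hom_mult[OF FT_hom_group, of u n m v] by simp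

lemma FT_zero: "FT n m 0 = Zer A (Fn n) (Fn m)"
  using hom_one[OF FT_hom_group group_free_Abelian_group FT_group, of n m] by simp

lemma FT_cmul: "u \<in> tensors {1..n} m \<Longrightarrow> FT n m (frag_cmul c u) = scal A c (FT n m u)"
  using hom_int_pow[OF FT_hom_group _ group_free_Abelian_group FT_group, of u n m c]
  by (simp add: scal_pow[OF FT_hom])

lemma FT_sign:
  assumes "u \<in> tensors {1..n} m"
  shows "FT n m ((- 1) ^ k * u) = scal A ((- 1) ^ k) (FT n m u)"
  using FT_cmul[OF assms, of "(- 1) ^ k"] by (cases "even k") simp_all

lemma FT_of_nat:
  assumes "u \<in> tensors {1..n} m"
  shows "FT n m (of_nat k * u) = scal A (int k) (FT n m u)"
proof -
  have "of_nat k * u = frag_cmul (int k) u"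
    by (induction k) (simp_all add: algebra_simps frag_cmul_distrib)
  then show ?thesis using FT_cmul[OF assms] by simp
qed

lemma FT_id: "FT n n (frag_of (ival 0 n)) = Idt A (Fn n)"
  using F_id[of "{1..n}"] FT_word[OF ival_words[of 0 n n]] by (simp add: word_map_ival)

lemma FT_comp:
  assumes "u \<in> tensors {1..n} m" "v \<in> tensors {1..m} k"
  shows "FT m k v \<cdot> FT n m u = FT n k (tcomp u v)"
proof (rule free_hom_eqI[OF FT_group, where L = "\<lambda>v. FT m k v \<cdot> FT n m u"])
  show "(\<lambda>v. FT m k v \<cdot> FT n m u) \<in> hom (free_Abelian_group (words {1..m} k)) (hom_group A (Fn n) (Fn k))"
    by (rule hom_compose'[OF FT_hom_group comp_right_hom]) (rule FT_hom[OF assms(1)])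
  show "(\<lambda>v. FT n k (tcomp u v)) \<in> hom (free_Abelian_group (words {1..m} k)) (hom_group A (Fn n) (Fn k))"
    by (rule hom_compose'[OF free_homI FT_hom_group])
       (use tcomp_tensors[OF assms(1)] in \<open>simp_all add: tcomp_def frag_extend_add\<close>)
  fix v assume v: "v \<in> words {1..m} k"
  then have v': "frag_of v \<in> tensors {1..m} k" by simp
  show "FT m k (frag_of v) \<cdot> FT n m u = FT n k (tcomp u (frag_of v))"
  proof (rule free_hom_eqI[OF FT_group, where L = "\<lambda>u. FT m k (frag_of v) \<cdot> FT n m u"])
    show "(\<lambda>u. FT m k (frag_of v) \<cdot> FT n m u)
        \<in> hom (free_Abelian_group (words {1..n} m)) (hom_group A (Fn n) (Fn k))"
      by (rule hom_compose'[OF FT_hom_group comp_left_hom]) (rule FT_hom[OF v'])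
    show "(\<lambda>u. FT n k (tcomp u (frag_of v)))
        \<in> hom (free_Abelian_group (words {1..n} m)) (hom_group A (Fn n) (Fn k))"
      by (rule hom_compose'[OF free_homI FT_hom_group])
         (use tcomp_tensors[OF _ v'] in \<open>simp_all add: tcomp_def frag_extend_add\<close>)
    fix u assume u: "u \<in> words {1..n} m"
    have "Fm {1..k} {1..m} (word_map v) \<cdot> Fm {1..m} {1..n} (word_map u)
        = Fm {1..k} {1..n} (compose {1..k} (word_map u) (word_map v))"
      using word_map_PiE[OF u] word_map_PiE[OF v] by (intro F_comp[symmetric]) auto
    then show "FT m k (frag_of v) \<cdot> FT n m (frag_of u) = FT n k (tcomp (frag_of u) (frag_of v))"
      using u v by (simp add: FT_word tcomp_def plug_words word_map_plug)
  qed (use assms in simp_all)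
qed (use assms in simp_all)

abbreviation NN :: "nat \<Rightarrow> nat \<Rightarrow> 'm" where "NN p q \<equiv> N_ord A Fm N p q"

lemma Fm_split_hom: "Fm {1..p + q} ({1..p} \<amalg> {1..q}) (split_map p q) \<in> Hom A (Fo ({1..p} \<amalg> {1..q})) (Fn (p + q))"
  by (intro F_hom split_map_PiE) simp_all

lemma NN_hom: "NN p q \<in> Hom A (Fn p \<odot> Fn q) (Fn (p + q))"
  unfolding N_ord_def by (rule comp_hom[OF N_hom Fm_split_hom]) simp_all

lemma NN_natural_word:
  assumes u: "u \<in> words {1..p} p'" and v: "v \<in> words {1..q} q'"
  shows "NN p' q' \<cdot> (FT p p' (frag_of u) \<otimes>\<^sub>m FT q q' (frag_of v)) =
    FT (p + q) (p' + q') (frag_of (u @ map ((+) p) v)) \<cdot> NN p q"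
proof -
  let ?S = "{1..p}" and ?S' = "{1..p'}" and ?T = "{1..q}" and ?T' = "{1..q'}"
  let ?D = "djunion_map ?S' ?T' (word_map u) (word_map v)"
  have w: "u @ map ((+) p) v \<in> words {1..p + q} (p' + q')"
    using u v by (fastforce simp: words_def)
  note uv = word_map_PiE[OF u] word_map_PiE[OF v]
  have h: "N ?S' ?T' \<in> Hom A (Fo ?S' \<odot> Fo ?T') (Fo (?S' \<amalg> ?T'))" "N ?S ?T \<in> Hom A (Fo ?S \<odot> Fo ?T) (Fo (?S \<amalg> ?T))"
    "Fm ?S' ?S (word_map u) \<otimes>\<^sub>m Fm ?T' ?T (word_map v) \<in> Hom A (Fo ?S \<odot> Fo ?T) (Fo ?S' \<odot> Fo ?T')"
    "Fm (?S' \<amalg> ?T') (?S \<amalg> ?T) ?D \<in> Hom A (Fo (?S \<amalg> ?T)) (Fo (?S' \<amalg> ?T'))"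
    using uv by (auto intro!: N_hom ten_hom F_hom djunion_map_PiE)
  have hw: "Fm {1..p' + q'} {1..p + q} (word_map (u @ map ((+) p) v)) \<in> Hom A (Fn (p + q)) (Fn (p' + q'))"
    using word_map_PiE[OF w] by (intro F_hom) auto
  have "NN p' q' \<cdot> (FT p p' (frag_of u) \<otimes>\<^sub>m FT q q' (frag_of v))
      = Fm {1..p' + q'} (?S' \<amalg> ?T') (split_map p' q') \<cdot>
        (N ?S' ?T' \<cdot> (Fm ?S' ?S (word_map u) \<otimes>\<^sub>m Fm ?T' ?T (word_map v)))"
    unfolding N_ord_def FT_word[OF u] FT_word[OF v]
    by (rule comp_assoc[symmetric, OF h(3,1) Fm_split_hom])
  also have "\<dots> = Fm {1..p' + q'} (?S' \<amalg> ?T') (split_map p' q') \<cdot>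
      (Fm (?S' \<amalg> ?T') (?S \<amalg> ?T) ?D \<cdot> N ?S ?T)"
    using N_nat[of ?S' ?S ?T' ?T "word_map u" "word_map v"] uv by simp
  also have "\<dots> = (Fm {1..p' + q'} (?S' \<amalg> ?T') (split_map p' q') \<cdot> Fm (?S' \<amalg> ?T') (?S \<amalg> ?T) ?D) \<cdot> N ?S ?T"
    by (rule comp_assoc[OF h(2,4) Fm_split_hom])
  also have "Fm {1..p' + q'} (?S' \<amalg> ?T') (split_map p' q') \<cdot> Fm (?S' \<amalg> ?T') (?S \<amalg> ?T) ?D
      = Fm {1..p' + q'} (?S \<amalg> ?T) (compose {1..p' + q'} ?D (split_map p' q'))"
    using uv by (intro F_comp[symmetric] split_map_PiE djunion_map_PiE) auto
  also have "\<dots> = Fm {1..p' + q'} {1..p + q} (word_map (u @ map ((+) p) v)) \<cdot>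
      Fm {1..p + q} (?S \<amalg> ?T) (split_map p q)"
    unfolding split_map_natural[OF u v] by (intro F_comp split_map_PiE word_map_PiE[OF w]) auto
  also have "\<dots> \<cdot> N ?S ?T = FT (p + q) (p' + q') (frag_of (u @ map ((+) p) v)) \<cdot> NN p q"
    unfolding FT_word[OF w] N_ord_def by (rule comp_assoc[symmetric, OF h(2) Fm_split_hom hw])
  finally show ?thesis .
qed

text \<open>Under \<open>N\<close>, the tensor product of two actions is the action of the product in the tensor ring,
  once the letters of the second factor are shifted past those of the first.\<close>

lemma NN_natural:
  assumes u: "u \<in> tensors {1..p} p'" and v: "v \<in> tensors {1..q} q'"
  shows "NN p' q' \<cdot> (FT p p' u \<otimes>\<^sub>m FT q q' v) =
    FT (p + q) (p' + q') (u * relabel ((+) p) v) \<cdot> NN p q"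
proof -
  let ?G = "hom_group A (Fn p \<odot> Fn q) (Fn (p' + q'))"
  have G: "group ?G"
    by (rule comm_group.axioms(2)[OF hom_comm_group]) (simp_all add: Fn_obj ten_obj)
  have shift: "relabel ((+) p) v \<in> tensors {1..p + q} q'" if "v \<in> tensors {1..q} q'" for v
    using that by (rule relabel_tensors) auto
  have incl: "u \<in> tensors {1..p + q} p'" if "u \<in> tensors {1..p} p'" for u
    using that by (fastforce simp: words_def)
  note R = comp_right_hom[OF NN_hom]
  have L1: "(\<lambda>v. NN p' q' \<cdot> (FT p p' u \<otimes>\<^sub>m FT q q' v)) \<in> hom (free_Abelian_group (words {1..q} q')) ?G"
    if "u \<in> tensors {1..p} p'" for u
    by (rule hom_compose'[OF hom_compose'[OF FT_hom_group ten_right_hom[OF FT_hom[OF that]]]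
          comp_left_hom[OF NN_hom]])
  have L2: "(\<lambda>u. NN p' q' \<cdot> (FT p p' u \<otimes>\<^sub>m FT q q' v)) \<in> hom (free_Abelian_group (words {1..p} p')) ?G"
    if "v \<in> tensors {1..q} q'" for v
    by (rule hom_compose'[OF hom_compose'[OF FT_hom_group ten_left_hom[OF FT_hom[OF that]]]
          comp_left_hom[OF NN_hom]])
  have R1: "(\<lambda>v. FT (p + q) (p' + q') (u * relabel ((+) p) v) \<cdot> NN p q)
      \<in> hom (free_Abelian_group (words {1..q} q')) ?G" if "u \<in> tensors {1..p} p'" for u
    by (rule hom_compose'[OF hom_compose'[OF free_homI FT_hom_group] R])
       (use tensors_mult[OF incl[OF that] shift] in \<open>simp_all add: relabel_add distrib_left\<close>)
  have R2: "(\<lambda>u. FT (p + q) (p' + q') (u * relabel ((+) p) v) \<cdot> NN p q)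
      \<in> hom (free_Abelian_group (words {1..p} p')) ?G" if "v \<in> tensors {1..q} q'" for v
    by (rule hom_compose'[OF hom_compose'[OF free_homI FT_hom_group] R])
       (use tensors_mult[OF incl shift[OF that]] in \<open>simp_all add: distrib_right\<close>)
  have "NN p' q' \<cdot> (FT p p' (frag_of u) \<otimes>\<^sub>m FT q q' v) =
    FT (p + q) (p' + q') (frag_of u * relabel ((+) p) v) \<cdot> NN p q" if u: "u \<in> words {1..p} p'" for u
  proof (rule free_hom_eqI[OF G L1 R1 _ v])
    show "NN p' q' \<cdot> (FT p p' (frag_of u) \<otimes>\<^sub>m FT q q' (frag_of v)) =
      FT (p + q) (p' + q') (frag_of u * relabel ((+) p) (frag_of v)) \<cdot> NN p q" if "v \<in> words {1..q} q'" for v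
      using NN_natural_word[OF u that] by (simp flip: frag_of_append)
  qed (use u in simp_all)
  then show ?thesis
    by (rule free_hom_eqI[OF G L2[OF v] R2[OF v] _ u])
qed


text \<open>The commutativity constraint becomes the word that exchanges two blocks.\<close>

lemma NN_Comm:
  "NN q p \<cdot> Comm A (Fn p) (Fn q) = FT (p + q) (q + p) (frag_of (ival p q @ ival 0 p)) \<cdot> NN p q"
proof -
  let ?S = "{1..p}" and ?T = "{1..q}"
  have w: "ival p q @ ival 0 p \<in> words {1..p + q} (q + p)"
    by (auto simp: words_def)
  have h: "N ?S ?T \<in> Hom A (Fo ?S \<odot> Fo ?T) (Fo (?S \<amalg> ?T))" "N ?T ?S \<in> Hom A (Fo ?T \<odot> Fo ?S) (Fo (?T \<amalg> ?S))"
    "Comm A (Fn p) (Fn q) \<in> Hom A (Fn p \<odot> Fn q) (Fn q \<odot> Fn p)"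
    "Fm (?T \<amalg> ?S) (?S \<amalg> ?T) (switch_map ?T ?S) \<in> Hom A (Fo (?S \<amalg> ?T)) (Fo (?T \<amalg> ?S))"
    by (simp_all add: N_hom comm_hom Fn_obj F_hom switch_map_PiE)
  have hw: "Fm {1..q + p} {1..p + q} (word_map (ival p q @ ival 0 p)) \<in> Hom A (Fn (p + q)) (Fn (q + p))"
    using word_map_PiE[OF w] by (intro F_hom) auto
  have "NN q p \<cdot> Comm A (Fn p) (Fn q)
      = Fm {1..q + p} (?T \<amalg> ?S) (split_map q p) \<cdot> (N ?T ?S \<cdot> Comm A (Fn p) (Fn q))"
    unfolding N_ord_def by (rule comp_assoc[symmetric, OF h(3,2) Fm_split_hom])
  also have "\<dots> = Fm {1..q + p} (?T \<amalg> ?S) (split_map q p) \<cdot>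
      (Fm (?T \<amalg> ?S) (?S \<amalg> ?T) (switch_map ?T ?S) \<cdot> N ?S ?T)"
    using N_commutative[of ?S ?T] by simp
  also have "\<dots> = (Fm {1..q + p} (?T \<amalg> ?S) (split_map q p) \<cdot>
      Fm (?T \<amalg> ?S) (?S \<amalg> ?T) (switch_map ?T ?S)) \<cdot> N ?S ?T"
    by (rule comp_assoc[OF h(1,4) Fm_split_hom])
  also have "Fm {1..q + p} (?T \<amalg> ?S) (split_map q p) \<cdot> Fm (?T \<amalg> ?S) (?S \<amalg> ?T) (switch_map ?T ?S)
      = Fm {1..q + p} (?S \<amalg> ?T) (compose {1..q + p} (switch_map ?T ?S) (split_map q p))"
    by (intro F_comp[symmetric] split_map_PiE switch_map_PiE) auto
  also have "\<dots> = Fm {1..q + p} {1..p + q} (word_map (ival p q @ ival 0 p)) \<cdot>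
      Fm {1..p + q} (?S \<amalg> ?T) (split_map p q)"
    unfolding split_map_switch by (intro F_comp split_map_PiE word_map_PiE[OF w]) auto
  also have "\<dots> \<cdot> N ?S ?T = FT (p + q) (q + p) (frag_of (ival p q @ ival 0 p)) \<cdot> NN p q"
    unfolding FT_word[OF w] N_ord_def by (rule comp_assoc[symmetric, OF h(1) Fm_split_hom hw])
  finally show ?thesis .
qed

lemma NN_assoc:
  "NN (p + q) r \<cdot> (NN p q \<otimes>\<^sub>m Idt A (Fn r)) =
   NN p (q + r) \<cdot> (Idt A (Fn p) \<otimes>\<^sub>m NN q r) \<cdot> Asso A (Fn p) (Fn q) (Fn r)"
proof -
  let ?P = "{1..p}" and ?Q = "{1..q}" and ?R = "{1..r}" and ?I = "{1..p + q + r}"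
  let ?idP = "\<lambda>x \<in> ?P. x" and ?idR = "\<lambda>x \<in> ?R. x"
  define s t where "s = split_map p q" and "t = split_map q r"
  have st: "s \<in> {1..p + q} \<rightarrow>\<^sub>E ?P \<amalg> ?Q" "t \<in> {1..q + r} \<rightarrow>\<^sub>E ?Q \<amalg> ?R"
    by (simp_all add: s_def t_def split_map_PiE)
  have ids: "?idP \<in> ?P \<rightarrow>\<^sub>E ?P" "?idR \<in> ?R \<rightarrow>\<^sub>E ?R" by auto
  have fF: "Fm ?P ?P ?idP = Idt A (Fn p)" "Fm ?R ?R ?idR = Idt A (Fn r)" by (simp_all add: F_id)
  have split_hom: "Fm ?I ({1..p + q} \<amalg> ?R) (split_map (p + q) r) \<in> Hom A (Fo ({1..p + q} \<amalg> ?R)) (Fn (p + q + r))"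
    "Fm ?I (?P \<amalg> {1..q + r}) (split_map p (q + r)) \<in> Hom A (Fo (?P \<amalg> {1..q + r})) (Fn (p + q + r))"
    "Fm {1..p + q} (?P \<amalg> ?Q) s \<in> Hom A (Fo (?P \<amalg> ?Q)) (Fn (p + q))"
    "Fm {1..q + r} (?Q \<amalg> ?R) t \<in> Hom A (Fo (?Q \<amalg> ?R)) (Fn (q + r))"
    using Fm_split_hom[of p q] Fm_split_hom[of q r] Fm_split_hom[of "p + q" r] Fm_split_hom[of p "q + r"]
    by (simp_all add: s_def t_def add.assoc)
  have dj: "Fm ({1..p + q} \<amalg> ?R) ((?P \<amalg> ?Q) \<amalg> ?R) (djunion_map {1..p + q} ?R s ?idR)
      \<in> Hom A (Fo ((?P \<amalg> ?Q) \<amalg> ?R)) (Fo ({1..p + q} \<amalg> ?R))"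
    "Fm (?P \<amalg> {1..q + r}) (?P \<amalg> (?Q \<amalg> ?R)) (djunion_map ?P {1..q + r} ?idP t)
      \<in> Hom A (Fo (?P \<amalg> (?Q \<amalg> ?R))) (Fo (?P \<amalg> {1..q + r}))"
    "Fm ((?P \<amalg> ?Q) \<amalg> ?R) (?P \<amalg> (?Q \<amalg> ?R)) (assoc_map ?P ?Q ?R)
      \<in> Hom A (Fo (?P \<amalg> (?Q \<amalg> ?R))) (Fo ((?P \<amalg> ?Q) \<amalg> ?R))"
    by (intro F_hom djunion_map_PiE st ids assoc_map_PiE finite_djunion; simp)+
  note Nh = N_hom[of ?P ?Q, simplified] N_hom[of ?Q ?R, simplified]
    N_hom[of "{1..p + q}" ?R, simplified] N_hom[of ?P "{1..q + r}", simplified]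
    N_hom[of "?P \<amalg> ?Q" ?R, simplified] N_hom[of ?P "?Q \<amalg> ?R", simplified]
  note ah = asso_hom[OF Fn_obj Fn_obj Fn_obj, of p q r]
  note arrs = HomD[OF Nh(1)] HomD[OF Nh(2)] HomD[OF Nh(3)] HomD[OF Nh(4)] HomD[OF Nh(5)] HomD[OF Nh(6)]
    HomD[OF split_hom(1)] HomD[OF split_hom(2)] HomD[OF split_hom(3)] HomD[OF split_hom(4)]
    HomD[OF dj(1)] HomD[OF dj(2)] HomD[OF dj(3)] HomD[OF ah]
  note simps = arrs arr_simps arr_ten arr_ten_comp arr_ten_comp' Fn_obj
  have nat1: "N {1..p + q} ?R \<cdot> (Fm {1..p + q} (?P \<amalg> ?Q) s \<otimes>\<^sub>m Idt A (Fn r)) =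
      Fm ({1..p + q} \<amalg> ?R) ((?P \<amalg> ?Q) \<amalg> ?R) (djunion_map {1..p + q} ?R s ?idR) \<cdot> N (?P \<amalg> ?Q) ?R"
    using N_nat[OF _ _ _ _ st(1) ids(2)] fF by simp
  have nat2: "N ?P {1..q + r} \<cdot> (Idt A (Fn p) \<otimes>\<^sub>m Fm {1..q + r} (?Q \<amalg> ?R) t) =
      Fm (?P \<amalg> {1..q + r}) (?P \<amalg> (?Q \<amalg> ?R)) (djunion_map ?P {1..q + r} ?idP t) \<cdot> N ?P (?Q \<amalg> ?R)"
    using N_nat[OF _ _ _ _ ids(1) st(2)] fF by simp
  let ?tail = "N ?P (?Q \<amalg> ?R) \<cdot> (Idt A (Fn p) \<otimes>\<^sub>m N ?Q ?R) \<cdot> Asso A (Fn p) (Fn q) (Fn r)"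
  have tail: "?tail \<in> Hom A ((Fn p \<odot> Fn q) \<odot> Fn r) (Fo (?P \<amalg> (?Q \<amalg> ?R)))"
    by (rule HomI) (simp_all add: simps)
  have "NN (p + q) r \<cdot> (NN p q \<otimes>\<^sub>m Idt A (Fn r))
      = Fm ?I ({1..p + q} \<amalg> ?R) (split_map (p + q) r) \<cdot>
        (N {1..p + q} ?R \<cdot> (Fm {1..p + q} (?P \<amalg> ?Q) s \<otimes>\<^sub>m Idt A (Fn r))) \<cdot> (N ?P ?Q \<otimes>\<^sub>m Idt A (Fn r))"
    by (simp add: N_ord_def simps flip: s_def)
  also have "\<dots> = Fm ?I ({1..p + q} \<amalg> ?R) (split_map (p + q) r) \<cdot>
      Fm ({1..p + q} \<amalg> ?R) ((?P \<amalg> ?Q) \<amalg> ?R) (djunion_map {1..p + q} ?R s ?idR) \<cdot>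
      (N (?P \<amalg> ?Q) ?R \<cdot> (N ?P ?Q \<otimes>\<^sub>m Idt A (Fn r)))"
    unfolding nat1 by (simp add: simps)
  also have "\<dots> = Fm ?I ({1..p + q} \<amalg> ?R) (split_map (p + q) r) \<cdot>
      Fm ({1..p + q} \<amalg> ?R) ((?P \<amalg> ?Q) \<amalg> ?R) (djunion_map {1..p + q} ?R s ?idR) \<cdot>
      Fm ((?P \<amalg> ?Q) \<amalg> ?R) (?P \<amalg> (?Q \<amalg> ?R)) (assoc_map ?P ?Q ?R) \<cdot> ?tail"
    using N_associative[of ?P ?Q ?R] by (simp add: simps)
  also have "Fm ?I ({1..p + q} \<amalg> ?R) (split_map (p + q) r) \<cdot>
      Fm ({1..p + q} \<amalg> ?R) ((?P \<amalg> ?Q) \<amalg> ?R) (djunion_map {1..p + q} ?R s ?idR) =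
      Fm ?I ((?P \<amalg> ?Q) \<amalg> ?R) (compose ?I (djunion_map {1..p + q} ?R s ?idR) (split_map (p + q) r))"
    by (intro F_comp[symmetric] split_map_PiE djunion_map_PiE st ids finite_djunion) simp_all
  also have "\<dots> \<cdot> Fm ((?P \<amalg> ?Q) \<amalg> ?R) (?P \<amalg> (?Q \<amalg> ?R)) (assoc_map ?P ?Q ?R) =
      Fm ?I (?P \<amalg> (?Q \<amalg> ?R)) (compose ?I (assoc_map ?P ?Q ?R)
        (compose ?I (djunion_map {1..p + q} ?R s ?idR) (split_map (p + q) r)))"
    by (intro F_comp[symmetric] assoc_map_PiE finite_djunion
        funcset_compose_PiE[OF split_map_PiE djunion_map_PiE[OF st(1) ids(2)]]) simp_all
  also have "\<dots> = Fm ?I (?P \<amalg> (?Q \<amalg> ?R)) (compose ?I (djunion_map ?P {1..q + r} ?idP t) (split_map p (q + r)))"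
    unfolding s_def t_def split_map_assoc ..
  also have "\<dots> = Fm ?I (?P \<amalg> {1..q + r}) (split_map p (q + r)) \<cdot>
      Fm (?P \<amalg> {1..q + r}) (?P \<amalg> (?Q \<amalg> ?R)) (djunion_map ?P {1..q + r} ?idP t)"
    using split_map_PiE[of p "q + r"]
    by (intro F_comp djunion_map_PiE st ids finite_djunion) (simp_all add: add.assoc)
  also have "\<dots> \<cdot> ?tail = Fm ?I (?P \<amalg> {1..q + r}) (split_map p (q + r)) \<cdot>
      (N ?P {1..q + r} \<cdot> (Idt A (Fn p) \<otimes>\<^sub>m Fm {1..q + r} (?Q \<amalg> ?R) t)) \<cdot>
      (Idt A (Fn p) \<otimes>\<^sub>m N ?Q ?R) \<cdot> Asso A (Fn p) (Fn q) (Fn r)"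
    unfolding nat2 by (simp add: simps)
  also have "\<dots> = NN p (q + r) \<cdot> (Idt A (Fn p) \<otimes>\<^sub>m NN q r) \<cdot> Asso A (Fn p) (Fn q) (Fn r)"
    by (simp add: N_ord_def simps flip: t_def add.assoc)
  finally show ?thesis .
qed

end

section \<open>The bracket and the differential on the functor\<close>

text \<open>The bracket on \<open>F(p) \<otimes> F(q)\<close> as a tensor: the superbracket of the words of the two blocks.\<close>

definition bracket_tensor :: "nat \<Rightarrow> nat \<Rightarrow> tensor" where
  "bracket_tensor p q = sbr p q (frag_of (ival 0 p)) (frag_of (ival p q))"

lemma bracket_tensor_tensors: "bracket_tensor p q \<in> tensors {1..p + q} (p + q)"
  unfolding bracket_tensor_def by (intro tensors_sbr tensors_frag_of ival_words) simp_all

lemma tcomp_frag_of_bracket: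
  assumes "length u = p" "length v = q"
  shows "tcomp (frag_of (u @ v)) (bracket_tensor p q) = sbr p q (frag_of u) (frag_of v)"
proof -
  have "map (\<lambda>j. (u @ v) ! (j - 1)) (ival 0 p) = u" "map (\<lambda>j. (u @ v) ! (j - 1)) (ival p q) = v"
    using assms by (auto intro!: nth_equalityI simp: nth_append)
  then show ?thesis
    by (simp add: tcomp_conv_relabel bracket_tensor_def relabel_sbr)
qed

lemma tcomp_bracket_tensor:
  assumes "u \<in> tensors S p" "v \<in> tensors S' q"
  shows "tcomp (u * v) (bracket_tensor p q) = sbr p q u v"
proof -
  have *: "tcomp (frag_of u * v) (bracket_tensor p q) = sbr p q (frag_of u) v" if "length u = p" for u
    using assms(2)
  proof (induction v rule: frag_induct)
    case (of v)
    then show ?case using that tcomp_frag_of_bracket[of u p v q] by (simp add: words_def frag_of_append)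
  qed (simp_all add: right_diff_distrib tcomp_diff_left sbr_diff_right tcomp_zero_left,
       simp add: sbr_def)
  show ?thesis
    using assms(1)
    by (induction u rule: frag_induct)
       (simp_all add: left_diff_distrib tcomp_diff_left sbr_diff_left tcomp_zero_left sbr_zero *
         words_def del: mult_single)
qed

context multiplicative_Fin_opp_functor
begin

abbreviation FB :: "nat \<Rightarrow> nat \<Rightarrow> 'm" where "FB p q \<equiv> F_bracket A Fo Fm N p q"

lemma FB_eq: "FB p q = FT (p + q) (p + q) (bracket_tensor p q) \<cdot> NN p q"
proof -
  let ?c = "- ((- 1) ^ (p * q)) :: int"
  let ?x = "frag_of (ival 0 (p + q))" and ?y = "frag_of (ival p q @ ival 0 p) :: tensor"
  have xy: "?x \<in> tensors {1..p + q} (p + q)" "?y \<in> tensors {1..p + q} (p + q)"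
    by (auto simp: words_def)
  have "bracket_tensor p q = ?x + frag_cmul ?c ?y"
    using ival_append[of 0 p q]
    by (cases "even (p * q)") (simp_all add: bracket_tensor_def sbr_def flip: frag_of_append)
  then have "FT (p + q) (p + q) (bracket_tensor p q)
      = Idt A (Fn (p + q)) \<boxplus> scal A ?c (FT (p + q) (p + q) ?y)"
    using FT_add[OF xy(1) tensors_cmul[OF xy(2)]] FT_cmul[OF xy(2)] FT_id by simp
  then have "FT (p + q) (p + q) (bracket_tensor p q) \<cdot> NN p q
      = Idt A (Fn (p + q)) \<cdot> NN p q \<boxplus> scal A ?c (FT (p + q) (p + q) ?y) \<cdot> NN p q"
    using comp_add_left[OF NN_hom id_hom[OF Fn_obj] scal_hom[OF FT_hom[OF xy(2)]]] by simp
  also have "\<dots> = NN p q \<boxplus> scal A ?c (FT (p + q) (p + q) ?y \<cdot> NN p q)"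
    using id_left[OF NN_hom] scal_comp[OF NN_hom FT_hom[OF xy(2)]] by simp
  also have "FT (p + q) (p + q) ?y \<cdot> NN p q = NN q p \<cdot> Comm A (Fn p) (Fn q)"
    using NN_Comm[of q p] by (simp add: add.commute)
  finally show ?thesis by (simp add: F_bracket_def)
qed

lemma FB_hom: "FB p q \<in> Hom A (Fn p \<odot> Fn q) (Fn (p + q))"
  unfolding FB_eq by (rule comp_hom[OF NN_hom FT_hom[OF bracket_tensor_tensors]])

lemma FB_natural:
  assumes u: "u \<in> tensors {1..p} p'" and v: "v \<in> tensors {1..q} q'"
  shows "FB p' q' \<cdot> (FT p p' u \<otimes>\<^sub>m FT q q' v) =
    FT (p + q) (p' + q') (sbr p' q' u (relabel ((+) p) v)) \<cdot> NN p q"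
proof -
  have uv: "u \<in> tensors {1..p + q} p'" "relabel ((+) p) v \<in> tensors {1..p + q} q'"
    using tensors_mono[OF u] shift_tensors[OF v] by auto
  note h = HomD[OF NN_hom] HomD[OF FT_hom[OF bracket_tensor_tensors]] HomD[OF FT_hom[OF u]] HomD[OF FT_hom[OF v]]
    HomD[OF FT_hom[OF tensors_mult[OF uv]]]
  have "FB p' q' \<cdot> (FT p p' u \<otimes>\<^sub>m FT q q' v)
      = FT (p' + q') (p' + q') (bracket_tensor p' q') \<cdot> (NN p' q' \<cdot> (FT p p' u \<otimes>\<^sub>m FT q q' v))"
    by (simp add: FB_eq h arr_simps arr_ten)
  also have "\<dots> = FT (p' + q') (p' + q') (bracket_tensor p' q') \<cdot>
      FT (p + q) (p' + q') (u * relabel ((+) p) v) \<cdot> NN p q"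
    unfolding NN_natural[OF u v] by (simp add: h arr_simps)
  also have "FT (p' + q') (p' + q') (bracket_tensor p' q') \<cdot> FT (p + q) (p' + q') (u * relabel ((+) p) v)
      = FT (p + q) (p' + q') (sbr p' q' u (relabel ((+) p) v))"
    unfolding FT_comp[OF tensors_mult[OF uv] bracket_tensor_tensors] tcomp_bracket_tensor[OF uv] ..
  finally show ?thesis .
qed

text \<open>The threefold \<open>N\<close>, through which all terms of the Jacobi identity factor.\<close>

definition N3 :: "nat \<Rightarrow> nat \<Rightarrow> nat \<Rightarrow> 'm" where
  "N3 p q r = NN (p + q) r \<cdot> (NN p q \<otimes>\<^sub>m Idt A (Fn r))"

lemma N3_hom: "N3 p q r \<in> Hom A ((Fn p \<odot> Fn q) \<odot> Fn r) (Fn (p + q + r))"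
  unfolding N3_def by (intro comp_hom[OF ten_hom[OF NN_hom id_hom[OF Fn_obj]] NN_hom])

lemma FB_nested_right:
  "FB p (q + r) \<cdot> (Idt A (Fn p) \<otimes>\<^sub>m FB q r) \<cdot> Asso A (Fn p) (Fn q) (Fn r) =
   FT (p + q + r) (p + q + r) (sbr p (q + r) (frag_of (ival 0 p))
     (sbr q r (frag_of (ival p q)) (frag_of (ival (p + q) r)))) \<cdot> N3 p q r"
proof -
  let ?X = "frag_of (ival 0 p)" and ?v = "bracket_tensor q r"
  have X: "?X \<in> tensors {1..p} p" by (rule ival_tensors) simp
  have v: "relabel ((+) p) ?v = sbr q r (frag_of (ival p q)) (frag_of (ival (p + q) r))"
    by (simp add: bracket_tensor_def relabel_sbr map_add_ival)
  have t: "sbr p (q + r) ?X (relabel ((+) p) ?v) \<in> tensors {1..p + (q + r)} (p + (q + r))"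
    by (intro tensors_sbr ival_tensors shift_tensors bracket_tensor_tensors) simp
  note ah = asso_hom[OF Fn_obj Fn_obj Fn_obj]
  note h = HomD[OF NN_hom] HomD[OF FB_hom] HomD[OF FT_hom[OF bracket_tensor_tensors]]
    HomD[OF FT_hom[OF X]] HomD[OF FT_hom[OF t]] HomD[OF ah] arr_simps arr_ten arr_ten_comp arr_ten_comp' Fn_obj
  have "FB p (q + r) \<cdot> (Idt A (Fn p) \<otimes>\<^sub>m FB q r) \<cdot> Asso A (Fn p) (Fn q) (Fn r)
      = FB p (q + r) \<cdot> (FT p p ?X \<otimes>\<^sub>m FT (q + r) (q + r) ?v) \<cdot> (Idt A (Fn p) \<otimes>\<^sub>m NN q r) \<cdot> Asso A (Fn p) (Fn q) (Fn r)"
    using FB_eq[of q r] by (simp add: h FT_id)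
  also have "\<dots> = FT (p + (q + r)) (p + (q + r)) (sbr p (q + r) ?X (relabel ((+) p) ?v)) \<cdot>
      (NN p (q + r) \<cdot> (Idt A (Fn p) \<otimes>\<^sub>m NN q r) \<cdot> Asso A (Fn p) (Fn q) (Fn r))"
    unfolding FB_natural[OF X bracket_tensor_tensors] by (simp add: h)
  also have "\<dots> = FT (p + q + r) (p + q + r) (sbr p (q + r) ?X (relabel ((+) p) ?v)) \<cdot> N3 p q r"
    unfolding N3_def NN_assoc by (simp add: add.assoc)
  finally show ?thesis unfolding v .
qed

lemma FB_nested_left:
  "FB (p + q) r \<cdot> (FB p q \<otimes>\<^sub>m Idt A (Fn r)) =
   FT (p + q + r) (p + q + r) (sbr (p + q) r (sbr p q (frag_of (ival 0 p)) (frag_of (ival p q)))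
     (frag_of (ival (p + q) r))) \<cdot> N3 p q r"
proof -
  let ?Z = "frag_of (ival 0 r)" and ?u = "bracket_tensor p q"
  have Z: "?Z \<in> tensors {1..r} r" by (rule ival_tensors) simp
  have t: "sbr (p + q) r ?u (relabel ((+) (p + q)) ?Z) \<in> tensors {1..p + q + r} (p + q + r)"
    by (intro tensors_sbr shift_tensors Z tensors_mono[OF bracket_tensor_tensors]) simp
  note h = HomD[OF NN_hom] HomD[OF FB_hom] HomD[OF FT_hom[OF bracket_tensor_tensors]]
    HomD[OF FT_hom[OF Z]] HomD[OF FT_hom[OF t]] arr_simps arr_ten arr_ten_comp arr_ten_comp' Fn_obj
  have "FB (p + q) r \<cdot> (FB p q \<otimes>\<^sub>m Idt A (Fn r))
      = FB (p + q) r \<cdot> (FT (p + q) (p + q) ?u \<otimes>\<^sub>m FT r r ?Z) \<cdot> (NN p q \<otimes>\<^sub>m Idt A (Fn r))"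
    using FB_eq[of p q] by (simp add: h FT_id)
  also have "\<dots> = FT (p + q + r) (p + q + r) (sbr (p + q) r ?u (relabel ((+) (p + q)) ?Z)) \<cdot> N3 p q r"
    unfolding FB_natural[OF bracket_tensor_tensors Z] N3_def by (simp add: h del: relabel_frag_of)
  finally show ?thesis by (simp add: bracket_tensor_def map_add_ival)
qed

lemma N3_Comm:
  "N3 q p r \<cdot> (Comm A (Fn p) (Fn q) \<otimes>\<^sub>m Idt A (Fn r)) =
   FT (p + q + r) (q + p + r) (frag_of (ival p q @ ival 0 p @ ival (p + q) r)) \<cdot> N3 p q r"
proof -
  let ?Z = "frag_of (ival 0 r)" and ?s = "frag_of (ival p q @ ival 0 p)"
  have Z: "?Z \<in> tensors {1..r} r" by (rule ival_tensors) simp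
  have s: "?s \<in> tensors {1..p + q} (q + p)" by (intro tensors_frag_of) (auto simp: words_def)
  have t: "?s * relabel ((+) (p + q)) ?Z \<in> tensors {1..p + q + r} (q + p + r)"
    by (intro tensors_mult shift_tensors Z tensors_mono[OF s]) simp
  have c: "Comm A (Fn p) (Fn q) \<in> Hom A (Fn p \<odot> Fn q) (Fn q \<odot> Fn p)" by (intro comm_hom Fn_obj)
  note h = HomD[OF NN_hom] HomD[OF FT_hom[OF s]] HomD[OF c]
    HomD[OF FT_hom[OF Z]] HomD[OF FT_hom[OF t]] arr_simps arr_ten arr_ten_comp arr_ten_comp' Fn_obj
  have "N3 q p r \<cdot> (Comm A (Fn p) (Fn q) \<otimes>\<^sub>m Idt A (Fn r))
      = NN (q + p) r \<cdot> ((NN q p \<cdot> Comm A (Fn p) (Fn q)) \<otimes>\<^sub>m Idt A (Fn r))"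
    unfolding N3_def by (simp add: h)
  also have "\<dots> = NN (q + p) r \<cdot> (FT (p + q) (q + p) ?s \<otimes>\<^sub>m FT r r ?Z) \<cdot> (NN p q \<otimes>\<^sub>m Idt A (Fn r))"
    unfolding NN_Comm by (simp add: h FT_id)
  also have "\<dots> = FT (p + q + r) (q + p + r) (?s * relabel ((+) (p + q)) ?Z) \<cdot> N3 p q r"
    unfolding NN_natural[OF s Z] N3_def by (simp add: h del: relabel_frag_of)
  finally show ?thesis by (simp add: map_add_ival mult_single)
qed

text \<open>By the preceding lemmas each term is the action of an iterated superbracket of the words \<open>X\<close>, \<open>Y\<close>, \<open>Z\<close>
  of the three blocks. In the last term the blocks \<open>p\<close> and \<open>q\<close> are exchanged by the constraint, which
  turns the standard words for \<open>(q, p, r)\<close> into \<open>Y\<close>, \<open>X\<close>, \<open>Z\<close>.\<close>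

lemma FB_jacobi:
  "FB p (q + r) \<cdot> (Idt A (Fn p) \<otimes>\<^sub>m FB q r) \<cdot> Asso A (Fn p) (Fn q) (Fn r) =
   FB (p + q) r \<cdot> (FB p q \<otimes>\<^sub>m Idt A (Fn r)) \<boxplus>
   scal A ((- 1) ^ (p * q)) (FB q (p + r) \<cdot> (Idt A (Fn q) \<otimes>\<^sub>m FB p r) \<cdot> Asso A (Fn q) (Fn p) (Fn r) \<cdot>
     (Comm A (Fn p) (Fn q) \<otimes>\<^sub>m Idt A (Fn r)))"
proof -
  let ?n = "p + q + r"
  define X Y Z where "X = frag_of (ival 0 p)" and "Y = frag_of (ival p q)" and "Z = frag_of (ival (p + q) r)"
  define s where "s = ival p q @ ival 0 p @ ival (p + q) r"
  define y where "y = sbr q (p + r) (frag_of (ival 0 q)) (sbr p r (frag_of (ival q p)) (frag_of (ival (q + p) r)))"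
  have XYZ: "X \<in> tensors {1..?n} p" "Y \<in> tensors {1..?n} q" "Z \<in> tensors {1..?n} r"
    unfolding X_def Y_def Z_def by (intro ival_tensors; simp)+
  have s: "frag_of s \<in> tensors {1..?n} (q + p + r)"
    unfolding s_def by (intro tensors_frag_of) (auto simp: words_def)
  have "y \<in> tensors {1..q + p + r} (q + (p + r))"
    unfolding y_def by (intro tensors_sbr ival_tensors) simp_all
  then have y: "y \<in> tensors {1..q + p + r} (q + p + r)" by (simp only: add.assoc)
  have L: "sbr (p + q) r (sbr p q X Y) Z \<in> tensors {1..?n} ?n" by (intro tensors_sbr XYZ)
  have "sbr q (p + r) Y (sbr p r X Z) \<in> tensors {1..?n} (q + (p + r))" by (intro tensors_sbr XYZ)
  then have R: "sbr q (p + r) Y (sbr p r X Z) \<in> tensors {1..?n} ?n" by (simp add: ac_simps)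
  have "tcomp (frag_of s) y = sbr q (p + r) Y (sbr p r X Z)"
  proof -
    have "map (\<lambda>j. s ! (j - 1)) (ival 0 q) = ival p q" "map (\<lambda>j. s ! (j - 1)) (ival q p) = ival 0 p"
      "map (\<lambda>j. s ! (j - 1)) (ival (q + p) r) = ival (p + q) r"
      by (auto intro!: nth_equalityI simp: s_def nth_append)
    then show ?thesis
      by (simp add: tcomp_conv_relabel y_def relabel_sbr X_def Y_def Z_def)
  qed
  then have sw: "FT (q + p + r) (q + p + r) y \<cdot> FT ?n (q + p + r) (frag_of s)
      = FT ?n ?n (sbr q (p + r) Y (sbr p r X Z))"
    using FT_comp[OF s y] by (simp add: add.commute[of q p])
  have c: "Comm A (Fn p) (Fn q) \<otimes>\<^sub>m Idt A (Fn r) \<in> Hom A ((Fn p \<odot> Fn q) \<odot> Fn r) ((Fn q \<odot> Fn p) \<odot> Fn r)"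
    by (intro ten_hom comm_hom id_hom Fn_obj)
  note h = HomD[OF c] HomD[OF N3_hom] HomD[OF FT_hom[OF s]] HomD[OF FT_hom[OF y]] arr_simps
  have "FB q (p + r) \<cdot> (Idt A (Fn q) \<otimes>\<^sub>m FB p r) \<cdot> Asso A (Fn q) (Fn p) (Fn r) \<cdot>
      (Comm A (Fn p) (Fn q) \<otimes>\<^sub>m Idt A (Fn r))
      = FT (q + p + r) (q + p + r) y \<cdot> (N3 q p r \<cdot> (Comm A (Fn p) (Fn q) \<otimes>\<^sub>m Idt A (Fn r)))"
    unfolding FB_nested_right y_def[symmetric] by (simp add: h)
  also have "\<dots> = (FT (q + p + r) (q + p + r) y \<cdot> FT ?n (q + p + r) (frag_of s)) \<cdot> N3 p q r"
    unfolding N3_Comm s_def[symmetric] by (simp add: h)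
  finally have 3: "FB q (p + r) \<cdot> (Idt A (Fn q) \<otimes>\<^sub>m FB p r) \<cdot> Asso A (Fn q) (Fn p) (Fn r) \<cdot>
      (Comm A (Fn p) (Fn q) \<otimes>\<^sub>m Idt A (Fn r)) = FT ?n ?n (sbr q (p + r) Y (sbr p r X Z)) \<cdot> N3 p q r"
    unfolding sw .
  show ?thesis
    unfolding 3 unfolding FB_nested_right FB_nested_left X_def[symmetric] Y_def[symmetric] Z_def[symmetric]
      sbr_jacobi[of p q r] FT_add[OF L tensors_sign[OF R]] FT_sign[OF R]
    using comp_add_left[OF N3_hom FT_hom[OF L] scal_hom[OF FT_hom[OF R]]]
      scal_comp[OF N3_hom FT_hom[OF R]] by simp
qed

lemma FB_antisym:
  "FB p q = scal A (- ((- 1) ^ (p * q))) (FB q p \<cdot> Comm A (Fn p) (Fn q))"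
proof -
  let ?c = "- ((- 1) ^ (p * q)) :: int"
  have c: "Comm A (Fn p) (Fn q) \<in> Hom A (Fn p \<odot> Fn q) (Fn q \<odot> Fn p)"
    "Comm A (Fn q) (Fn p) \<in> Hom A (Fn q \<odot> Fn p) (Fn p \<odot> Fn q)" by (intro comm_hom Fn_obj)+
  have NC: "NN q p \<cdot> Comm A (Fn p) (Fn q) \<in> Hom A (Fn p \<odot> Fn q) (Fn (p + q))"
    "NN p q \<cdot> Comm A (Fn q) (Fn p) \<in> Hom A (Fn q \<odot> Fn p) (Fn (q + p))"
    using comp_hom[OF c(1) NN_hom] comp_hom[OF c(2) NN_hom] by (simp_all add: add.commute)
  have "FB q p \<cdot> Comm A (Fn p) (Fn q) = NN q p \<cdot> Comm A (Fn p) (Fn q) \<boxplus>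
      scal A ?c (NN p q \<cdot> Comm A (Fn q) (Fn p) \<cdot> Comm A (Fn p) (Fn q))"
    unfolding F_bracket_def
    using comp_add_left[OF c(1) NN_hom scal_hom[OF NC(2)]] scal_comp[OF c(1) NC(2)]
    by (simp add: mult.commute)
  also have "NN p q \<cdot> Comm A (Fn q) (Fn p) \<cdot> Comm A (Fn p) (Fn q) = NN p q"
    using comp_assoc[OF c NN_hom] symmetry[OF Fn_obj Fn_obj] id_right[OF NN_hom] by simp
  finally have "scal A ?c (FB q p \<cdot> Comm A (Fn p) (Fn q))
      = scal A ?c (NN q p \<cdot> Comm A (Fn p) (Fn q)) \<boxplus> scal A ?c (scal A ?c (NN p q))"
    using scal_add[OF NC(1) scal_hom[OF NN_hom]] by simp
  also have "scal A ?c (scal A ?c (NN p q)) = NN p q"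
    using scal_scal[OF NN_hom, of ?c ?c] scal_one[OF NN_hom] by (cases "even (p * q)") simp_all
  finally show ?thesis
    unfolding F_bracket_def using add_commute[OF NN_hom scal_hom[OF NC(1)]] by simp
qed

abbreviation FD :: "nat \<Rightarrow> 'm" where "FD n \<equiv> FT n (n + 1) (dbl (ival 0 n))"

lemma FD_hom: "FD n \<in> Hom A (Fn n) (Fn (n + 1))"
  by (intro FT_hom dbl_ival_tensors) simp

lemma FD_FD: "FD (n + 1) \<cdot> FD n = Zer A (Fn n) (Fn (n + 2))"
proof -
  have "FD (n + 1) \<cdot> FD n = FT n (n + 1 + 1) (tcomp (dbl (ival 0 n)) (dbl (ival 0 (n + 1))))"
    by (intro FT_comp dbl_ival_tensors) simp_all
  moreover have "tcomp (dbl (ival 0 n)) (dbl (ival 0 (n + 1))) = 0"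
    using tcomp_dbl[OF dbl_ival_tensors[of 0 n n]] by (simp add: dbl_dbl)
  moreover have "n + 1 + 1 = n + 2" by simp
  ultimately show ?thesis by (simp only: FT_zero)
qed

lemma FB_leibniz:
  "FD (p + q) \<cdot> FB p q = FB (p + 1) q \<cdot> (FD p \<otimes>\<^sub>m Idt A (Fn q)) \<boxplus>
    scal A ((- 1) ^ p) (FB p (q + 1) \<cdot> (Idt A (Fn p) \<otimes>\<^sub>m FD q))"
proof -
  let ?n = "p + q" and ?X = "frag_of (ival 0 p)" and ?Y = "frag_of (ival p q)"
  have X: "?X \<in> tensors {1..p} p" and X': "?X \<in> tensors {1..?n} p" and Y: "?Y \<in> tensors {1..?n} q"
    and Y0: "frag_of (ival 0 q) \<in> tensors {1..q} q"
    by (intro ival_tensors; simp)+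
  have d: "dbl (ival 0 p) \<in> tensors {1..p} (p + 1)" "dbl (ival 0 p) \<in> tensors {1..?n} (p + 1)"
    "dbl (ival p q) \<in> tensors {1..?n} (q + 1)" "dbl (ival 0 q) \<in> tensors {1..q} (q + 1)"
    "dbl (ival 0 ?n) \<in> tensors {1..?n} (?n + 1)"
    by (intro dbl_ival_tensors; simp)+
  let ?L = "sbr (p + 1) q (dbl (ival 0 p)) ?Y" and ?R = "sbr p (q + 1) ?X (dbl (ival p q))"
  have LR: "?L \<in> tensors {1..?n} (?n + 1)" "?R \<in> tensors {1..?n} (?n + 1)"
    using tensors_sbr[OF d(2) Y, of "p + 1" q] tensors_sbr[OF X' d(3), of p "q + 1"]
    by (simp_all add: ac_simps)
  have "FD ?n \<cdot> FB p q = (FD ?n \<cdot> FT ?n ?n (bracket_tensor p q)) \<cdot> NN p q"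
    unfolding FB_eq by (rule comp_assoc[OF NN_hom FT_hom[OF bracket_tensor_tensors] FD_hom])
  also have "FD ?n \<cdot> FT ?n ?n (bracket_tensor p q) = FT ?n (?n + 1) (frag_extend dbl (bracket_tensor p q))"
    using FT_comp[OF bracket_tensor_tensors d(5)] tcomp_dbl[OF bracket_tensor_tensors] by simp
  also have "frag_extend dbl (bracket_tensor p q) = ?L + (- 1) ^ p * ?R"
    unfolding bracket_tensor_def dbl_sbr[OF X' Y] by simp
  also have "FT ?n (?n + 1) (?L + (- 1) ^ p * ?R) = FT ?n (?n + 1) ?L \<boxplus> scal A ((- 1) ^ p) (FT ?n (?n + 1) ?R)"
    using FT_add[OF LR(1) tensors_sign[OF LR(2)]] FT_sign[OF LR(2)] by simp
  also have "\<dots> \<cdot> NN p q = FT ?n (?n + 1) ?L \<cdot> NN p q \<boxplus> scal A ((- 1) ^ p) (FT ?n (?n + 1) ?R \<cdot> NN p q)"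
    using comp_add_left[OF NN_hom FT_hom[OF LR(1)] scal_hom[OF FT_hom[OF LR(2)]]]
      scal_comp[OF NN_hom FT_hom[OF LR(2)]] by simp
  also have "FT ?n (?n + 1) ?L \<cdot> NN p q = FB (p + 1) q \<cdot> (FD p \<otimes>\<^sub>m Idt A (Fn q))"
    using FB_natural[OF d(1) Y0] by (simp add: FT_id map_add_ival ac_simps)
  also have "FT ?n (?n + 1) ?R \<cdot> NN p q = FB p (q + 1) \<cdot> (Idt A (Fn p) \<otimes>\<^sub>m FD q)"
    using FB_natural[OF X d(4)] by (simp add: FT_id map_add_ival relabel_dbl ac_simps)
  finally show ?thesis .
qed

end

section \<open>The images, and the restriction of bracket and differential\<close>

context multiplicative_Fin_opp_functor
begin

abbreviation FW :: "nat \<Rightarrow> 'm" where "FW n \<equiv> FT n n (lie (ival 0 n))"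

lemma FW_hom: "FW n \<in> Hom A (Fn n) (Fn n)"
  by (intro FT_hom lie_ival_tensors)

lemma F_ext_w_tilde: "1 \<le> n \<Longrightarrow> F_ext A Fo Fm {1..n} {1..n} (w_tilde n) = FW n"
  by (simp add: w_tilde_eq_lie FT_def)

lemma F_ext_f_elem: "F_ext A Fo Fm {1..n + 1} {1..n} (f_elem n) = FD n"
  by (simp add: f_elem_eq_dbl FT_def)

lemma FW_FT: "u \<in> tensors {1..n} m \<Longrightarrow> FW m \<cdot> FT n m u = FT n m (frag_extend lie u)"
  using FT_comp[OF _ lie_ival_tensors] tcomp_lie by simp

lemma FW_square:
  assumes "1 \<le> n" shows "FW n \<cdot> FW n = scal A (int n) (FW n)"
  using assms FW_FT[OF lie_ival_tensors, of n] FT_of_nat[OF lie_ival_tensors, of n n]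
    lie_lie[of "ival 0 n"] by simp

lemma images_exist:
  assumes "Q_Karoubian A"
  shows "\<exists>P \<iota>. image_family A Fo Fm P \<iota>"
proof -
  have ex: "\<exists>I i. is_image A (Fn n) (Fn n) (FW n) I i" if "1 \<le> n" for n
    using assms Fn_obj FW_hom[of n] FW_square[OF that] unfolding Q_Karoubian_def by blast
  define PI where "PI n = (SOME Ii. is_image A (Fn n) (Fn n) (FW n) (fst Ii) (snd Ii))" for n
  have "is_image A (Fn n) (Fn n) (FW n) (fst (PI n)) (snd (PI n))" if "1 \<le> n" for n
    unfolding PI_def by (rule someI_ex) (use ex[OF that] in simp)
  then have "image_family A Fo Fm (\<lambda>n. fst (PI n)) (\<lambda>n. snd (PI n))"
    unfolding image_family_def by (simp add: F_ext_w_tilde)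
  then show ?thesis by blast
qed

lemma FT_sign_zero:
  assumes "u \<in> tensors {1..n} m" "z \<in> Hom A X (Fn n)" "FT n m u \<cdot> z = Zer A X (Fn m)"
  shows "FT n m ((- 1) ^ k * u) \<cdot> z = Zer A X (Fn m)"
  using scal_comp[OF assms(2) FT_hom[OF assms(1)]] assms(3) Hom_objD(1)[OF assms(2)]
  by (simp add: FT_sign[OF assms(1)] scal_zer Fn_obj)

lemma FT_add_zero:
  assumes "u \<in> tensors {1..n} m" "v \<in> tensors {1..n} m" "z \<in> Hom A X (Fn n)"
    and "FT n m v \<cdot> z = Zer A X (Fn m)"
  shows "FT n m (u + v) \<cdot> z = FT n m u \<cdot> z"
  using comp_add_left[OF assms(3) FT_hom[OF assms(1)] FT_hom[OF assms(2)]] assms(4)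
    add_zer(1)[OF comp_hom[OF assms(3) FT_hom[OF assms(1)]]]
  by (simp add: FT_add[OF assms(1,2)])

text \<open>Suppose that the tensors in one block which \<open>\<lambda>\<close> annihilates act on \<open>z\<close> by zero. Then so do the tensors
  \<open>\<Omega>\<close> that mix the letters of the block with others and are annihilated by \<open>\<lambda>\<close> in the block: the block
  decomposition writes \<open>\<Omega>\<close> as a sum of such actions in the block, each followed by a word.\<close>

lemma FT_block_zero:
  fixes a r b m :: nat
  defines "n \<equiv> a + r + b"
  assumes z: "z \<in> Hom A X (Fn n)"
    and \<Omega>: "\<Omega> \<in> carrier (free_Abelian_group
      {w \<in> words {1..n} m. length (filter (in_block a r) w) = r})"
    and ann: "tcomp (embed_tensor a r b (lie (ival 0 r))) \<Omega> = 0"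
    and van: "\<And>u. u \<in> tensors {1..r} r \<Longrightarrow> tcomp (lie (ival 0 r)) u = 0 \<Longrightarrow>
      FT n n (embed_tensor a r b u) \<cdot> z = Zer A X (Fn n)"
  shows "FT n m \<Omega> \<cdot> z = Zer A X (Fn m)"
proof -
  have X: "X \<in> Obj A" using Hom_objD(1)[OF z] .
  obtain K :: "nat list set" and u t where K: "finite K"
    "\<Omega> = (\<Sum>\<kappa>\<in>K. tcomp (embed_tensor a r b (u \<kappa>)) (frag_of (t \<kappa>)))"
    "\<And>\<kappa>. \<kappa> \<in> K \<Longrightarrow> u \<kappa> \<in> tensors {1..r} r" "\<And>\<kappa>. \<kappa> \<in> K \<Longrightarrow> tcomp (lie (ival 0 r)) (u \<kappa>) = 0"
    "\<And>\<kappa>. \<kappa> \<in> K \<Longrightarrow> t \<kappa> \<in> words {1..n} m"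
    using block_decomposition[OF \<Omega>[unfolded n_def] lie_ival_tensors ann] unfolding n_def by blast
  let ?g = "\<lambda>\<kappa>. tcomp (embed_tensor a r b (u \<kappa>)) (frag_of (t \<kappa>))"
  have g: "?g \<kappa> \<in> tensors {1..n} m \<and> FT n m (?g \<kappa>) \<cdot> z = Zer A X (Fn m)" if "\<kappa> \<in> K" for \<kappa>
  proof -
    have E: "embed_tensor a r b (u \<kappa>) \<in> tensors {1..n} n"
      unfolding n_def by (rule embed_tensor_tensors[OF K(3)[OF that]])
    have T: "frag_of (t \<kappa>) \<in> tensors {1..n} m" using K(5)[OF that] by simp
    have "FT n m (?g \<kappa>) \<cdot> z = FT n m (frag_of (t \<kappa>)) \<cdot> (FT n n (embed_tensor a r b (u \<kappa>)) \<cdot> z)"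
      using FT_comp[OF E T] comp_assoc[OF z FT_hom[OF E] FT_hom[OF T]] by simp
    also have "\<dots> = Zer A X (Fn m)"
      unfolding van[OF K(3,4)[OF that]] by (rule comp_zer[OF FT_hom[OF T] X])
    finally show ?thesis using tcomp_tensors[OF E T] by simp
  qed
  have "sum ?g K' \<in> tensors {1..n} m \<and> FT n m (sum ?g K') \<cdot> z = Zer A X (Fn m)"
    if "K' \<subseteq> K" "finite K'" for K'
    using that(2,1)
  proof (induction K' rule: finite_induct)
    case empty
    show ?case using zer_comp[OF z Fn_obj] by (simp add: FT_zero)
  next
    case (insert \<kappa> K')
    then have 1: "sum ?g K' \<in> tensors {1..n} m" "FT n m (sum ?g K') \<cdot> z = Zer A X (Fn m)" by auto
    have 2: "?g \<kappa> \<in> tensors {1..n} m" "FT n m (?g \<kappa>) \<cdot> z = Zer A X (Fn m)"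
      using g insert.prems by auto
    have "sum ?g (insert \<kappa> K') = ?g \<kappa> + sum ?g K'" using insert by simp
    then show ?case
      using FT_add_zero[OF 2(1) 1(1) z 1(2)] 2(2) tensors_add[OF 2(1) 1(1)] by (simp only: simp_thms)
  qed
  then show ?thesis using K(1,2) by auto
qed

end

locale primitive_images = multiplicative_Fin_opp_functor A Fo Fm N
  for A :: "('o, 'm, 'z) tensor_data_scheme" (structure)
    and Fo :: "nat set \<Rightarrow> 'o" and Fm :: "nat set \<Rightarrow> nat set \<Rightarrow> (nat \<Rightarrow> nat) \<Rightarrow> 'm"
    and N :: "nat set \<Rightarrow> nat set \<Rightarrow> 'm" +
  fixes P :: "nat \<Rightarrow> 'o" and \<iota> :: "nat \<Rightarrow> 'm"
  assumes images: "image_family A Fo Fm P \<iota>"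
begin

definition \<epsilon> :: "nat \<Rightarrow> 'm" where
  "\<epsilon> n = (SOME e. is_epi A (Fn n) (P n) e \<and> FW n = \<iota> n \<cdot> e)"

lemma \<iota>_mono: "1 \<le> n \<Longrightarrow> is_mono A (P n) (Fn n) (\<iota> n)"
  using images by (simp add: image_family_def is_image_def)

lemma \<epsilon>: "1 \<le> n \<Longrightarrow> is_epi A (Fn n) (P n) (\<epsilon> n) \<and> FW n = \<iota> n \<cdot> \<epsilon> n"
  unfolding \<epsilon>_def
  by (rule someI_ex) (use images in \<open>auto simp: image_family_def is_image_def F_ext_w_tilde\<close>)

lemma \<iota>_hom: "1 \<le> n \<Longrightarrow> \<iota> n \<in> Hom A (P n) (Fn n)"
  using \<iota>_mono by (simp add: is_mono_def)

lemma \<epsilon>_hom: "1 \<le> n \<Longrightarrow> \<epsilon> n \<in> Hom A (Fn n) (P n)"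
  using \<epsilon> by (simp add: is_epi_def)

lemma P_obj: "1 \<le> n \<Longrightarrow> P n \<in> Obj A"
  using \<iota>_hom Hom_objD by blast

lemma \<iota>_cancel: "1 \<le> n \<Longrightarrow> f \<in> Hom A X (P n) \<Longrightarrow> g \<in> Hom A X (P n) \<Longrightarrow> \<iota> n \<cdot> f = \<iota> n \<cdot> g \<Longrightarrow> f = g"
  using \<iota>_mono[of n] unfolding is_mono_def by blast

lemma \<epsilon>_cancel: "1 \<le> n \<Longrightarrow> f \<in> Hom A (P n) X \<Longrightarrow> g \<in> Hom A (P n) X \<Longrightarrow> f \<cdot> \<epsilon> n = g \<cdot> \<epsilon> n \<Longrightarrow> f = g"
  using \<epsilon>[of n] unfolding is_epi_def by blast

lemma FT_\<iota>_\<epsilon>: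
  assumes "1 \<le> n" "u \<in> tensors {1..n} m"
  shows "FT n m u \<cdot> \<iota> n \<cdot> \<epsilon> n = FT n m (tcomp (lie (ival 0 n)) u)"
  using comp_assoc[OF \<epsilon>_hom \<iota>_hom FT_hom[OF assms(2)]] \<epsilon> FT_comp[OF lie_ival_tensors assms(2)] assms(1)
  by simp

text \<open>The inclusion of the image behaves like a Lie element. Here the epimorphism \<open>\<epsilon>\<close> is cancelled, which
  would be impossible after tensoring.\<close>

lemma FT_\<iota>_zero:
  assumes "1 \<le> n" "u \<in> tensors {1..n} m" "tcomp (lie (ival 0 n)) u = 0"
  shows "FT n m u \<cdot> \<iota> n = Zer A (P n) (Fn m)"
proof (rule \<epsilon>_cancel[OF assms(1)])
  show "FT n m u \<cdot> \<iota> n \<in> Hom A (P n) (Fn m)"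
    by (rule comp_hom[OF \<iota>_hom[OF assms(1)] FT_hom[OF assms(2)]])
  show "Zer A (P n) (Fn m) \<in> Hom A (P n) (Fn m)" by (intro zer_hom P_obj assms Fn_obj)
  show "FT n m u \<cdot> \<iota> n \<cdot> \<epsilon> n = Zer A (P n) (Fn m) \<cdot> \<epsilon> n"
    using FT_\<iota>_\<epsilon>[OF assms(1,2)] zer_comp[OF \<epsilon>_hom[OF assms(1)] Fn_obj] assms(3)
    by (simp add: FT_zero)
qed

definition N\<iota> :: "nat \<Rightarrow> nat \<Rightarrow> 'm" where
  "N\<iota> p q = NN p q \<cdot> (\<iota> p \<otimes>\<^sub>m \<iota> q)"

lemma N\<iota>_hom: "1 \<le> p \<Longrightarrow> 1 \<le> q \<Longrightarrow> N\<iota> p q \<in> Hom A (P p \<odot> P q) (Fn (p + q))"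
  unfolding N\<iota>_def by (rule comp_hom[OF ten_hom[OF \<iota>_hom \<iota>_hom] NN_hom])

lemma N\<iota>_natural:
  assumes "1 \<le> p" "1 \<le> q" "u \<in> tensors {1..p} p" "v \<in> tensors {1..q} q"
  shows "FT (p + q) (p + q) (u * relabel ((+) p) v) \<cdot> N\<iota> p q =
    NN p q \<cdot> ((FT p p u \<cdot> \<iota> p) \<otimes>\<^sub>m (FT q q v \<cdot> \<iota> q))"
proof -
  have t: "u * relabel ((+) p) v \<in> tensors {1..p + q} (p + q)"
    by (intro tensors_mult shift_tensors assms tensors_mono[OF assms(3)]) simp
  note h = HomD[OF NN_hom] HomD[OF FT_hom[OF t]] HomD[OF FT_hom[OF assms(3)]] HomD[OF FT_hom[OF assms(4)]]
    HomD[OF \<iota>_hom[OF assms(1)]] HomD[OF \<iota>_hom[OF assms(2)]] arr_simps arr_ten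
  have "FT (p + q) (p + q) (u * relabel ((+) p) v) \<cdot> N\<iota> p q
      = (NN p q \<cdot> (FT p p u \<otimes>\<^sub>m FT q q v)) \<cdot> (\<iota> p \<otimes>\<^sub>m \<iota> q)"
    unfolding NN_natural[OF assms(3,4)] N\<iota>_def by (simp add: h)
  then show ?thesis by (simp add: h arr_ten_comp)
qed

text \<open>Actions on the block of the last \<open>q\<close> letters act on the factor \<open>\<iota> q\<close> alone.\<close>

lemma right_defect_zero:
  assumes "1 \<le> p" "1 \<le> q"
  shows "FT (p + q) (p + q) (right_defect p q) \<cdot> N\<iota> p q = Zer A (P p \<odot> P q) (Fn (p + q))"
proof -
  have "FT (p + q + 0) (p + q) (right_defect p q) \<cdot> N\<iota> p q = Zer A (P p \<odot> P q) (Fn (p + q))"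
  proof (rule FT_block_zero)
    show "N\<iota> p q \<in> Hom A (P p \<odot> P q) (Fn (p + q + 0))" using N\<iota>_hom[OF assms] by simp
    show "right_defect p q \<in> carrier (free_Abelian_group
        {w \<in> words {1..p + q + 0} (p + q). length (filter (in_block p q) w) = q})"
      using multilinear_block[of _ p q 0] right_defect_multilinear by simp
    show "tcomp (embed_tensor p q 0 (lie (ival 0 q))) (right_defect p q) = 0"
      using assms by (intro right_defect_annihilated) simp
    fix u assume u: "u \<in> tensors {1..q} q" "tcomp (lie (ival 0 q)) u = 0"
    have "FT (p + q) (p + q) (embed_tensor p q 0 u) \<cdot> N\<iota> p q = NN p q \<cdot> ((FT p p (frag_of (ival 0 p)) \<cdot> \<iota> p) \<otimes>\<^sub>m (FT q q u \<cdot> \<iota> q))"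
      unfolding embed_tensor_right by (intro N\<iota>_natural assms u ival_tensors) simp
    also have "\<dots> = Zer A (P p \<odot> P q) (Fn (p + q))"
      using FT_\<iota>_zero[OF assms(2) u] id_left[OF \<iota>_hom[OF assms(1)]] ten_zer[OF \<iota>_hom[OF assms(1)] P_obj[OF assms(2)] Fn_obj]
        comp_zer[OF NN_hom ten_obj[OF P_obj[OF assms(1)] P_obj[OF assms(2)]]]
      by (simp add: FT_id)
    finally show "FT (p + q + 0) (p + q + 0) (embed_tensor p q 0 u) \<cdot> N\<iota> p q = Zer A (P p \<odot> P q) (Fn (p + q + 0))"
      by simp
  qed
  then show ?thesis by simp
qed

text \<open>Actions on the block of the first \<open>p\<close> letters act on the factor \<open>\<iota> p\<close> alone.\<close>

lemma left_defect_zero: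
  assumes "1 \<le> p" "1 \<le> q"
  shows "FT (p + q) (p + q) (left_defect p q) \<cdot> N\<iota> p q = Zer A (P p \<odot> P q) (Fn (p + q))"
proof -
  have "FT (0 + p + q) (p + q) (left_defect p q) \<cdot> N\<iota> p q = Zer A (P p \<odot> P q) (Fn (p + q))"
  proof (rule FT_block_zero)
    show "N\<iota> p q \<in> Hom A (P p \<odot> P q) (Fn (0 + p + q))" using N\<iota>_hom[OF assms] by simp
    show "left_defect p q \<in> carrier (free_Abelian_group
        {w \<in> words {1..0 + p + q} (p + q). length (filter (in_block 0 p) w) = p})"
      using multilinear_block[of _ 0 p q] left_defect_multilinear[of q p] assms by simp
    show "tcomp (embed_tensor 0 p q (lie (ival 0 p))) (left_defect p q) = 0"
      using assms by (intro left_defect_annihilated) simp_all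
    fix u assume u: "u \<in> tensors {1..p} p" "tcomp (lie (ival 0 p)) u = 0"
    have "FT (p + q) (p + q) (u * relabel ((+) p) (frag_of (ival 0 q))) \<cdot> N\<iota> p q
        = NN p q \<cdot> ((FT p p u \<cdot> \<iota> p) \<otimes>\<^sub>m (FT q q (frag_of (ival 0 q)) \<cdot> \<iota> q))"
      by (intro N\<iota>_natural assms u ival_tensors) simp
    also have "\<dots> = Zer A (P p \<odot> P q) (Fn (p + q))"
      using FT_\<iota>_zero[OF assms(1) u] id_left[OF \<iota>_hom[OF assms(2)]] zer_ten[OF \<iota>_hom[OF assms(2)] P_obj[OF assms(1)] Fn_obj]
        comp_zer[OF NN_hom ten_obj[OF P_obj[OF assms(1)] P_obj[OF assms(2)]]]
      by (simp add: FT_id)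
    finally show "FT (0 + p + q) (0 + p + q) (embed_tensor 0 p q u) \<cdot> N\<iota> p q = Zer A (P p \<odot> P q) (Fn (0 + p + q))"
      by (simp add: embed_tensor_left map_add_ival)
  qed
  then show ?thesis by simp
qed

text \<open>The defects vanish on \<open>\<iota> \<otimes> \<iota>\<close>, so there the bracket is \<open>\<plusminus>\<lambda>\<close> of one word \<open>w\<close>, that is
  \<open>\<plusminus>F(w\<^sub>n) F(w) N (\<iota> \<otimes> \<iota>)\<close> with \<open>F(w\<^sub>n) = \<iota> \<epsilon>\<close>.\<close>

lemma bracket_restricts:
  assumes p: "1 \<le> p" and q: "1 \<le> q"
  shows "\<exists>h \<in> Hom A (P p \<odot> P q) (P (p + q)). \<iota> (p + q) \<cdot> h = FB p q \<cdot> (\<iota> p \<otimes>\<^sub>m \<iota> q)"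
proof -
  let ?n = "p + q"
  \<comment> \<open>the word \<open>y\<^sub>1 V y\<^sub>2 \<dots> y\<^sub>q\<close>\<close>
  define w where "w = Suc p # ival 0 p @ ival (Suc p) (q - 1)"
  have n: "1 \<le> ?n" using p by simp
  have w: "w \<in> words {1..?n} ?n" "frag_of w \<in> tensors {1..?n} ?n"
    using q by (auto simp: w_def words_def)
  have L: "lie w \<in> tensors {1..?n} ?n" by (rule lie_tensors[OF w(1)])
  have D: "right_defect p q \<in> tensors {1..?n} ?n" "left_defect p q \<in> tensors {1..?n} ?n"
    using multilinear_block[of "right_defect p q" p q 0] right_defect_multilinear[of p q]
      multilinear_block[of "left_defect p q" 0 p q] left_defect_multilinear[of q p] q
    by (simp_all add: subset_iff)
  note z = N\<iota>_hom[OF p q]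
  let ?h = "scal A ((- 1) ^ Suc p) (\<epsilon> ?n \<cdot> (FT ?n ?n (frag_of w) \<cdot> N\<iota> p q))"
  have h0: "FT ?n ?n (frag_of w) \<cdot> N\<iota> p q \<in> Hom A (P p \<odot> P q) (Fn ?n)"
    by (rule comp_hom[OF z FT_hom[OF w(2)]])
  have h: "\<epsilon> ?n \<cdot> (FT ?n ?n (frag_of w) \<cdot> N\<iota> p q) \<in> Hom A (P p \<odot> P q) (P ?n)"
    by (rule comp_hom[OF h0 \<epsilon>_hom[OF n]])
  have "FB p q \<cdot> (\<iota> p \<otimes>\<^sub>m \<iota> q) = FT ?n ?n (bracket_tensor p q) \<cdot> N\<iota> p q"
    unfolding FB_eq N\<iota>_def
    by (rule comp_assoc[symmetric, OF ten_hom[OF \<iota>_hom[OF p] \<iota>_hom[OF q]] NN_hom FT_hom[OF bracket_tensor_tensors]])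
  also have "bracket_tensor p q = (- 1) ^ Suc p * lie w + (- 1) ^ 1 * right_defect p q
      + (- 1) ^ Suc p * left_defect p q"
    using sbr_eq_lie_defects[of q p] q by (simp add: bracket_tensor_def w_def)
  also have "FT ?n ?n \<dots> \<cdot> N\<iota> p q = FT ?n ?n ((- 1) ^ Suc p * lie w + (- 1) ^ 1 * right_defect p q) \<cdot> N\<iota> p q"
    by (rule FT_add_zero[OF tensors_add[OF tensors_sign[OF L] tensors_sign[OF D(1)]]
          tensors_sign[OF D(2)] z FT_sign_zero[OF D(2) z left_defect_zero[OF p q]]])
  also have "\<dots> = FT ?n ?n ((- 1) ^ Suc p * lie w) \<cdot> N\<iota> p q"
    by (rule FT_add_zero[OF tensors_sign[OF L] tensors_sign[OF D(1)] z
          FT_sign_zero[OF D(1) z right_defect_zero[OF p q]]])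
  also have "\<dots> = scal A ((- 1) ^ Suc p) (FT ?n ?n (lie w) \<cdot> N\<iota> p q)"
    unfolding FT_sign[OF L] by (rule scal_comp[OF z FT_hom[OF L]])
  also have "FT ?n ?n (lie w) = \<iota> ?n \<cdot> \<epsilon> ?n \<cdot> FT ?n ?n (frag_of w)"
    using FW_FT[OF w(2)] \<epsilon>[OF n] by simp
  also have "\<dots> \<cdot> N\<iota> p q = \<iota> ?n \<cdot> (\<epsilon> ?n \<cdot> (FT ?n ?n (frag_of w) \<cdot> N\<iota> p q))"
    using HomD[OF \<iota>_hom[OF n]] HomD[OF \<epsilon>_hom[OF n]] HomD[OF FT_hom[OF w(2)]] HomD[OF z]
    by (simp add: arr_simps)
  also have "scal A ((- 1) ^ Suc p) \<dots> = \<iota> ?n \<cdot> ?h"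
    by (rule comp_scal[symmetric, OF h \<iota>_hom[OF n]])
  finally show ?thesis using scal_hom[OF h] by metis
qed

text \<open>By \<open>dbl_lie_twice\<close>, \<open>2 d \<iota> = \<iota> g\<close> where \<open>g\<close> doubles the first letter and projects by \<open>\<epsilon>\<close>; the
  epimorphism \<open>\<epsilon> n\<close> may be cancelled here. Halving \<open>g\<close> gives the restriction.\<close>

lemma differential_restricts:
  assumes two: "two_inverted A" and n: "1 \<le> n"
  shows "\<exists>h \<in> Hom A (P n) (P (n + 1)). \<iota> (n + 1) \<cdot> h = FD n \<cdot> \<iota> n"
proof -
  let ?L = "lie (ival 0 n)"
  \<comment> \<open>composition with this word doubles the first letter\<close>
  define w where "w = 1 # ival 0 n"
  have n1: "1 \<le> n + 1" by simp
  have w: "frag_of w \<in> tensors {1..n} (n + 1)"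
    using n by (intro tensors_frag_of) (auto simp: w_def words_def)
  have d: "dbl (ival 0 n) \<in> tensors {1..n} (n + 1)" by (rule dbl_ival_tensors) simp
  have L: "tcomp ?L (frag_of w) = frag_extend (\<lambda>u. frag_of (hd u # u)) ?L"
    unfolding tcomp_def frag_extend_of
  proof (rule frag_extend_cong[OF lie_ival_tensors])
    fix u assume "u \<in> words {1..n} n"
    then have "length u = n" "u \<noteq> []" using n by (auto simp: words_def)
    then have "plug u w = hd u # u"
      using plug_ival[of u n] by (simp add: w_def plug_def hd_conv_nth)
    then show "frag_of (plug u w) = frag_of (hd u # u)" by simp
  qed
  have "FT n (n + 1) (frag_extend lie (tcomp ?L (frag_of w))) = scal A 2 (FT n (n + 1) (frag_extend dbl ?L))"
  proof -
    have "frag_extend lie (tcomp ?L (frag_of w)) = of_nat 2 * frag_extend dbl ?L"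
      unfolding L using dbl_lie_twice[of "ival 0 n"] n
      by (subst additive_frag_extend) (simp_all add: frag_extend_diff)
    moreover have "frag_extend dbl ?L \<in> tensors {1..n} (n + 1)"
      using tcomp_tensors[OF lie_ival_tensors d] tcomp_dbl[OF lie_ival_tensors] by simp
    ultimately show ?thesis using FT_of_nat[of "frag_extend dbl ?L" n "n + 1" 2] by simp
  qed
  moreover have "FD n \<cdot> \<iota> n \<cdot> \<epsilon> n = FT n (n + 1) (frag_extend dbl ?L)"
    using FT_\<iota>_\<epsilon>[OF n d] tcomp_dbl[OF lie_ival_tensors] by simp
  moreover have "FW (n + 1) \<cdot> FT n (n + 1) (frag_of w) \<cdot> FW n = FT n (n + 1) (frag_extend lie (tcomp ?L (frag_of w)))"
    using FW_FT[OF tcomp_tensors[OF lie_ival_tensors w]] FT_comp[OF lie_ival_tensors w]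
      comp_assoc[OF FW_hom FT_hom[OF w] FW_hom] by simp
  ultimately have eq: "FW (n + 1) \<cdot> FT n (n + 1) (frag_of w) \<cdot> FW n = scal A 2 (FD n \<cdot> \<iota> n \<cdot> \<epsilon> n)"
    by simp
  note h = HomD[OF \<iota>_hom[OF n]] HomD[OF \<iota>_hom[OF n1]] HomD[OF \<epsilon>_hom[OF n]] HomD[OF \<epsilon>_hom[OF n1]]
    HomD[OF FT_hom[OF w]] HomD[OF FD_hom] HomD[OF FW_hom] arr_simps
  define g where "g = \<epsilon> (n + 1) \<cdot> FT n (n + 1) (frag_of w) \<cdot> \<iota> n"
  have g: "g \<in> Hom A (P n) (P (n + 1))" unfolding g_def by (rule HomI) (simp_all add: h)
  have D: "FD n \<cdot> \<iota> n \<in> Hom A (P n) (Fn (n + 1))" by (rule comp_hom[OF \<iota>_hom[OF n] FD_hom])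
  have "\<iota> (n + 1) \<cdot> g = scal A 2 (FD n \<cdot> \<iota> n)"
  proof (rule \<epsilon>_cancel[OF n])
    show "\<iota> (n + 1) \<cdot> g \<in> Hom A (P n) (Fn (n + 1))" by (rule comp_hom[OF g \<iota>_hom[OF n1]])
    show "scal A 2 (FD n \<cdot> \<iota> n) \<in> Hom A (P n) (Fn (n + 1))" by (rule scal_hom[OF D])
    have "\<iota> (n + 1) \<cdot> g \<cdot> \<epsilon> n = (\<iota> (n + 1) \<cdot> \<epsilon> (n + 1)) \<cdot> FT n (n + 1) (frag_of w) \<cdot> (\<iota> n \<cdot> \<epsilon> n)"
      unfolding g_def by (simp add: h)
    then have "\<iota> (n + 1) \<cdot> g \<cdot> \<epsilon> n = FW (n + 1) \<cdot> FT n (n + 1) (frag_of w) \<cdot> FW n"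
      using \<epsilon>[OF n] \<epsilon>[OF n1] by simp
    then show "\<iota> (n + 1) \<cdot> g \<cdot> \<epsilon> n = scal A 2 (FD n \<cdot> \<iota> n) \<cdot> \<epsilon> n"
      unfolding eq using scal_comp[OF \<epsilon>_hom[OF n] D] by simp
  qed
  moreover obtain k where k: "k \<in> Hom A (P n) (P (n + 1))" "scal A 2 k = g"
  proof -
    have "scal A 2 ` Hom A (P n) (P (n + 1)) = Hom A (P n) (P (n + 1))"
      using two P_obj[OF n] P_obj[OF n1] by (simp add: two_inverted_def bij_betw_def)
    then show ?thesis using that g by (metis imageE)
  qed
  ultimately have "scal A 2 (\<iota> (n + 1) \<cdot> k) = scal A 2 (FD n \<cdot> \<iota> n)"
    using comp_scal[OF k(1) \<iota>_hom[OF n1], of 2] by simp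
  moreover have "inj_on (scal A 2) (Hom A (P n) (Fn (n + 1)))"
    using two P_obj[OF n] Fn_obj[of "n + 1"] by (simp add: two_inverted_def bij_betw_def)
  ultimately have "\<iota> (n + 1) \<cdot> k = FD n \<cdot> \<iota> n"
    using comp_hom[OF k(1) \<iota>_hom[OF n1]] D by (meson inj_onD)
  then show ?thesis using k(1) by blast
qed

lemma induced_structure_exists:
  assumes "two_inverted A"
  shows "\<exists>d b. induced_structure A Fo Fm N P \<iota> d b"
proof -
  define d where "d n = (SOME h. h \<in> Hom A (P n) (P (n + 1)) \<and> \<iota> (n + 1) \<cdot> h = FD n \<cdot> \<iota> n)" for n
  define b where "b p q = (SOME h. h \<in> Hom A (P p \<odot> P q) (P (p + q)) \<and>
      \<iota> (p + q) \<cdot> h = FB p q \<cdot> (\<iota> p \<otimes>\<^sub>m \<iota> q))" for p q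
  have d: "d n \<in> Hom A (P n) (P (n + 1)) \<and> \<iota> (n + 1) \<cdot> d n = FD n \<cdot> \<iota> n" if "1 \<le> n" for n
    unfolding d_def by (rule someI_ex) (use differential_restricts[OF assms that] in blast)
  have b: "b p q \<in> Hom A (P p \<odot> P q) (P (p + q)) \<and> \<iota> (p + q) \<cdot> b p q = FB p q \<cdot> (\<iota> p \<otimes>\<^sub>m \<iota> q)"
    if "1 \<le> p" "1 \<le> q" for p q
    unfolding b_def by (rule someI_ex) (use bracket_restricts[OF that] in blast)
  have "induced_structure A Fo Fm N P \<iota> d b"
    unfolding induced_structure_def F_ext_f_elem using d b by blast
  then show ?thesis by blast
qed

end

section \<open>The identities of a differential graded Lie algebra on the images\<close>

locale induced_bracket = primitive_images A Fo Fm N P \<iota>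
  for A :: "('o, 'm, 'z) tensor_data_scheme" (structure)
    and Fo :: "nat set \<Rightarrow> 'o" and Fm :: "nat set \<Rightarrow> nat set \<Rightarrow> (nat \<Rightarrow> nat) \<Rightarrow> 'm"
    and N :: "nat set \<Rightarrow> nat set \<Rightarrow> 'm" and P :: "nat \<Rightarrow> 'o" and \<iota> :: "nat \<Rightarrow> 'm" +
  fixes d :: "nat \<Rightarrow> 'm" and b :: "nat \<Rightarrow> nat \<Rightarrow> 'm"
  assumes induced: "induced_structure A Fo Fm N P \<iota> d b"
begin

lemma d_hom: "1 \<le> n \<Longrightarrow> d n \<in> Hom A (P n) (P (n + 1))"
  and \<iota>_d: "1 \<le> n \<Longrightarrow> \<iota> (n + 1) \<cdot> d n = FD n \<cdot> \<iota> n"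
  using induced unfolding induced_structure_def F_ext_f_elem by blast+

lemma b_hom: "1 \<le> p \<Longrightarrow> 1 \<le> q \<Longrightarrow> b p q \<in> Hom A (P p \<odot> P q) (P (p + q))"
  and \<iota>_b: "1 \<le> p \<Longrightarrow> 1 \<le> q \<Longrightarrow> \<iota> (p + q) \<cdot> b p q = FB p q \<cdot> (\<iota> p \<otimes>\<^sub>m \<iota> q)"
  using induced unfolding induced_structure_def by blast+

lemma d_d:
  assumes n: "1 \<le> n" shows "d (n + 1) \<cdot> d n = Zer A (P n) (P (n + 2))"
proof -
  have n2: "1 \<le> n + 1" "1 \<le> n + 2" and e: "n + 1 + 1 = n + 2" by simp_all
  note h = HomD[OF d_hom[OF n]] HomD[OF d_hom[OF n2(1), unfolded e]] HomD[OF \<iota>_hom[OF n]]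
    HomD[OF \<iota>_hom[OF n2(1)]] HomD[OF \<iota>_hom[OF n2(2)]] HomD[OF FD_hom[of n]] HomD[OF FD_hom[of "n + 1", unfolded e]]
    arr_simps
  show ?thesis
  proof (rule \<iota>_cancel[OF n2(2)])
    show "d (n + 1) \<cdot> d n \<in> Hom A (P n) (P (n + 2))" by (rule HomI) (simp_all add: h del: add_2_eq_Suc')
    show "Zer A (P n) (P (n + 2)) \<in> Hom A (P n) (P (n + 2))" by (intro zer_hom P_obj n n2)
    have "\<iota> (n + 2) \<cdot> (d (n + 1) \<cdot> d n) = (\<iota> (n + 2) \<cdot> d (n + 1)) \<cdot> d n" by (simp add: h e del: add_2_eq_Suc')
    also have "\<dots> = FD (n + 1) \<cdot> (\<iota> (n + 1) \<cdot> d n)"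
      using \<iota>_d[OF n2(1), unfolded e] by (simp add: h e del: add_2_eq_Suc')
    also have "\<dots> = (FD (n + 1) \<cdot> FD n) \<cdot> \<iota> n"
      unfolding \<iota>_d[OF n] by (simp add: h e del: add_2_eq_Suc')
    also have "\<dots> = Zer A (P n) (Fn (n + 2))"
      unfolding FD_FD by (rule zer_comp[OF \<iota>_hom[OF n] Fn_obj])
    also have "\<dots> = \<iota> (n + 2) \<cdot> Zer A (P n) (P (n + 2))"
      by (rule comp_zer[symmetric, OF \<iota>_hom[OF n2(2)] P_obj[OF n]])
    finally show "\<iota> (n + 2) \<cdot> (d (n + 1) \<cdot> d n) = \<iota> (n + 2) \<cdot> Zer A (P n) (P (n + 2))" .
  qed
qed

lemma b_antisym:
  assumes p: "1 \<le> p" and q: "1 \<le> q"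
  shows "b p q = scal A (- ((- 1) ^ (p * q))) (b q p \<cdot> Comm A (P p) (P q))"
proof -
  let ?c = "- ((- 1) ^ (p * q)) :: int" and ?n = "p + q"
  have n: "1 \<le> ?n" using p by simp
  have qp: "b q p \<in> Hom A (P q \<odot> P p) (P ?n)" "\<iota> ?n \<cdot> b q p = FB q p \<cdot> (\<iota> q \<otimes>\<^sub>m \<iota> p)"
    "FB q p \<in> Hom A (Fn q \<odot> Fn p) (Fn ?n)"
    using b_hom[OF q p] \<iota>_b[OF q p] FB_hom[of q p] by (simp_all add: add.commute)
  have c: "Comm A (P p) (P q) \<in> Hom A (P p \<odot> P q) (P q \<odot> P p)"
    "Comm A (Fn p) (Fn q) \<in> Hom A (Fn p \<odot> Fn q) (Fn q \<odot> Fn p)"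
    using p q by (auto intro: comm_hom P_obj Fn_obj)
  have bc: "b q p \<cdot> Comm A (P p) (P q) \<in> Hom A (P p \<odot> P q) (P ?n)" by (rule comp_hom[OF c(1) qp(1)])
  have ii: "\<iota> p \<otimes>\<^sub>m \<iota> q \<in> Hom A (P p \<odot> P q) (Fn p \<odot> Fn q)" "\<iota> q \<otimes>\<^sub>m \<iota> p \<in> Hom A (P q \<odot> P p) (Fn q \<odot> Fn p)"
    using p q by (auto intro: ten_hom \<iota>_hom)
  note h = HomD[OF qp(1)] HomD[OF qp(3)] HomD[OF c(1)] HomD[OF c(2)] HomD[OF \<iota>_hom[OF n]] HomD[OF ii(1)]
    HomD[OF ii(2)] arr_simps
  show ?thesis
  proof (rule \<iota>_cancel[OF n b_hom[OF p q] scal_hom[OF bc]])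
    have "\<iota> ?n \<cdot> scal A ?c (b q p \<cdot> Comm A (P p) (P q)) = scal A ?c (\<iota> ?n \<cdot> b q p \<cdot> Comm A (P p) (P q))"
      using comp_scal[OF bc \<iota>_hom[OF n]] by (simp add: h)
    also have "\<iota> ?n \<cdot> b q p \<cdot> Comm A (P p) (P q) = FB q p \<cdot> (Comm A (Fn p) (Fn q) \<cdot> (\<iota> p \<otimes>\<^sub>m \<iota> q))"
      unfolding qp(2) comm_nat[OF \<iota>_hom[OF p] \<iota>_hom[OF q]] by (simp add: h)
    also have "\<dots> = FB q p \<cdot> Comm A (Fn p) (Fn q) \<cdot> (\<iota> p \<otimes>\<^sub>m \<iota> q)"
      by (simp add: h)
    also have "scal A ?c \<dots> = scal A ?c (FB q p \<cdot> Comm A (Fn p) (Fn q)) \<cdot> (\<iota> p \<otimes>\<^sub>m \<iota> q)"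
      by (rule scal_comp[symmetric, OF ii(1) comp_hom[OF c(2) qp(3)]])
    also have "\<dots> = \<iota> ?n \<cdot> b p q"
      unfolding FB_antisym[of p q, symmetric] \<iota>_b[OF p q] ..
    finally show "\<iota> ?n \<cdot> b p q = \<iota> ?n \<cdot> scal A ?c (b q p \<cdot> Comm A (P p) (P q))" ..
  qed
qed

lemma \<iota>_nested_right:
  assumes p: "1 \<le> p" and q: "1 \<le> q" and r: "1 \<le> r"
  shows "\<iota> (p + (q + r)) \<cdot> (b p (q + r) \<cdot> (Idt A (P p) \<otimes>\<^sub>m b q r) \<cdot> Asso A (P p) (P q) (P r)) =
    FB p (q + r) \<cdot> (Idt A (Fn p) \<otimes>\<^sub>m FB q r) \<cdot> Asso A (Fn p) (Fn q) (Fn r) \<cdot> ((\<iota> p \<otimes>\<^sub>m \<iota> q) \<otimes>\<^sub>m \<iota> r)"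
proof -
  have qr: "1 \<le> q + r" "1 \<le> p + (q + r)" using q by simp_all
  note h = HomD[OF b_hom[OF p qr(1)]] HomD[OF b_hom[OF q r]] HomD[OF \<iota>_hom[OF p]] HomD[OF \<iota>_hom[OF q]]
    HomD[OF \<iota>_hom[OF r]] HomD[OF \<iota>_hom[OF qr(1)]] HomD[OF \<iota>_hom[OF qr(2)]] HomD[OF FB_hom]
    HomD[OF asso_hom[OF Fn_obj Fn_obj Fn_obj]] HomD[OF asso_hom[OF P_obj[OF p] P_obj[OF q] P_obj[OF r]]]
    Fn_obj P_obj[OF p] arr_simps arr_ten arr_ten_comp arr_ten_comp'
  have "\<iota> (p + (q + r)) \<cdot> (b p (q + r) \<cdot> (Idt A (P p) \<otimes>\<^sub>m b q r) \<cdot> Asso A (P p) (P q) (P r))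
      = (\<iota> (p + (q + r)) \<cdot> b p (q + r)) \<cdot> (Idt A (P p) \<otimes>\<^sub>m b q r) \<cdot> Asso A (P p) (P q) (P r)"
    by (simp add: h)
  also have "\<dots> = FB p (q + r) \<cdot> (\<iota> p \<otimes>\<^sub>m (\<iota> (q + r) \<cdot> b q r)) \<cdot> Asso A (P p) (P q) (P r)"
    unfolding \<iota>_b[OF p qr(1)] by (simp add: h)
  also have "\<dots> = FB p (q + r) \<cdot> (Idt A (Fn p) \<otimes>\<^sub>m FB q r) \<cdot> ((\<iota> p \<otimes>\<^sub>m (\<iota> q \<otimes>\<^sub>m \<iota> r)) \<cdot> Asso A (P p) (P q) (P r))"
    unfolding \<iota>_b[OF q r] by (simp add: h)
  also have "\<dots> = FB p (q + r) \<cdot> (Idt A (Fn p) \<otimes>\<^sub>m FB q r) \<cdot> Asso A (Fn p) (Fn q) (Fn r) \<cdot> ((\<iota> p \<otimes>\<^sub>m \<iota> q) \<otimes>\<^sub>m \<iota> r)"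
    unfolding assoc_nat[OF \<iota>_hom[OF p] \<iota>_hom[OF q] \<iota>_hom[OF r], symmetric] by (simp add: h)
  finally show ?thesis .
qed

lemma \<iota>_nested_left:
  assumes p: "1 \<le> p" and q: "1 \<le> q" and r: "1 \<le> r"
  shows "\<iota> (p + q + r) \<cdot> (b (p + q) r \<cdot> (b p q \<otimes>\<^sub>m Idt A (P r))) =
    FB (p + q) r \<cdot> (FB p q \<otimes>\<^sub>m Idt A (Fn r)) \<cdot> ((\<iota> p \<otimes>\<^sub>m \<iota> q) \<otimes>\<^sub>m \<iota> r)"
proof -
  have pq: "1 \<le> p + q" "1 \<le> p + q + r" using q by simp_all
  note h = HomD[OF b_hom[OF pq(1) r]] HomD[OF b_hom[OF p q]] HomD[OF \<iota>_hom[OF p]] HomD[OF \<iota>_hom[OF q]]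
    HomD[OF \<iota>_hom[OF r]] HomD[OF \<iota>_hom[OF pq(1)]] HomD[OF \<iota>_hom[OF pq(2)]] HomD[OF FB_hom]
    Fn_obj P_obj[OF r] arr_simps arr_ten arr_ten_comp arr_ten_comp'
  have "\<iota> (p + q + r) \<cdot> (b (p + q) r \<cdot> (b p q \<otimes>\<^sub>m Idt A (P r)))
      = (\<iota> (p + q + r) \<cdot> b (p + q) r) \<cdot> (b p q \<otimes>\<^sub>m Idt A (P r))"
    by (simp add: h)
  also have "\<dots> = FB (p + q) r \<cdot> ((\<iota> (p + q) \<cdot> b p q) \<otimes>\<^sub>m \<iota> r)"
    unfolding \<iota>_b[OF pq(1) r] by (simp add: h)
  also have "\<dots> = FB (p + q) r \<cdot> (FB p q \<otimes>\<^sub>m Idt A (Fn r)) \<cdot> ((\<iota> p \<otimes>\<^sub>m \<iota> q) \<otimes>\<^sub>m \<iota> r)"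
    unfolding \<iota>_b[OF p q] by (simp add: h)
  finally show ?thesis .
qed


lemma b_jacobi:
  assumes p: "1 \<le> p" and q: "1 \<le> q" and r: "1 \<le> r"
  shows "b p (q + r) \<cdot> (Idt A (P p) \<otimes>\<^sub>m b q r) \<cdot> Asso A (P p) (P q) (P r) =
    b (p + q) r \<cdot> (b p q \<otimes>\<^sub>m Idt A (P r)) \<boxplus>
    scal A ((- 1) ^ (p * q)) (b q (p + r) \<cdot> (Idt A (P q) \<otimes>\<^sub>m b p r) \<cdot> Asso A (P q) (P p) (P r) \<cdot>
      (Comm A (P p) (P q) \<otimes>\<^sub>m Idt A (P r)))"
    (is "?R = ?L \<boxplus> scal A ?s ?C")
proof -
  let ?n = "p + q + r" and ?i = "(\<iota> p \<otimes>\<^sub>m \<iota> q) \<otimes>\<^sub>m \<iota> r"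
  let ?FR = "FB p (q + r) \<cdot> (Idt A (Fn p) \<otimes>\<^sub>m FB q r) \<cdot> Asso A (Fn p) (Fn q) (Fn r)"
  let ?FL = "FB (p + q) r \<cdot> (FB p q \<otimes>\<^sub>m Idt A (Fn r))"
  let ?FB = "FB q (p + r) \<cdot> (Idt A (Fn q) \<otimes>\<^sub>m FB p r) \<cdot> Asso A (Fn q) (Fn p) (Fn r)"
  let ?cF = "Comm A (Fn p) (Fn q) \<otimes>\<^sub>m Idt A (Fn r)" and ?cP = "Comm A (P p) (P q) \<otimes>\<^sub>m Idt A (P r)"
  let ?X = "(P p \<odot> P q) \<odot> P r" and ?Y = "(Fn p \<odot> Fn q) \<odot> Fn r"
  have n: "1 \<le> ?n" "1 \<le> p + q" "1 \<le> q + r" "1 \<le> p + r" using p q by simp_all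
  have e: "p + (q + r) = ?n" "q + (p + r) = ?n" by simp_all
  have obj: "P p \<in> Obj A" "P q \<in> Obj A" "P r \<in> Obj A" using p q r by (auto intro: P_obj)
  have i: "?i \<in> Hom A ?X ?Y" by (intro ten_hom \<iota>_hom p q r)
  have i': "(\<iota> q \<otimes>\<^sub>m \<iota> p) \<otimes>\<^sub>m \<iota> r \<in> Hom A ((P q \<odot> P p) \<odot> P r) ((Fn q \<odot> Fn p) \<odot> Fn r)"
    by (intro ten_hom \<iota>_hom p q r)
  have c: "?cF \<in> Hom A ?Y ((Fn q \<odot> Fn p) \<odot> Fn r)" "?cP \<in> Hom A ?X ((P q \<odot> P p) \<odot> P r)"
    using p q r by (auto intro!: ten_hom comm_hom id_hom obj Fn_obj)
  have R: "?R \<in> Hom A ?X (P ?n)"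
    using comp_hom[OF asso_hom[OF obj] comp_hom[OF ten_hom[OF id_hom[OF obj(1)] b_hom[OF q r]] b_hom[OF p n(3)]]]
    by (simp add: e HomD[OF b_hom[OF p n(3)]] HomD[OF b_hom[OF q r]] HomD[OF asso_hom[OF obj]] arr_simps arr_ten obj)
  have L: "?L \<in> Hom A ?X (P ?n)"
    by (rule comp_hom[OF ten_hom[OF b_hom[OF p q] id_hom[OF obj(3)]] b_hom[OF n(2) r]])
  let ?B = "b q (p + r) \<cdot> (Idt A (P q) \<otimes>\<^sub>m b p r) \<cdot> Asso A (P q) (P p) (P r)"
  have C0: "?B \<in> Hom A ((P q \<odot> P p) \<odot> P r) (P ?n)"
    using comp_hom[OF asso_hom[OF obj(2,1,3)] comp_hom[OF ten_hom[OF id_hom[OF obj(2)] b_hom[OF p r]] b_hom[OF q n(4)]]]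
    by (simp add: e HomD[OF b_hom[OF q n(4)]] HomD[OF b_hom[OF p r]] HomD[OF asso_hom[OF obj(2,1,3)]] arr_simps arr_ten obj)
  have C: "?C \<in> Hom A ?X (P ?n)" by (rule comp_hom[OF c(2) C0])
  have FL: "?FL \<in> Hom A ?Y (Fn ?n)"
    by (rule comp_hom[OF ten_hom[OF FB_hom id_hom[OF Fn_obj]] FB_hom])
  have FC0: "?FB \<in> Hom A ((Fn q \<odot> Fn p) \<odot> Fn r) (Fn ?n)"
  proof -
    have "?FB \<in> Hom A ((Fn q \<odot> Fn p) \<odot> Fn r) (Fn (q + (p + r)))"
      by (rule HomI) (simp_all add: HomD[OF FB_hom] HomD[OF asso_hom[OF Fn_obj Fn_obj Fn_obj]]
          arr_simps arr_ten Fn_obj)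
    then show ?thesis unfolding e .
  qed
  have FC: "?FB \<cdot> ?cF \<in> Hom A ?Y (Fn ?n)" by (rule comp_hom[OF c(1) FC0])
  have iR: "\<iota> ?n \<cdot> ?R = ?FR \<cdot> ?i" using \<iota>_nested_right[OF p q r] unfolding e .
  have iL: "\<iota> ?n \<cdot> ?L = ?FL \<cdot> ?i" using \<iota>_nested_left[OF p q r] .
  have iC: "\<iota> ?n \<cdot> ?C = (?FB \<cdot> ?cF) \<cdot> ?i"
  proof -
    have "\<iota> ?n \<cdot> ?C = (\<iota> ?n \<cdot> ?B) \<cdot> ?cP" by (rule comp_assoc[OF c(2) C0 \<iota>_hom[OF n(1)]])
    also have "\<dots> = ?FB \<cdot> ((\<iota> q \<otimes>\<^sub>m \<iota> p) \<otimes>\<^sub>m \<iota> r) \<cdot> ?cP"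
      using \<iota>_nested_right[OF q p r] unfolding e by simp
    also have "\<dots> = ?FB \<cdot> (((\<iota> q \<otimes>\<^sub>m \<iota> p) \<otimes>\<^sub>m \<iota> r) \<cdot> ?cP)" by (rule comp_assoc[symmetric, OF c(2) i' FC0])
    also have "((\<iota> q \<otimes>\<^sub>m \<iota> p) \<otimes>\<^sub>m \<iota> r) \<cdot> ?cP = ?cF \<cdot> ?i"
      using comm_nat[OF \<iota>_hom[OF p] \<iota>_hom[OF q]] HomD[OF \<iota>_hom[OF p]] HomD[OF \<iota>_hom[OF q]] HomD[OF \<iota>_hom[OF r]]
        HomD[OF comm_hom[OF obj(1,2)]] HomD[OF comm_hom[OF Fn_obj Fn_obj]]
      by (simp add: arr_simps arr_ten arr_ten_comp obj Fn_obj)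
    also have "?FB \<cdot> (?cF \<cdot> ?i) = (?FB \<cdot> ?cF) \<cdot> ?i" by (rule comp_assoc[OF i c(1) FC0])
    finally show ?thesis .
  qed
  show ?thesis
  proof (rule \<iota>_cancel[OF n(1) R add_hom[OF L scal_hom[OF C]]])
    have "\<iota> ?n \<cdot> ?R = (?FL \<boxplus> scal A ?s (?FB \<cdot> ?cF)) \<cdot> ?i"
      unfolding iR FB_jacobi[of p q r] ..
    also have "\<dots> = ?FL \<cdot> ?i \<boxplus> scal A ?s ((?FB \<cdot> ?cF) \<cdot> ?i)"
      using comp_add_left[OF i FL scal_hom[OF FC]] scal_comp[OF i FC] by simp
    also have "\<dots> = \<iota> ?n \<cdot> (?L \<boxplus> scal A ?s ?C)"
      unfolding iL[symmetric] iC[symmetric]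
      using comp_add_right[OF L scal_hom[OF C] \<iota>_hom[OF n(1)]] comp_scal[OF C \<iota>_hom[OF n(1)]] by simp
    finally show "\<iota> ?n \<cdot> ?R = \<iota> ?n \<cdot> (?L \<boxplus> scal A ?s ?C)" .
  qed
qed

lemma b_leibniz:
  assumes p: "1 \<le> p" and q: "1 \<le> q"
  shows "d (p + q) \<cdot> b p q = b (p + 1) q \<cdot> (d p \<otimes>\<^sub>m Idt A (P q)) \<boxplus>
    scal A ((- 1) ^ p) (b p (q + 1) \<cdot> (Idt A (P p) \<otimes>\<^sub>m d q))"
    (is "?D = ?L \<boxplus> scal A ?s ?R")
proof -
  let ?n = "p + q + 1" and ?i = "\<iota> p \<otimes>\<^sub>m \<iota> q"
  have n: "1 \<le> ?n" "1 \<le> p + q" "1 \<le> p + 1" "1 \<le> q + 1" using p by simp_all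
  have e: "p + 1 + q = ?n" "p + (q + 1) = ?n" by simp_all
  note obj = P_obj[OF p] P_obj[OF q]
  have i: "?i \<in> Hom A (P p \<odot> P q) (Fn p \<odot> Fn q)" by (intro ten_hom \<iota>_hom p q)
  have D: "?D \<in> Hom A (P p \<odot> P q) (P ?n)" by (rule comp_hom[OF b_hom[OF p q] d_hom[OF n(2)]])
  have L: "?L \<in> Hom A (P p \<odot> P q) (P ?n)"
    using comp_hom[OF ten_hom[OF d_hom[OF p] id_hom[OF obj(2)]] b_hom[OF n(3) q]] unfolding e .
  have R: "?R \<in> Hom A (P p \<odot> P q) (P ?n)"
    using comp_hom[OF ten_hom[OF id_hom[OF obj(1)] d_hom[OF q]] b_hom[OF p n(4)]] unfolding e .
  let ?FL = "FB (p + 1) q \<cdot> (FD p \<otimes>\<^sub>m Idt A (Fn q))" and ?FR = "FB p (q + 1) \<cdot> (Idt A (Fn p) \<otimes>\<^sub>m FD q)"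
  have "?FL \<in> Hom A (Fn p \<odot> Fn q) (Fn (p + 1 + q))" "?FR \<in> Hom A (Fn p \<odot> Fn q) (Fn (p + (q + 1)))"
    by (intro comp_hom[OF ten_hom FB_hom] FD_hom id_hom Fn_obj)+
  then have FL: "?FL \<in> Hom A (Fn p \<odot> Fn q) (Fn ?n)" and FR: "?FR \<in> Hom A (Fn p \<odot> Fn q) (Fn ?n)"
    unfolding e .
  note h = HomD[OF d_hom[OF p]] HomD[OF d_hom[OF q]] HomD[OF d_hom[OF n(2)]] HomD[OF b_hom[OF p q]]
    HomD[OF b_hom[OF n(3) q, unfolded e]] HomD[OF b_hom[OF p n(4), unfolded e]] HomD[OF \<iota>_hom[OF p]]
    HomD[OF \<iota>_hom[OF q]] HomD[OF \<iota>_hom[OF n(1)]] HomD[OF \<iota>_hom[OF n(2)]] HomD[OF \<iota>_hom[OF n(3)]]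
    HomD[OF \<iota>_hom[OF n(4)]] HomD[OF FD_hom] HomD[OF FB_hom] HomD[OF FB_hom[of "p + 1" q, unfolded e]]
    HomD[OF FB_hom[of p "q + 1", unfolded e]]
    obj Fn_obj arr_simps arr_ten arr_ten_comp arr_ten_comp'
  have iD: "\<iota> ?n \<cdot> ?D = (FD (p + q) \<cdot> FB p q) \<cdot> ?i"
  proof -
    have "\<iota> ?n \<cdot> ?D = (\<iota> ?n \<cdot> d (p + q)) \<cdot> b p q" by (simp add: h)
    also have "\<dots> = FD (p + q) \<cdot> (\<iota> (p + q) \<cdot> b p q)" unfolding \<iota>_d[OF n(2)] by (simp add: h)
    also have "\<dots> = (FD (p + q) \<cdot> FB p q) \<cdot> ?i" unfolding \<iota>_b[OF p q] by (simp add: h)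
    finally show ?thesis .
  qed
  have iL: "\<iota> ?n \<cdot> ?L = ?FL \<cdot> ?i"
  proof -
    have "\<iota> ?n \<cdot> ?L = (\<iota> ?n \<cdot> b (p + 1) q) \<cdot> (d p \<otimes>\<^sub>m Idt A (P q))" by (simp add: h)
    also have "\<dots> = FB (p + 1) q \<cdot> ((\<iota> (p + 1) \<cdot> d p) \<otimes>\<^sub>m \<iota> q)"
      unfolding \<iota>_b[OF n(3) q, unfolded e] by (simp add: h)
    also have "\<dots> = ?FL \<cdot> ?i" unfolding \<iota>_d[OF p] by (simp add: h)
    finally show ?thesis .
  qed
  have iR: "\<iota> ?n \<cdot> ?R = ?FR \<cdot> ?i"
  proof -
    have "\<iota> ?n \<cdot> ?R = (\<iota> ?n \<cdot> b p (q + 1)) \<cdot> (Idt A (P p) \<otimes>\<^sub>m d q)" by (simp add: h)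
    also have "\<dots> = FB p (q + 1) \<cdot> (\<iota> p \<otimes>\<^sub>m (\<iota> (q + 1) \<cdot> d q))"
      unfolding \<iota>_b[OF p n(4), unfolded e] by (simp add: h)
    also have "\<dots> = ?FR \<cdot> ?i" unfolding \<iota>_d[OF q] by (simp add: h)
    finally show ?thesis .
  qed
  show ?thesis
  proof (rule \<iota>_cancel[OF n(1) D add_hom[OF L scal_hom[OF R]]])
    have "\<iota> ?n \<cdot> ?D = ?FL \<cdot> ?i \<boxplus> scal A ?s (?FR \<cdot> ?i)"
      unfolding iD FB_leibniz using comp_add_left[OF i FL scal_hom[OF FR]] scal_comp[OF i FR] by simp
    also have "\<dots> = \<iota> ?n \<cdot> (?L \<boxplus> scal A ?s ?R)"
      unfolding iL[symmetric] iR[symmetric]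
      using comp_add_right[OF L scal_hom[OF R] \<iota>_hom[OF n(1)]] comp_scal[OF R \<iota>_hom[OF n(1)]] by simp
    finally show "\<iota> ?n \<cdot> ?D = \<iota> ?n \<cdot> (?L \<boxplus> scal A ?s ?R)" .
  qed
qed

lemma dg_Lie_algebra: "is_dg_Lie_algebra A P d b"
  unfolding is_dg_Lie_algebra_def
  by (intro conjI allI impI P_obj d_hom b_hom d_d b_antisym b_jacobi b_leibniz)

end

section \<open>Truncation\<close>

text \<open>Only the source and target of a differential and a bracket, with no identities. It shows that both
  sides of each identity of the truncation are parallel morphisms.\<close>

locale graded_bracket = additive_tensor_category A
  for A :: "('o, 'm, 'z) tensor_data_scheme" (structure) +
  fixes P :: "nat \<Rightarrow> 'o" and d :: "nat \<Rightarrow> 'm" and b :: "nat \<Rightarrow> nat \<Rightarrow> 'm"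
  assumes gr_obj: "1 \<le> n \<Longrightarrow> P n \<in> Obj A"
    and gr_d: "1 \<le> n \<Longrightarrow> d n \<in> Hom A (P n) (P (n + 1))"
    and gr_b: "1 \<le> p \<Longrightarrow> 1 \<le> q \<Longrightarrow> b p q \<in> Hom A (P p \<odot> P q) (P (p + q))"
begin

lemma d_d_hom:
  assumes "1 \<le> n" shows "d (n + 1) \<cdot> d n \<in> Hom A (P n) (P (n + 2))"
proof -
  have e: "n + 1 + 1 = n + 2" by simp
  show ?thesis using comp_hom[OF gr_d[OF assms] gr_d[of "n + 1", unfolded e]] by simp
qed

lemma antisym_hom:
  assumes "1 \<le> p" "1 \<le> q"
  shows "scal A c (b q p \<cdot> Comm A (P p) (P q)) \<in> Hom A (P p \<odot> P q) (P (p + q))"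
  using scal_hom[OF comp_hom[OF comm_hom[OF gr_obj[OF assms(1)] gr_obj[OF assms(2)]] gr_b[OF assms(2,1)]]]
  by (simp add: add.commute)

lemma nested_right_hom:
  assumes "1 \<le> p" "1 \<le> q" "1 \<le> r"
  shows "b p (q + r) \<cdot> (Idt A (P p) \<otimes>\<^sub>m b q r) \<cdot> Asso A (P p) (P q) (P r)
    \<in> Hom A ((P p \<odot> P q) \<odot> P r) (P (p + q + r))"
proof -
  have qr: "1 \<le> q + r" using assms by simp
  show ?thesis
    using comp_hom[OF asso_hom[OF gr_obj[OF assms(1)] gr_obj[OF assms(2)] gr_obj[OF assms(3)]]
      comp_hom[OF ten_hom[OF id_hom[OF gr_obj[OF assms(1)]] gr_b[OF assms(2,3)]] gr_b[OF assms(1) qr]]]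
    by (simp add: add.assoc)
qed

lemma nested_swapped_hom:
  assumes "1 \<le> p" "1 \<le> q" "1 \<le> r"
  shows "b q (p + r) \<cdot> (Idt A (P q) \<otimes>\<^sub>m b p r) \<cdot> Asso A (P q) (P p) (P r) \<cdot>
      (Comm A (P p) (P q) \<otimes>\<^sub>m Idt A (P r)) \<in> Hom A ((P p \<odot> P q) \<odot> P r) (P (p + q + r))"
  using comp_hom[OF ten_hom[OF comm_hom id_hom] nested_right_hom[OF assms(2,1,3)]] assms
  by (simp add: gr_obj ac_simps)

lemma nested_left_hom:
  assumes "1 \<le> p" "1 \<le> q" "1 \<le> r"
  shows "b (p + q) r \<cdot> (b p q \<otimes>\<^sub>m Idt A (P r)) \<in> Hom A ((P p \<odot> P q) \<odot> P r) (P (p + q + r))"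
  by (intro comp_hom[OF ten_hom[OF gr_b id_hom[OF gr_obj]] gr_b] assms) (use assms in simp)

lemma leibniz_hom:
  assumes "1 \<le> p" "1 \<le> q"
  shows "d (p + q) \<cdot> b p q \<in> Hom A (P p \<odot> P q) (P (p + q + 1))"
    and "b (p + 1) q \<cdot> (d p \<otimes>\<^sub>m Idt A (P q)) \<in> Hom A (P p \<odot> P q) (P (p + q + 1))"
    and "b p (q + 1) \<cdot> (Idt A (P p) \<otimes>\<^sub>m d q) \<in> Hom A (P p \<odot> P q) (P (p + q + 1))"
proof -
  have n: "1 \<le> p + q" "1 \<le> p + 1" "1 \<le> q + 1" using assms by simp_all
  show "d (p + q) \<cdot> b p q \<in> Hom A (P p \<odot> P q) (P (p + q + 1))"
    by (rule comp_hom[OF gr_b[OF assms] gr_d[OF n(1)]])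
  show "b (p + 1) q \<cdot> (d p \<otimes>\<^sub>m Idt A (P q)) \<in> Hom A (P p \<odot> P q) (P (p + q + 1))"
    using comp_hom[OF ten_hom[OF gr_d[OF assms(1)] id_hom[OF gr_obj[OF assms(2)]]] gr_b[OF n(2) assms(2)]]
    by (simp add: ac_simps)
  show "b p (q + 1) \<cdot> (Idt A (P p) \<otimes>\<^sub>m d q) \<in> Hom A (P p \<odot> P q) (P (p + q + 1))"
    using comp_hom[OF ten_hom[OF id_hom[OF gr_obj[OF assms(1)]] gr_d[OF assms(2)]] gr_b[OF assms(1) n(3)]]
    by (simp add: ac_simps)
qed

end

text \<open>In each identity the target has the highest degree that occurs. If it exceeds the bound, it is a zero
  object; otherwise the identity is the one that holds before truncation.\<close>

lemma (in additive_tensor_category) truncation_dg_Lie_algebra: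
  assumes dgl: "is_dg_Lie_algebra A P d b" and Z: "is_zero_object A Z"
  shows "is_dg_Lie_algebra A (trunc_obj Z M P) (trunc_diff A Z M P d) (trunc_bracket A Z M P b)"
proof -
  let ?P = "trunc_obj Z M P" and ?d = "trunc_diff A Z M P d" and ?b = "trunc_bracket A Z M P b"
  note D = dgl[unfolded is_dg_Lie_algebra_def]
  note D2 = D[THEN conjunct2, THEN conjunct2, THEN conjunct2]
  note dgl_d_d = D2[THEN conjunct1, rule_format]
    and dgl_antisym = D2[THEN conjunct2, THEN conjunct1, rule_format]
    and dgl_jacobi = D2[THEN conjunct2, THEN conjunct2, THEN conjunct1, rule_format]
    and dgl_leibniz = D2[THEN conjunct2, THEN conjunct2, THEN conjunct2, rule_format]
  have dgl_hom: "\<And>n. 1 \<le> n \<Longrightarrow> P n \<in> Obj A" "\<And>n. 1 \<le> n \<Longrightarrow> d n \<in> Hom A (P n) (P (n + 1))"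
    "\<And>p q. 1 \<le> p \<Longrightarrow> 1 \<le> q \<Longrightarrow> b p q \<in> Hom A (P p \<odot> P q) (P (p + q))"
    using D[THEN conjunct1] D[THEN conjunct2, THEN conjunct1]
      D[THEN conjunct2, THEN conjunct2, THEN conjunct1] by blast+
  have obj: "?P n \<in> Obj A" if "1 \<le> n" for n
    using that dgl_hom(1) Z by (simp add: trunc_obj_def is_zero_object_def)
  interpret T: graded_bracket A ?P ?d ?b
  proof
    show "?P n \<in> Obj A" if "1 \<le> n" for n by (rule obj[OF that])
    show "?d n \<in> Hom A (?P n) (?P (n + 1))" if "1 \<le> n" for n
      using dgl_hom(2)[OF that] zer_hom[OF obj[OF that] obj[of "n + 1"]]
      by (simp add: trunc_diff_def) (simp add: trunc_obj_def)
    show "?b p q \<in> Hom A (?P p \<odot> ?P q) (?P (p + q))" if "1 \<le> p" "1 \<le> q" for p q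
      using dgl_hom(3)[OF that] zer_hom[OF ten_obj[OF obj[OF that(1)] obj[OF that(2)]] obj[of "p + q"]] that
      by (simp add: trunc_bracket_def) (simp add: trunc_obj_def)
  qed
  have big: "f = g" if "f \<in> Hom A X (?P n)" "g \<in> Hom A X (?P n)" "\<not> n \<le> M" for f g X n
    using hom_to_zero_object[OF Z, of f X g] that by (simp add: trunc_obj_def)
  have small: "n \<le> M \<Longrightarrow> ?P n = P n" "n < M \<Longrightarrow> ?d n = d n" "p + q \<le> M \<Longrightarrow> ?b p q = b p q" for n p q
    by (simp_all add: trunc_obj_def trunc_diff_def trunc_bracket_def)
  have 1: "?d (n + 1) \<cdot> ?d n = Zer A (?P n) (?P (n + 2))" if n: "1 \<le> n" for n
  proof (cases "n + 2 \<le> M")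
    case True
    have s: "?d (n + 1) = d (n + 1)" "?d n = d n" "?P n = P n" "?P (n + 2) = P (n + 2)"
      using True by (simp_all add: small)
    show ?thesis unfolding s by (rule dgl_d_d[OF n])
  next
    case False
    show ?thesis
      by (rule big[OF T.d_d_hom[OF n] zer_hom[OF obj[OF n] obj] False]) simp
  qed
  have 2: "?b p q = scal A (- ((- 1) ^ (p * q))) (?b q p \<cdot> Comm A (?P p) (?P q))"
    if pq: "1 \<le> p" "1 \<le> q" for p q
  proof (cases "p + q \<le> M")
    case True
    have s: "?b p q = b p q" "?b q p = b q p" "?P p = P p" "?P q = P q"
      using True by (simp_all add: small)
    show ?thesis unfolding s by (rule dgl_antisym[OF pq])
  next
    case False
    show ?thesis by (rule big[OF T.gr_b[OF pq] T.antisym_hom[OF pq] False])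
  qed
  have 3: "?b p (q + r) \<cdot> (Idt A (?P p) \<otimes>\<^sub>m ?b q r) \<cdot> Asso A (?P p) (?P q) (?P r) =
      ?b (p + q) r \<cdot> (?b p q \<otimes>\<^sub>m Idt A (?P r)) \<boxplus>
      scal A ((- 1) ^ (p * q)) (?b q (p + r) \<cdot> (Idt A (?P q) \<otimes>\<^sub>m ?b p r) \<cdot> Asso A (?P q) (?P p) (?P r) \<cdot>
        (Comm A (?P p) (?P q) \<otimes>\<^sub>m Idt A (?P r)))"
    if pqr: "1 \<le> p" "1 \<le> q" "1 \<le> r" for p q r
  proof (cases "p + q + r \<le> M")
    case True
    have s: "?b p (q + r) = b p (q + r)" "?b q r = b q r" "?b (p + q) r = b (p + q) r" "?b p q = b p q"
      "?b q (p + r) = b q (p + r)" "?b p r = b p r" "?P p = P p" "?P q = P q" "?P r = P r"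
      using True by (simp_all add: small)
    show ?thesis unfolding s by (rule dgl_jacobi[OF pqr])
  next
    case False
    show ?thesis
      by (rule big[OF T.nested_right_hom[OF pqr]
            add_hom[OF T.nested_left_hom[OF pqr] scal_hom[OF T.nested_swapped_hom[OF pqr]]] False])
  qed
  have 4: "?d (p + q) \<cdot> ?b p q = ?b (p + 1) q \<cdot> (?d p \<otimes>\<^sub>m Idt A (?P q)) \<boxplus>
      scal A ((- 1) ^ p) (?b p (q + 1) \<cdot> (Idt A (?P p) \<otimes>\<^sub>m ?d q))"
    if pq: "1 \<le> p" "1 \<le> q" for p q
  proof (cases "p + q + 1 \<le> M")
    case True
    have s: "?d (p + q) = d (p + q)" "?b p q = b p q" "?b (p + 1) q = b (p + 1) q" "?d p = d p"
      "?b p (q + 1) = b p (q + 1)" "?d q = d q" "?P p = P p" "?P q = P q"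
      using True by (simp_all add: small)
    show ?thesis unfolding s by (rule dgl_leibniz[OF pq])
  next
    case False
    show ?thesis
      by (rule big[OF T.leibniz_hom(1)[OF pq]
            add_hom[OF T.leibniz_hom(2)[OF pq] scal_hom[OF T.leibniz_hom(3)[OF pq]]] False])
  qed
  show ?thesis
    unfolding is_dg_Lie_algebra_def by (intro conjI allI impI obj T.gr_d T.gr_b 1 2 3 4)
qed

theorem theorem3p5:
  fixes A :: "('o, 'm, 'z) tensor_data_scheme"
    and Fo :: "nat set \<Rightarrow> 'o"
    and Fm :: "nat set \<Rightarrow> nat set \<Rightarrow> (nat \<Rightarrow> nat) \<Rightarrow> 'm"
    and N :: "nat set \<Rightarrow> nat set \<Rightarrow> 'm"
  assumes "additive_tensor_category A"
    and "Q_Karoubian A"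
    and "two_inverted A"
    and "multiplicative_Fin_opp_functor A Fo Fm N"
  shows "(\<exists>P \<iota>. image_family A Fo Fm P \<iota>) \<and>
    (\<forall>P \<iota>. image_family A Fo Fm P \<iota> \<longrightarrow>
       (\<exists>d b. induced_structure A Fo Fm N P \<iota> d b) \<and>
       (\<forall>d b. induced_structure A Fo Fm N P \<iota> d b \<longrightarrow>
          is_dg_Lie_algebra A P d b \<and>
          (\<forall>M\<ge>1. \<forall>Z. is_zero_object A Z \<longrightarrow>
             is_dg_Lie_algebra A (trunc_obj Z M P) (trunc_diff A Z M P d)
               (trunc_bracket A Z M P b))))"
proof (intro conjI allI impI)
  interpret multiplicative_Fin_opp_functor A Fo Fm N by (rule assms(4))
  show "\<exists>P \<iota>. image_family A Fo Fm P \<iota>" by (rule images_exist[OF assms(2)])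
  fix P \<iota> assume im: "image_family A Fo Fm P \<iota>"
  then interpret primitive_images A Fo Fm N P \<iota> by unfold_locales
  show "\<exists>d b. induced_structure A Fo Fm N P \<iota> d b" by (rule induced_structure_exists[OF assms(3)])
  fix d b assume "induced_structure A Fo Fm N P \<iota> d b"
  then interpret induced_bracket A Fo Fm N P \<iota> d b by unfold_locales
  show "is_dg_Lie_algebra A P d b" by (rule dg_Lie_algebra)
  then show "is_dg_Lie_algebra A (trunc_obj Z M P) (trunc_diff A Z M P d) (trunc_bracket A Z M P b)"
    if "is_zero_object A Z" for M Z
    using that by (rule truncation_dg_Lie_algebra)
qed

end
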